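(* Let $K$ be a countable field and let $R\subset K$ be a sub-ring which is a large ideal domain (LID). Let $E\subset K$ satisfy $\bar d_{(F_N)}(E)>0$ for some double Følner sequence $(F_N)$ in $K$, and let $\epsilon>0$. Then the set $$\Big\{u\in R\setminus\{0\}:\ \bar d_{(F_N)}\big((E-u)\cap(E/u)\big)>\bar d_{(F_N)}(E)^2-\epsilon\Big\}$$ is $DC^*$ in $R$ and, in particular, affinely syndetic in $R$.
   Context: A ring $R$ is a large ideal domain (LID) if it is an infinite countable integral domain (commutative with $1$) such that for every $x\in R\setminus\{0\}$ the ideal $xR$ has finite index in $R$ as an additive subgroup. A double Følner sequence in $K$ is a sequence $(F_N)_{N\in\mathbb{N}}$ of finite nonempty subsets of $K$ such that for every $u\in K\setminus\{0\}$, $\lim_{N\to\infty}|F_N\cap(F_N+u)|/|F_N|=\lim_{N\to\infty}|F_N\cap(F_Nu)|/|F_N|=1$; $\bar d_{(F_N)}(E)=\limsup_{N\to\infty}|E\cap F_N|/|F_N|$. $E-u=\{x\in K:x+u\in E\}$, $E/u=\{x\in K:ux\in E\}$. Write $R^*=R\setminus\{0\}$. $\mathcal{A}_R$ is the semigroup under composition of all maps $R\to R$, $x\mapsto ux+v$, with $u\in R^*$, $v\in R$. A set $S\subset R$ is affinely syndetic in $R$ if there is a finite $F\subset\mathcal{A}_R$ such that for every $x\in R$ there is $g\in F$ with $g(x)\in S$. Ultrafilters: $\beta R$ is the set of ultrafilters on $R$ with the compact Hausdorff topology generated by the sets $\overline{E}=\{p\in\beta R:E\in p\}$, $E\subset R$;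 $\beta(R^* )=\{p\in\beta R: R^*\in p\}$. For $p,q\in\beta R$: $E\in p+q\iff\{u\in R:\{x\in R:x+u\in E\}\in q\}\in p$, and $E\in pq\iff\{u\in R:\{x\in R:ux\in E\}\in q\}\in p$. Elements of $R$ are identified with principal ultrafilters. A set $Y\subset\beta R$ is $S_A$-invariant if $u+p\in Y$ for all $p\in Y,u\in R$; $Y\subset\beta(R^* )$ is $S_M$-invariant if $up\in Y$ for all $p\in Y,u\in R^*$. $\mathcal{AMI}$ is the set of non-principal $p\in\beta R$ with $p+p=p$ that belong to a minimal nonempty compact $S_A$-invariant subset of $\beta R$; $\mathcal{MMI}$ is the set of non-principal $p\in\beta(R^* )$ with $pp=p$ that belong to a minimal nonempty compact $S_M$-invariant subset of $\beta(R^* )$. $\mathcal{G}=\overline{\mathcal{AMI}}\cap\mathcal{MMI}$ (closure in $\beta R$). A set $C\subset R$ is $DC$ if $C\in p$ for some $p\in\mathcal{G}$, and $DC^*$ if it has nonempty intersection with every $DC$ set (equivalently, $C\in p$ for all $p\in\mathcal{G}$). *)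

theory Defs
  imports "HOL-Analysis.Analysis"
begin

text \<open>Rings are subsets of an ambient type, with the operations of the type and the same unit.\<close>

definition is_subring :: "'a::comm_ring_1 set \<Rightarrow> bool" where
  "is_subring R \<longleftrightarrow> 0 \<in> R \<and> 1 \<in> R \<and>
     (\<forall>x\<in>R. - x \<in> R) \<and> (\<forall>x\<in>R. \<forall>y\<in>R. x + y \<in> R \<and> x * y \<in> R)"

definition additive_cosets :: "'a::comm_ring_1 set \<Rightarrow> 'a set \<Rightarrow> 'a set set" where
  "additive_cosets R H = (\<lambda>a. (\<lambda>y. a + y) ` H) ` R"

definition large_ideal_domain :: "'a::comm_ring_1 set \<Rightarrow> bool" where
  "large_ideal_domain R \<longleftrightarrow>
     is_subring R \<and>
     (\<forall>x\<in>R. \<forall>y\<in>R. x * y = 0 \<longrightarrow> x = 0 \<or> y = 0) \<and>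
     infinite R \<and> countable R \<and>
     (\<forall>x\<in>R - {0}. finite (additive_cosets R ((\<lambda>r. x * r) ` R)))"

definition double_Folner :: "(nat \<Rightarrow> 'a::field set) \<Rightarrow> bool" where
  "double_Folner F \<longleftrightarrow>
     (\<forall>N. finite (F N) \<and> F N \<noteq> {}) \<and>
     (\<forall>u. u \<noteq> 0 \<longrightarrow>
        (\<lambda>N. real (card (F N \<inter> (\<lambda>x. x + u) ` F N)) / real (card (F N))) \<longlonglongrightarrow> 1 \<and>
        (\<lambda>N. real (card (F N \<inter> (\<lambda>x. x * u) ` F N)) / real (card (F N))) \<longlonglongrightarrow> 1)"

text \<open>The limsup is taken in the extended reals, where it always exists; it lies in the
  interval from 0 to 1.\<close>

definition upper_density :: "(nat \<Rightarrow> 'a set) \<Rightarrow> 'a set \<Rightarrow> ereal" where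
  "upper_density F E = limsup (\<lambda>N. ereal (real (card (E \<inter> F N)) / real (card (F N))))"

definition shift_minus :: "'a::field set \<Rightarrow> 'a \<Rightarrow> 'a set" where
  "shift_minus E u = {x. x + u \<in> E}"

definition shift_divide :: "'a::field set \<Rightarrow> 'a \<Rightarrow> 'a set" where
  "shift_divide E u = {x. u * x \<in> E}"

text \<open>Maps from \<open>R\<close> to \<open>R\<close> are functions on the ambient type made undefined outside \<open>R\<close>.\<close>

definition affine_maps :: "'a::comm_ring_1 set \<Rightarrow> ('a \<Rightarrow> 'a) set" where
  "affine_maps R = {restrict (\<lambda>x. u * x + v) R | u v. u \<in> R - {0} \<and> v \<in> R}"

definition affinely_syndetic :: "'a::comm_ring_1 set \<Rightarrow> 'a set \<Rightarrow> bool" where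
  "affinely_syndetic R S \<longleftrightarrow>
     S \<subseteq> R \<and> (\<exists>G. finite G \<and> G \<subseteq> affine_maps R \<and> (\<forall>x\<in>R. \<exists>g\<in>G. g x \<in> S))"

definition ultrafilter_on :: "'a set \<Rightarrow> 'a set set \<Rightarrow> bool" where
  "ultrafilter_on X p \<longleftrightarrow>
     p \<subseteq> Pow X \<and> X \<in> p \<and> {} \<notin> p \<and>
     (\<forall>A\<in>p. \<forall>B\<in>p. A \<inter> B \<in> p) \<and>
     (\<forall>A\<in>p. \<forall>B. A \<subseteq> B \<and> B \<subseteq> X \<longrightarrow> B \<in> p) \<and>
     (\<forall>A. A \<subseteq> X \<longrightarrow> A \<in> p \<or> X - A \<in> p)"

definition beta :: "'a set \<Rightarrow> 'a set set set" where
  "beta X = {p. ultrafilter_on X p}"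

definition beta_clopen :: "'a set \<Rightarrow> 'a set \<Rightarrow> 'a set set set" where
  "beta_clopen X E = {p \<in> beta X. E \<in> p}"

definition beta_topology :: "'a set \<Rightarrow> 'a set set topology" where
  "beta_topology X = topology_generated_by {beta_clopen X E | E. E \<subseteq> X}"

lemma topspace_beta_topology [simp]: "topspace (beta_topology X) = beta X"
  by (auto simp: beta_topology_def topology_generated_by_topspace beta_clopen_def beta_def
      ultrafilter_on_def)

definition principal_ultrafilter :: "'a set \<Rightarrow> 'a \<Rightarrow> 'a set set" where
  "principal_ultrafilter X x = {E. E \<subseteq> X \<and> x \<in> E}"

definition nonprincipal :: "'a set \<Rightarrow> 'a set set \<Rightarrow> bool" where
  "nonprincipal X p \<longleftrightarrow> (\<forall>x\<in>X. p \<noteq> principal_ultrafilter X x)"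

definition beta_plus :: "'a::comm_ring_1 set \<Rightarrow> 'a set set \<Rightarrow> 'a set set \<Rightarrow> 'a set set" where
  "beta_plus R p q = {E. E \<subseteq> R \<and> {u \<in> R. {x \<in> R. x + u \<in> E} \<in> q} \<in> p}"

definition beta_times :: "'a::comm_ring_1 set \<Rightarrow> 'a set set \<Rightarrow> 'a set set \<Rightarrow> 'a set set" where
  "beta_times R p q = {E. E \<subseteq> R \<and> {u \<in> R. {x \<in> R. u * x \<in> E} \<in> q} \<in> p}"

text \<open>The ultrafilters on the nonzero elements are regarded as
  points of \<open>beta R\<close>.\<close>

definition beta_star :: "'a::comm_ring_1 set \<Rightarrow> 'a set set set" where
  "beta_star R = {p \<in> beta R. R - {0} \<in> p}"

definition SA_invariant :: "'a::comm_ring_1 set \<Rightarrow> 'a set set set \<Rightarrow> bool" where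
  "SA_invariant R Y \<longleftrightarrow>
     Y \<subseteq> beta R \<and> (\<forall>p\<in>Y. \<forall>u\<in>R. beta_plus R (principal_ultrafilter R u) p \<in> Y)"

definition SM_invariant :: "'a::comm_ring_1 set \<Rightarrow> 'a set set set \<Rightarrow> bool" where
  "SM_invariant R Y \<longleftrightarrow>
     Y \<subseteq> beta_star R \<and>
     (\<forall>p\<in>Y. \<forall>u\<in>R - {0}. beta_times R (principal_ultrafilter R u) p \<in> Y)"

definition minimal_set :: "('a set \<Rightarrow> bool) \<Rightarrow> 'a set \<Rightarrow> bool" where
  "minimal_set P Y \<longleftrightarrow> P Y \<and> (\<forall>Z. P Z \<and> Z \<subseteq> Y \<longrightarrow> Z = Y)"

definition minimal_SA :: "'a::comm_ring_1 set \<Rightarrow> 'a set set set \<Rightarrow> bool" where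
  "minimal_SA R =
     minimal_set (\<lambda>Y. Y \<noteq> {} \<and> compactin (beta_topology R) Y \<and> SA_invariant R Y)"

definition minimal_SM :: "'a::comm_ring_1 set \<Rightarrow> 'a set set set \<Rightarrow> bool" where
  "minimal_SM R =
     minimal_set (\<lambda>Y. Y \<noteq> {} \<and> compactin (beta_topology R) Y \<and> SM_invariant R Y)"

definition AMI :: "'a::comm_ring_1 set \<Rightarrow> 'a set set set" where
  "AMI R = {p \<in> beta R. nonprincipal R p \<and> beta_plus R p p = p \<and>
                        (\<exists>Y. minimal_SA R Y \<and> p \<in> Y)}"

definition MMI :: "'a::comm_ring_1 set \<Rightarrow> 'a set set set" where
  "MMI R = {p \<in> beta_star R. nonprincipal R p \<and> beta_times R p p = p \<and>
                             (\<exists>Y. minimal_SM R Y \<and> p \<in> Y)}"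

definition DC_ultrafilters :: "'a::comm_ring_1 set \<Rightarrow> 'a set set set" where
  "DC_ultrafilters R = (beta_topology R closure_of AMI R) \<inter> MMI R"

definition DC :: "'a::comm_ring_1 set \<Rightarrow> 'a set \<Rightarrow> bool" where
  "DC R C \<longleftrightarrow> C \<subseteq> R \<and> (\<exists>p\<in>DC_ultrafilters R. C \<in> p)"

definition DC_star :: "'a::comm_ring_1 set \<Rightarrow> 'a set \<Rightarrow> bool" where
  "DC_star R C \<longleftrightarrow> C \<subseteq> R \<and> (\<forall>D. DC R D \<longrightarrow> C \<inter> D \<noteq> {})"

end

theory Submission
  imports Defs
begin

text \<open>
  Passing to an ultralimit of averages over \<open>F\<close> turns the upper density of \<open>E\<close> into an invariant mean, and
  hence the bounded functions on \<open>K\<close> into a semi-inner product space on which \<open>A\<^sub>u f(x) = f(x + u)\<close> and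
  \<open>M\<^sub>u f(x) = f(ux)\<close> act isometrically. It suffices that
  \<open>p-lim\<^sub>u \<langle>A\<^sub>u f, M\<^sub>u f\<rangle> \<ge> \<langle>f, 1\<rangle>\<^sup>2\<close> for every \<open>p \<in> \<G>\<close>.
  For all minimal additive idempotents \<open>p\<close> the weak limit of \<open>A\<^sub>u\<close> is one and the same idempotent \<open>V\<close>, because the
  coefficients of the representation see \<open>\<beta>R\<close> as a commutative semigroup; this extends to the
  closure, and \<open>R\<close> being a large ideal domain, it also holds for \<open>A\<^sub>c\<^sub>u\<close> with \<open>c \<noteq> 0\<close>.
  If \<open>V w = 0\<close>, a van der Corput argument for the multiplicative idempotent \<open>p\<close> applied to
  \<open>M\<^sub>u\<^sup>-\<^sup>1 A\<^sub>u w\<close> shows \<open>p-lim\<^sub>u \<langle>A\<^sub>u w, M\<^sub>u f\<rangle> = 0\<close>;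
  if \<open>V h = h\<close>, then \<open>A\<^sub>u h\<close> tends to \<open>h\<close> in norm and \<open>p-lim\<^sub>u \<langle>h, M\<^sub>u h\<rangle> \<ge> \<langle>h, 1\<rangle>\<^sup>2\<close>.
  The space is not complete, so \<open>V f\<close> is replaced by an approximating vector \<open>h\<close>.
  Finally, a set that is not affinely syndetic has an affinely thick complement, and the
  ultrafilters all of whose affine images contain the complement form a closed affinely invariant set,
  which therefore meets \<open>\<G>\<close>.
\<close>

section \<open>Ultrafilters on a set\<close>

text \<open>The obstacle is that one \<open>u\<close> drives an additive and a multiplicative action
  at once. For \<open>a u = M (inverse u) (A u w)\<close> the affine relation turns the correlation
  of \<open>a (b * u)\<close> with \<open>a u\<close> into that of
  \<open>A ((1 - b * b) * u) w\<close> with \<open>M (inverse b) w\<close>: a purely additive limit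
  in \<open>u\<close>, but along a dilated index. Hence limits of \<open>A (c * u)\<close> must
  agree for all nonzero \<open>c\<close> in \<open>R\<close>. Finite index supplies this: for each
  such \<open>c\<close> every ultrafilter is a translate of a dilate by \<open>c\<close>, so
  dilation preserves minimality. The functions live on the field so that
  \<open>M (inverse u)\<close> makes sense. Commutativity of the coefficients is Grothendieck's
  exchange of iterated limits. The van der Corput step uses no averages: an idempotent yields
  arbitrarily many vectors with prescribed pairwise correlations, and large Gram matrices with
  bounded diagonal cannot have all other entries below a fixed negative number. As
  \<open>V f\<close> is only approximated, each exact statement becomes an estimate whose error
  vanishes with \<delta>; only the final bound is sent to the limit.\<close>

lemma ultrafilter_onD:
  assumes "ultrafilter_on X p"
  shows "A \<in> p \<Longrightarrow> A \<subseteq> X" "X \<in> p" "{} \<notin> p" "A \<in> p \<Longrightarrow> B \<in> p \<Longrightarrow> A \<inter> B \<in> p"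
    "A \<in> p \<Longrightarrow> A \<subseteq> B \<Longrightarrow> B \<subseteq> X \<Longrightarrow> B \<in> p" "A \<subseteq> X \<Longrightarrow> X - A \<in> p \<longleftrightarrow> A \<notin> p"
proof -
  note u = assms[unfolded ultrafilter_on_def]
  show "A \<in> p \<Longrightarrow> A \<subseteq> X" "X \<in> p" "{} \<notin> p" "A \<in> p \<Longrightarrow> B \<in> p \<Longrightarrow> A \<inter> B \<in> p"
    using u by auto
  show "A \<in> p \<Longrightarrow> A \<subseteq> B \<Longrightarrow> B \<subseteq> X \<Longrightarrow> B \<in> p"
    using u by auto
  show "A \<subseteq> X \<Longrightarrow> X - A \<in> p \<longleftrightarrow> A \<notin> p"
    using u by (metis Diff_disjoint)
qed

lemma beta_iff: "p \<in> beta X \<longleftrightarrow> ultrafilter_on X p"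
  by (simp add: beta_def)

lemmas betaD = ultrafilter_onD[OF beta_iff[THEN iffD1]]

lemma beta_subset_imp_eq:
  assumes "p \<in> beta X" "q \<in> beta X" "p \<subseteq> q"
  shows "p = q"
proof
  show "q \<subseteq> p"
  proof
    fix E assume E: "E \<in> q"
    then have "E \<subseteq> X" using betaD(1)[OF assms(2)] by simp
    then show "E \<in> p" using E betaD(6)[OF assms(1)] betaD(6)[OF assms(2)] assms(3) by auto
  qed
qed (rule assms)

text \<open>Zorn's lemma for intersection-closed families without the empty set. A maximal one
  contains every subset of \<open>X\<close> that meets all its members (\<open>in_M\<close>), and
  this single property yields the remaining ultrafilter axioms.\<close>

lemma beta_extend:
  assumes sub: "\<Phi> \<subseteq> Pow X" and int: "\<And>A B. A \<in> \<Phi> \<Longrightarrow> B \<in> \<Phi> \<Longrightarrow> A \<inter> B \<in> \<Phi>"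
    and ne: "{} \<notin> \<Phi>" and "\<Phi> \<noteq> {}"
  obtains p where "p \<in> beta X" "\<Phi> \<subseteq> p"
proof -
  define \<A> where "\<A> = {Q. \<Phi> \<subseteq> Q \<and> Q \<subseteq> Pow X \<and> (\<forall>A\<in>Q. \<forall>B\<in>Q. A \<inter> B \<in> Q) \<and> {} \<notin> Q}"
  have "\<exists>M\<in>\<A>. \<forall>Q\<in>\<A>. M \<subseteq> Q \<longrightarrow> Q = M"
  proof (rule subset_Zorn_nonempty)
    have "\<Phi> \<in> \<A>" using sub int ne unfolding \<A>_def by simp
    then show "\<A> \<noteq> {}" by blast
    fix \<C> assume C: "\<C> \<noteq> {}" "subset.chain \<A> \<C>"
    have "A \<inter> B \<in> \<Union>\<C>" if AB: "A \<in> \<Union>\<C>" "B \<in> \<Union>\<C>" for A B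
    proof -
      obtain P Q where PQ: "A \<in> P" "P \<in> \<C>" "B \<in> Q" "Q \<in> \<C>"
        using AB by blast
      then have "P \<subseteq> Q \<or> Q \<subseteq> P" using C unfolding subset_chain_def by auto
      moreover have "P \<in> \<A>" "Q \<in> \<A>" using PQ C unfolding subset_chain_def by auto
      ultimately obtain S where "S \<in> \<C>" "S \<in> \<A>" "A \<in> S" "B \<in> S"
        using PQ by blast
      then have "A \<inter> B \<in> S" unfolding \<A>_def by simp
      then show ?thesis using \<open>S \<in> \<C>\<close> by blast
    qed
    then show "\<Union>\<C> \<in> \<A>"
    proof -
      assume *: "\<And>A B. A \<in> \<Union>\<C> \<Longrightarrow> B \<in> \<Union>\<C> \<Longrightarrow> A \<inter> B \<in> \<Union>\<C>"
      have S: "\<Phi> \<subseteq> S" "S \<subseteq> Pow X" "{} \<notin> S" if "S \<in> \<C>" for S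
      proof -
        have "S \<in> \<A>" using C that unfolding subset_chain_def by (meson subsetD)
        then show "\<Phi> \<subseteq> S" "S \<subseteq> Pow X" "{} \<notin> S" unfolding \<A>_def by simp_all
      qed
      obtain S where "S \<in> \<C>" using C(1) by auto
      then have "\<Phi> \<subseteq> \<Union>\<C>" by (intro subset_trans[OF S(1) Union_upper])
      moreover have "\<Union>\<C> \<subseteq> Pow X" using S(2) by (rule Union_least)
      moreover have "{} \<notin> \<Union>\<C>" using S(3) by simp
      ultimately show ?thesis using * unfolding \<A>_def by simp
    qed
  qed
  then obtain M where M: "M \<in> \<A>" and max: "\<And>Q. Q \<in> \<A> \<Longrightarrow> M \<subseteq> Q \<Longrightarrow> Q = M" by blast
  have M': "\<Phi> \<subseteq> M" "M \<subseteq> Pow X" "{} \<notin> M" "\<And>A B. A \<in> M \<Longrightarrow> B \<in> M \<Longrightarrow> A \<inter> B \<in> M"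
    using M by (auto simp: \<A>_def)
  have in_M: "A \<in> M" if A: "A \<subseteq> X" "\<And>B. B \<in> M \<Longrightarrow> A \<inter> B \<noteq> {}" for A
  proof -
    define Q where "Q = {C. C \<subseteq> X \<and> (\<exists>B\<in>M. A \<inter> B \<subseteq> C)}"
    have "C \<inter> D \<in> Q" if CD: "C \<in> Q" "D \<in> Q" for C D
    proof -
      obtain B B' where "C \<subseteq> X" "D \<subseteq> X" "B \<in> M" "B' \<in> M" "A \<inter> B \<subseteq> C" "A \<inter> B' \<subseteq> D"
        using CD unfolding Q_def by auto
      moreover from this have "B \<inter> B' \<in> M" using M' by auto
      moreover from calculation have "A \<inter> (B \<inter> B') \<subseteq> C \<inter> D" "C \<inter> D \<subseteq> X" by auto
      ultimately show ?thesis unfolding Q_def mem_Collect_eq by metis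
    qed
    moreover have "M \<subseteq> Q" using M'(2) unfolding Q_def by auto
    moreover have "{} \<notin> Q" using A(2) unfolding Q_def by auto
    moreover have "Q \<subseteq> Pow X" unfolding Q_def by auto
    moreover have "\<Phi> \<subseteq> Q" using M'(1) \<open>M \<subseteq> Q\<close> by (rule subset_trans)
    ultimately have "Q \<in> \<A>" unfolding \<A>_def by simp
    then have "Q = M" using \<open>M \<subseteq> Q\<close> by (rule max)
    moreover have "A \<in> Q" using A(1) \<open>\<Phi> \<noteq> {}\<close> M'(1) unfolding Q_def by auto
    ultimately show ?thesis by simp
  qed
  have "ultrafilter_on X M"
    unfolding ultrafilter_on_def
  proof (intro conjI ballI allI impI)
    show "M \<subseteq> Pow X" "{} \<notin> M" using M' by auto
    show "X \<in> M"
    proof (rule in_M)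
      fix B assume "B \<in> M"
      then have "B \<subseteq> X" "B \<noteq> {}" using M'(2,3) by auto
      then show "X \<inter> B \<noteq> {}" by auto
    qed simp
    show "A \<inter> B \<in> M" if "A \<in> M" "B \<in> M" for A B using that M' by auto
    show "B \<in> M" if "A \<in> M" "A \<subseteq> B \<and> B \<subseteq> X" for A B
    proof (rule in_M)
      fix C assume "C \<in> M"
      then have "A \<inter> C \<in> M" using that(1) M'(4) by simp
      then have "A \<inter> C \<noteq> {}" using M'(3) by metis
      then show "B \<inter> C \<noteq> {}" using that(2) by auto
    qed (use that in auto)
    show "A \<in> M \<or> X - A \<in> M" if "A \<subseteq> X" for A
    proof (rule disjCI)
      assume "X - A \<notin> M"
      then obtain B where B: "B \<in> M" "(X - A) \<inter> B = {}" using in_M[of "X - A"] by auto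
      then have "B \<subseteq> A" using M'(2) by auto
      show "A \<in> M"
      proof (rule in_M[OF that])
        fix C assume "C \<in> M"
        then have "B \<inter> C \<in> M" using B(1) M'(4) by simp
        then have "B \<inter> C \<noteq> {}" using M'(3) by metis
        then show "A \<inter> C \<noteq> {}" using \<open>B \<subseteq> A\<close> by auto
      qed
    qed
  qed
  then show ?thesis using that M' by (auto simp: beta_def)
qed

lemma beta_Inter_mem:
  assumes "p \<in> beta X" "finite \<F>" "\<And>A. A \<in> \<F> \<Longrightarrow> A \<in> p"
  shows "X \<inter> \<Inter>\<F> \<in> p"
  using assms(2,3)
proof induction
  case empty
  then show ?case using betaD(2)[OF assms(1)] by simp
next
  case (insert A \<F>)
  then have "A \<in> p" "X \<inter> \<Inter>\<F> \<in> p" by auto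
  then have "A \<inter> (X \<inter> \<Inter>\<F>) \<in> p" by (rule betaD(4)[OF assms(1)])
  then show ?case by (simp add: Int_left_commute)
qed

lemma beta_nonempty_mem: "p \<in> beta X \<Longrightarrow> A \<in> p \<Longrightarrow> A \<noteq> {}"
  using betaD(3) by blast

lemma principal_in_beta: "x \<in> X \<Longrightarrow> principal_ultrafilter X x \<in> beta X"
  by (auto simp: principal_ultrafilter_def beta_def ultrafilter_on_def)

lemma beta_eq_principal:
  assumes "p \<in> beta X" "{x} \<in> p"
  shows "p = principal_ultrafilter X x"
proof -
  have "x \<in> X" using betaD(1)[OF assms] by simp
  moreover have "principal_ultrafilter X x \<subseteq> p"
    using assms betaD(5)[OF assms(1) assms(2)] by (auto simp: principal_ultrafilter_def)
  ultimately show ?thesis using assms beta_subset_imp_eq principal_in_beta by metis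
qed

lemma nonprincipal_iff:
  assumes "p \<in> beta X"
  shows "nonprincipal X p \<longleftrightarrow> (\<forall>x\<in>X. X - {x} \<in> p)"
proof -
  have "p = principal_ultrafilter X x \<longleftrightarrow> {x} \<in> p" if "x \<in> X" for x
  proof
    show "{x} \<in> p" if "p = principal_ultrafilter X x"
      using that \<open>x \<in> X\<close> by (simp add: principal_ultrafilter_def)
  qed (rule beta_eq_principal[OF assms])
  then show ?thesis unfolding nonprincipal_def using betaD(6)[OF assms] by auto
qed

lemma nonprincipal_cofinite:
  assumes "p \<in> beta X" "nonprincipal X p" "finite A"
  shows "X - A \<in> p"
proof -
  have "X \<inter> \<Inter>((\<lambda>x. X - {x}) ` (A \<inter> X)) \<in> p"
    using assms by (intro beta_Inter_mem) (auto simp: nonprincipal_iff)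
  also have "X \<inter> \<Inter>((\<lambda>x. X - {x}) ` (A \<inter> X)) = X - A" by auto
  finally show ?thesis .
qed

section \<open>The topology of \<open>beta X\<close>: closed sets, compactness, minimal closed
  sets\<close>

lemma openin_beta_topology:
  "openin (beta_topology X) U \<longleftrightarrow> U \<subseteq> beta X \<and> (\<forall>p\<in>U. \<exists>E\<in>p. beta_clopen X E \<subseteq> U)"
proof
  assume "openin (beta_topology X) U"
  then have "generate_topology_on {beta_clopen X E | E. E \<subseteq> X} U"
    by (simp add: beta_topology_def openin_topology_generated_by_iff)
  then show "U \<subseteq> beta X \<and> (\<forall>p\<in>U. \<exists>E\<in>p. beta_clopen X E \<subseteq> U)"
  proof induction
    case (Int A B)
    have "\<exists>E\<in>p. beta_clopen X E \<subseteq> A \<inter> B" if "p \<in> A \<inter> B" for p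
    proof -
      have "p \<in> A" "p \<in> B" using that by auto
      then obtain E E' where E: "E \<in> p" "E' \<in> p" "beta_clopen X E \<subseteq> A" "beta_clopen X E' \<subseteq> B"
        using Int.IH by metis
      have p: "p \<in> beta X" using \<open>p \<in> A\<close> Int.IH by auto
      have "E \<inter> E' \<in> p" using betaD(4)[OF p] E by simp
      \<comment> \<open>Basic sets are closed under intersection, so the generators are already a
        base.\<close>
      moreover have "beta_clopen X (E \<inter> E') \<subseteq> A \<inter> B"
      proof
        fix q assume "q \<in> beta_clopen X (E \<inter> E')"
        then have q: "q \<in> beta X" "E \<inter> E' \<in> q" by (auto simp: beta_clopen_def)
        then have "E \<in> q" "E' \<in> q"
          using betaD(5)[OF q(1,2)] betaD(1)[OF p] E by auto
        then show "q \<in> A \<inter> B" using E q by (auto simp: beta_clopen_def)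
      qed
      ultimately show ?thesis by blast
    qed
    then show ?case using Int by blast
  next
    case (UN K)
    show ?case
    proof (intro conjI ballI)
      show "\<Union>K \<subseteq> beta X" using UN.IH by auto
      fix p assume "p \<in> \<Union>K"
      then obtain V where V: "V \<in> K" "p \<in> V" by auto
      then obtain E where "E \<in> p" "beta_clopen X E \<subseteq> V" using UN.IH by metis
      then show "\<exists>E\<in>p. beta_clopen X E \<subseteq> \<Union>K" using V by auto
    qed
  next
    case (Basis s)
    then show ?case by (auto simp: beta_clopen_def)
  qed auto
next
  assume U: "U \<subseteq> beta X \<and> (\<forall>p\<in>U. \<exists>E\<in>p. beta_clopen X E \<subseteq> U)"
  then have "U = \<Union>{beta_clopen X E | E. E \<subseteq> X \<and> beta_clopen X E \<subseteq> U}"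
  proof (intro equalityI subsetI)
    fix p assume "p \<in> U"
    moreover from this U obtain E where "E \<in> p" "beta_clopen X E \<subseteq> U" by metis
    moreover from \<open>p \<in> U\<close> U have "p \<in> beta X" by blast
    moreover from \<open>p \<in> beta X\<close> \<open>E \<in> p\<close> have "E \<subseteq> X" by (rule betaD(1))
    ultimately show "p \<in> \<Union>{beta_clopen X E | E. E \<subseteq> X \<and> beta_clopen X E \<subseteq> U}"
      by (auto simp: beta_clopen_def)
  qed auto
  moreover have "openin (beta_topology X) (beta_clopen X E)" if "E \<subseteq> X" for E
    using that unfolding beta_topology_def by (intro topology_generated_by_Basis) auto
  then have "openin (beta_topology X) (\<Union>{beta_clopen X E | E. E \<subseteq> X \<and> beta_clopen X E \<subseteq> U})"
    by (intro openin_Union) auto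
  ultimately show "openin (beta_topology X) U" by simp
qed

text \<open>Adherence is expressed by membership alone, basic neighbourhoods of \<open>p\<close>
  being given by the members of \<open>p\<close>. \<open>compactin_beta_iff\<close> identifies this
  with compactness, so that minimal compact invariant sets can be handled without open
  covers.\<close>

definition beta_closed :: "'a set \<Rightarrow> 'a set set set \<Rightarrow> bool" where
  "beta_closed X Y \<longleftrightarrow> Y \<subseteq> beta X \<and> (\<forall>p\<in>beta X. (\<forall>E\<in>p. \<exists>q\<in>Y. E \<in> q) \<longrightarrow> p \<in> Y)"

lemma beta_closedI:
  assumes "Y \<subseteq> beta X" "\<And>p. p \<in> beta X \<Longrightarrow> (\<And>E. E \<in> p \<Longrightarrow> \<exists>q\<in>Y. E \<in> q) \<Longrightarrow> p \<in> Y"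
  shows "beta_closed X Y"
  using assms by (auto simp: beta_closed_def)

lemma beta_closedD:
  assumes "beta_closed X Y"
  shows "Y \<subseteq> beta X" "p \<in> beta X \<Longrightarrow> (\<And>E. E \<in> p \<Longrightarrow> \<exists>q\<in>Y. E \<in> q) \<Longrightarrow> p \<in> Y"
  using assms by (auto simp: beta_closed_def)

lemma in_closure_of_beta:
  assumes "Y \<subseteq> beta X"
  shows "p \<in> beta_topology X closure_of Y \<longleftrightarrow> p \<in> beta X \<and> (\<forall>E\<in>p. \<exists>q\<in>Y. E \<in> q)"
proof
  assume p: "p \<in> beta_topology X closure_of Y"
  have "\<exists>q\<in>Y. E \<in> q" if "E \<in> p" for E
  proof -
    have "p \<in> beta X" using p by (simp add: in_closure_of)
    then have "p \<in> beta_clopen X E" using that by (auto simp: beta_clopen_def)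
    moreover have "openin (beta_topology X) (beta_clopen X E)"
      by (auto simp: openin_beta_topology beta_clopen_def)
    ultimately obtain q where "q \<in> Y" "q \<in> beta_clopen X E" using p unfolding in_closure_of by metis
    then show ?thesis by (auto simp: beta_clopen_def)
  qed
  then show "p \<in> beta X \<and> (\<forall>E\<in>p. \<exists>q\<in>Y. E \<in> q)"
    using p by (simp add: in_closure_of)
next
  assume p: "p \<in> beta X \<and> (\<forall>E\<in>p. \<exists>q\<in>Y. E \<in> q)"
  have "\<exists>q\<in>Y. q \<in> T" if T: "p \<in> T" "openin (beta_topology X) T" for T
  proof -
    obtain E where E: "E \<in> p" "beta_clopen X E \<subseteq> T" using T openin_beta_topology by metis
    then obtain q where "q \<in> Y" "E \<in> q" using p by auto
    then show ?thesis using E assms by (auto simp: beta_clopen_def)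
  qed
  then show "p \<in> beta_topology X closure_of Y"
    using p by (auto simp: in_closure_of)
qed

lemma beta_closed_closure_of:
  assumes "Y \<subseteq> beta X"
  shows "beta_closed X (beta_topology X closure_of Y)"
proof (rule beta_closedI)
  show "beta_topology X closure_of Y \<subseteq> beta X"
    using in_closure_of_beta[OF assms] by auto
  fix p assume p: "p \<in> beta X" "\<And>E. E \<in> p \<Longrightarrow> \<exists>q\<in>beta_topology X closure_of Y. E \<in> q"
  then have "\<exists>q\<in>Y. E \<in> q" if "E \<in> p" for E
    using in_closure_of_beta[OF assms] that by metis
  then show "p \<in> beta_topology X closure_of Y"
    using in_closure_of_beta[OF assms] p(1) by simp
qed

text \<open>If a member \<open>E\<close> of \<open>p\<close> belonged to no point of
  \<open>Y\<close>, its complement would be common to all of \<open>Y\<close> and hence lie in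
  \<open>p\<close>. Together with \<open>beta_extend\<close> this places constructed ultrafilters in
  a given closed set.\<close>

lemma beta_closed_filter:
  assumes "beta_closed X Y" "p \<in> beta X" "\<And>A. A \<subseteq> X \<Longrightarrow> (\<And>q. q \<in> Y \<Longrightarrow> A \<in> q) \<Longrightarrow> A \<in> p"
  shows "p \<in> Y"
proof (rule beta_closedD(2)[OF assms(1,2)])
  fix E assume E: "E \<in> p"
  then have "E \<subseteq> X" by (rule betaD(1)[OF assms(2)])
  moreover from this have "X - E \<notin> p" using E betaD(6)[OF assms(2)] by simp
  ultimately obtain q where q: "q \<in> Y" "X - E \<notin> q" using assms(3)[of "X - E"] by auto
  then have "q \<in> beta X" using beta_closedD(1)[OF assms(1)] by auto
  then show "\<exists>q\<in>Y. E \<in> q" using q \<open>E \<subseteq> X\<close> betaD(6) by metis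
qed

text \<open>From compact to closed: \<open>beta X\<close> is Hausdorff, since distinct ultrafilters
  are separated by a set and its complement. From closed to compact: an open cover without a finite
  subcover produces an ultrafilter in \<open>Y\<close> that no member of the cover can
  contain.\<close>

lemma compactin_beta_iff: "compactin (beta_topology X) Y \<longleftrightarrow> beta_closed X Y"
proof
  assume Y: "compactin (beta_topology X) Y"
  show "beta_closed X Y"
  proof (rule beta_closedI)
    show sub: "Y \<subseteq> beta X" using Y compactin_subset_topspace by fastforce
    fix p assume p: "p \<in> beta X" "\<And>E. E \<in> p \<Longrightarrow> \<exists>q\<in>Y. E \<in> q"
    show "p \<in> Y"
    proof (rule ccontr)
      assume "p \<notin> Y"
      have "\<exists>E. E \<in> q \<and> X - E \<in> p" if "q \<in> Y" for q
      proof -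
        have "\<not> q \<subseteq> p" using that sub p(1) \<open>p \<notin> Y\<close> beta_subset_imp_eq by blast
        then obtain E where "E \<in> q" "E \<notin> p" by blast
        moreover have "E \<subseteq> X" using \<open>E \<in> q\<close> betaD(1) that sub by (metis subsetD)
        ultimately show ?thesis using betaD(6)[OF p(1)] by auto
      qed
      moreover have "q \<in> beta_clopen X E" if "q \<in> Y" "E \<in> q" for q E
        using that sub by (auto simp: beta_clopen_def)
      ultimately have "Y \<subseteq> \<Union>(beta_clopen X ` {E. X - E \<in> p})" by fast
      moreover have "openin (beta_topology X) U" if "U \<in> beta_clopen X ` {E. X - E \<in> p}" for U
        using that by (auto simp: openin_beta_topology beta_clopen_def)
      ultimately obtain \<F> where "finite \<F>" "\<F> \<subseteq> beta_clopen X ` {E. X - E \<in> p}" "Y \<subseteq> \<Union>\<F>"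
        using compactinD[OF Y, of "beta_clopen X ` {E. X - E \<in> p}"] by metis
      then obtain \<E> where E: "finite \<E>" "\<E> \<subseteq> {E. X - E \<in> p}" "Y \<subseteq> \<Union>(beta_clopen X ` \<E>)"
        using finite_subset_image[of \<F> "beta_clopen X"] by (metis (no_types, lifting))
      then have "X \<inter> \<Inter>((\<lambda>E. X - E) ` \<E>) \<in> p"
        using p(1) by (intro beta_Inter_mem) auto
      then obtain q where q: "q \<in> Y" "X \<inter> \<Inter>((\<lambda>E. X - E) ` \<E>) \<in> q" using p(2) by blast
      have "q \<in> \<Union>(beta_clopen X ` \<E>)" using E(3) q(1) by (rule subsetD)
      then obtain E where "E \<in> \<E>" "E \<in> q" by (auto simp: beta_clopen_def)
      then have "E \<inter> (X \<inter> \<Inter>((\<lambda>E. X - E) ` \<E>)) \<in> q"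
        using q(2) betaD(4)[OF subsetD[OF sub q(1)]] by metis
      moreover have "E \<inter> (X \<inter> \<Inter>((\<lambda>E. X - E) ` \<E>)) = {}" using \<open>E \<in> \<E>\<close> by auto
      ultimately show False using q(1) sub betaD(3) by (metis subsetD)
    qed
  qed
next
  assume Y: "beta_closed X Y"
  note sub = beta_closedD(1)[OF Y]
  show "compactin (beta_topology X) Y"
    unfolding compactin_def
  proof (intro conjI allI impI)
    show "Y \<subseteq> topspace (beta_topology X)" using sub by simp
    fix \<U> assume U: "(\<forall>U\<in>\<U>. openin (beta_topology X) U) \<and> Y \<subseteq> \<Union>\<U>"
    show "\<exists>\<F>. finite \<F> \<and> \<F> \<subseteq> \<U> \<and> Y \<subseteq> \<Union>\<F>"
    proof (rule ccontr)
      assume neg: "\<nexists>\<F>. finite \<F> \<and> \<F> \<subseteq> \<U> \<and> Y \<subseteq> \<Union>\<F>"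
      \<comment> \<open>The sets that belong to all points of \<open>Y\<close> left uncovered by
        some finite subfamily; without a finite subcover the empty set is not among them.\<close>
      define \<Phi> where "\<Phi> = {E. E \<subseteq> X \<and> (\<exists>\<F>. finite \<F> \<and> \<F> \<subseteq> \<U> \<and> (\<forall>q\<in>Y - \<Union>\<F>. E \<in> q))}"
      have mem: "q \<in> beta X" if "q \<in> Y" for q using sub that by auto
      have "X \<in> \<Phi>" using betaD(2)[OF mem] unfolding \<Phi>_def by (auto intro!: exI[of _ "{}"])
      then have "\<Phi> \<noteq> {}" by blast
      moreover have "{} \<notin> \<Phi>"
      proof
        assume "{} \<in> \<Phi>"
        then obtain \<F> where F: "finite \<F>" "\<F> \<subseteq> \<U>" "\<forall>q\<in>Y - \<Union>\<F>. {} \<in> q" unfolding \<Phi>_def by auto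
        then have "Y \<subseteq> \<Union>\<F>" using betaD(3)[OF mem] by auto
        then show False using neg F by blast
      qed
      moreover have "A \<inter> B \<in> \<Phi>" if AB: "A \<in> \<Phi>" "B \<in> \<Phi>" for A B
      proof -
        obtain \<F> \<G> where FG: "finite \<F>" "\<F> \<subseteq> \<U>" "\<forall>q\<in>Y - \<Union>\<F>. A \<in> q"
          "finite \<G>" "\<G> \<subseteq> \<U>" "\<forall>q\<in>Y - \<Union>\<G>. B \<in> q" "A \<subseteq> X"
          using AB unfolding \<Phi>_def by auto
        then have "\<forall>q\<in>Y - \<Union>(\<F> \<union> \<G>). A \<inter> B \<in> q" using betaD(4)[OF mem] by auto
        then show ?thesis using FG unfolding \<Phi>_def
          by (auto intro!: exI[of _ "\<F> \<union> \<G>"])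
      qed
      moreover have "\<Phi> \<subseteq> Pow X" unfolding \<Phi>_def by auto
      ultimately obtain p where p: "p \<in> beta X" "\<Phi> \<subseteq> p" using beta_extend[of \<Phi> X] by blast
      have "p \<in> Y"
      proof (rule beta_closed_filter[OF Y p(1)])
        fix A assume "A \<subseteq> X" "\<And>q. q \<in> Y \<Longrightarrow> A \<in> q"
        then have "A \<in> \<Phi>" unfolding \<Phi>_def by (auto intro!: exI[of _ "{}"])
        then show "A \<in> p" using p by blast
      qed
      then obtain U where "U \<in> \<U>" "p \<in> U" using U by blast
      then obtain E where E: "E \<in> p" "beta_clopen X E \<subseteq> U" using U openin_beta_topology by metis
      have "E \<subseteq> X" using E betaD(1)[OF p(1)] by auto
      have "X - E \<in> q" if "q \<in> Y - \<Union>{U}" for q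
        using that E \<open>E \<subseteq> X\<close> betaD(6)[OF mem, of q E] mem[of q] by (auto simp: beta_clopen_def)
      then have "X - E \<in> \<Phi>"
        using \<open>U \<in> \<U>\<close> unfolding \<Phi>_def by (auto intro!: exI[of _ "{U}"])
      then show False using p(2) E betaD(6)[OF p(1)] \<open>E \<subseteq> X\<close> by auto
    qed
  qed
qed

lemma beta_closed_Inter:
  assumes "\<C> \<noteq> {}" "\<And>Y. Y \<in> \<C> \<Longrightarrow> beta_closed X Y"
  shows "beta_closed X (\<Inter>\<C>)"
proof (rule beta_closedI)
  show "\<Inter>\<C> \<subseteq> beta X" using assms beta_closedD(1) by blast
  show "p \<in> \<Inter>\<C>" if "p \<in> beta X" "\<And>E. E \<in> p \<Longrightarrow> \<exists>q\<in>\<Inter>\<C>. E \<in> q" for p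
    using that beta_closedD(2)[OF assms(2)] by blast
qed

lemma beta_closed_Int:
  "beta_closed X Y \<Longrightarrow> beta_closed X Z \<Longrightarrow> beta_closed X (Y \<inter> Z)"
  using beta_closed_Inter[of "{Y, Z}" X] by auto

lemma beta_closed_mem: "beta_closed X {p \<in> beta X. E \<in> p}"
proof (cases "E \<subseteq> X")
  case True
  show ?thesis
  proof (rule beta_closedI)
    fix p assume p: "p \<in> beta X" "\<And>D. D \<in> p \<Longrightarrow> \<exists>q\<in>{p \<in> beta X. E \<in> p}. D \<in> q"
    have "X - E \<notin> p" using p(2)[of "X - E"] betaD(6)[OF _ True] by auto
    then show "p \<in> {p \<in> beta X. E \<in> p}" using betaD(6)[OF p(1) True] p(1) by auto
  qed auto
next
  case False
  then have "{p \<in> beta X. E \<in> p} = {}" using betaD(1)[of _ X E] by auto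
  then show ?thesis using betaD(2)[of _ X] by (auto simp: beta_closed_def)
qed

text \<open>Compactness for chains: the sets common to all points of some member of the chain are
  closed under intersection, as the smaller of two members is again in the chain. An ultrafilter
  extending them lies in every member.\<close>

lemma beta_chain_Inter_nonempty:
  assumes ne: "\<C> \<noteq> {}" and cl: "\<And>Y. Y \<in> \<C> \<Longrightarrow> beta_closed X Y \<and> Y \<noteq> {}"
    and chain: "\<And>Y Z. Y \<in> \<C> \<Longrightarrow> Z \<in> \<C> \<Longrightarrow> Y \<subseteq> Z \<or> Z \<subseteq> Y"
  shows "\<Inter>\<C> \<noteq> {}"
proof -
  define \<Phi> where "\<Phi> = {E. E \<subseteq> X \<and> (\<exists>Y\<in>\<C>. \<forall>q\<in>Y. E \<in> q)}"
  have sub: "\<And>Y. Y \<in> \<C> \<Longrightarrow> Y \<subseteq> beta X" using cl beta_closedD(1) by blast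
  have mem: "q \<in> beta X" if "q \<in> Y" "Y \<in> \<C>" for q Y using sub that by auto
  have sub\<Phi>: "\<Phi> \<subseteq> Pow X" unfolding \<Phi>_def by auto
  have X\<Phi>: "X \<in> \<Phi>" using ne betaD(2)[OF mem] unfolding \<Phi>_def by auto
  have ne\<Phi>: "{} \<notin> \<Phi>" using cl betaD(3)[OF mem] unfolding \<Phi>_def by auto
  have int\<Phi>: "A \<inter> B \<in> \<Phi>" if AB: "A \<in> \<Phi>" "B \<in> \<Phi>" for A B
  proof -
    obtain Y Z where YZ: "Y \<in> \<C>" "Z \<in> \<C>" "\<forall>q\<in>Y. A \<in> q" "\<forall>q\<in>Z. B \<in> q" "A \<subseteq> X"
      using AB unfolding \<Phi>_def by auto
    then have "Y \<inter> Z \<in> \<C>" using chain by (metis inf.absorb1 inf.absorb2)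
    moreover have "\<forall>q\<in>Y \<inter> Z. A \<inter> B \<in> q" using YZ betaD(4)[OF mem] by auto
    moreover have "A \<inter> B \<subseteq> X" using YZ by auto
    ultimately show ?thesis unfolding \<Phi>_def mem_Collect_eq by (intro conjI bexI)
  qed
  obtain p where p: "p \<in> beta X" "\<Phi> \<subseteq> p"
    using beta_extend[OF sub\<Phi> int\<Phi> ne\<Phi>] X\<Phi> by blast
  have "p \<in> Y" if "Y \<in> \<C>" for Y
  proof (rule beta_closed_filter[OF _ p(1)])
    fix A assume "A \<subseteq> X" "\<And>q. q \<in> Y \<Longrightarrow> A \<in> q"
    then have "A \<in> \<Phi>" using that unfolding \<Phi>_def by auto
    then show "A \<in> p" using p(2) by (rule subsetD[rotated])
  qed (use cl that in simp)
  then show ?thesis by blast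
qed

text \<open>The property \<open>Q\<close> is left open for two uses: invariance, for minimal
  invariant sets, and closure under the product, for idempotents. Complements turn the search for a
  minimal element into one for a maximal element.\<close>

lemma beta_minimal_closed:
  assumes "beta_closed X Y" "Y \<noteq> {}" "Q Y"
    and Q: "\<And>\<C>. \<C> \<noteq> {} \<Longrightarrow> (\<And>Z. Z \<in> \<C> \<Longrightarrow> Q Z) \<Longrightarrow> Q (\<Inter>\<C>)"
  obtains Z where "Z \<subseteq> Y" "minimal_set (\<lambda>Z. Z \<noteq> {} \<and> beta_closed X Z \<and> Q Z) Z"
proof -
  define \<A> where "\<A> = {Z. Z \<subseteq> Y \<and> Z \<noteq> {} \<and> beta_closed X Z \<and> Q Z}"
  have "\<exists>M\<in>uminus ` \<A>. \<forall>X\<in>uminus ` \<A>. M \<subseteq> X \<longrightarrow> X = M"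
  proof (rule subset_Zorn_nonempty)
    show "uminus ` \<A> \<noteq> {}" using assms by (auto simp: \<A>_def)
    fix \<D> assume D: "\<D> \<noteq> {}" "subset.chain (uminus ` \<A>) \<D>"
    define \<C> where "\<C> = uminus ` \<D>"
    have C: "\<C> \<noteq> {}" "\<C> \<subseteq> \<A>" using D unfolding \<C>_def subset_chain_def by force+
    have chain: "A \<subseteq> B \<or> B \<subseteq> A" if "A \<in> \<C>" "B \<in> \<C>" for A B
    proof -
      have "- A \<in> \<D>" "- B \<in> \<D>" using that unfolding \<C>_def by auto
      then have "- A \<subseteq> - B \<or> - B \<subseteq> - A" using D unfolding subset_chain_def by metis
      then show ?thesis by auto
    qed
    have "\<Inter>\<C> \<noteq> {}"
      using C chain by (intro beta_chain_Inter_nonempty[of _ X]) (auto simp: \<A>_def)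
    moreover have "beta_closed X (\<Inter>\<C>)" using C by (intro beta_closed_Inter) (auto simp: \<A>_def)
    moreover have "Q (\<Inter>\<C>)" using C by (intro Q) (auto simp: \<A>_def)
    moreover have "\<Inter>\<C> \<subseteq> Y" using C by (auto simp: \<A>_def)
    ultimately have "\<Inter>\<C> \<in> \<A>" unfolding \<A>_def by blast
    moreover have "\<Union>\<D> = - (\<Inter>\<C>)" unfolding \<C>_def by auto
    ultimately show "\<Union>\<D> \<in> uminus ` \<A>" by blast
  qed
  then obtain Z where "Z \<in> \<A>" "\<And>W. W \<in> \<A> \<Longrightarrow> W \<subseteq> Z \<Longrightarrow> W = Z" by auto
  then show ?thesis by (intro that[of Z]) (auto simp: \<A>_def minimal_set_def)
qed

section \<open>The compact semigroup of ultrafilters\<close>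

text \<open>Serves both operations: addition with \<open>T = R\<close>, multiplication with
  \<open>T = R - {0}\<close>. Keeping \<open>X = R\<close> in the second case places both semigroups
  in the same \<open>beta R\<close>, where a closure for one is compared with minimal sets for the
  other.\<close>

locale acting_semigroup =
  fixes X T :: "'a set" and f :: "'a \<Rightarrow> 'a \<Rightarrow> 'a"
  assumes T_subset: "T \<subseteq> X"
    and closed: "u \<in> X \<Longrightarrow> x \<in> X \<Longrightarrow> f u x \<in> X"
    and T_closed: "u \<in> T \<Longrightarrow> x \<in> T \<Longrightarrow> f u x \<in> T"
    and assoc: "u \<in> X \<Longrightarrow> v \<in> X \<Longrightarrow> x \<in> X \<Longrightarrow> f (f u v) x = f u (f v x)"
begin

definition pullback :: "'a \<Rightarrow> 'a set \<Rightarrow> 'a set" where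
  "pullback u E = {x \<in> X. f u x \<in> E}"

definition returns :: "'a set set \<Rightarrow> 'a set \<Rightarrow> 'a set" where
  "returns q E = {u \<in> X. pullback u E \<in> q}"

definition prod :: "'a set set \<Rightarrow> 'a set set \<Rightarrow> 'a set set" where
  "prod p q = {E. E \<subseteq> X \<and> returns q E \<in> p}"

definition betaT :: "'a set set set" where
  "betaT = {p \<in> beta X. T \<in> p}"

definition invariant :: "'a set set set \<Rightarrow> bool" where
  "invariant Y \<longleftrightarrow> Y \<subseteq> betaT \<and> (\<forall>p\<in>Y. \<forall>u\<in>T. prod (principal_ultrafilter X u) p \<in> Y)"

definition minimal :: "'a set set set \<Rightarrow> bool" where
  "minimal = minimal_set (\<lambda>Y. Y \<noteq> {} \<and> beta_closed X Y \<and> invariant Y)"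

lemma betaT_beta: "p \<in> betaT \<Longrightarrow> p \<in> beta X"
  by (simp add: betaT_def)

lemma beta_closed_betaT: "beta_closed X betaT"
  unfolding betaT_def by (rule beta_closed_mem)

lemma pullback_subset: "pullback u E \<subseteq> X" by (auto simp: pullback_def)
lemma returns_subset: "returns q E \<subseteq> X" by (auto simp: returns_def)

lemma pullback_Int: "pullback u (E \<inter> E') = pullback u E \<inter> pullback u E'"
  by (auto simp: pullback_def)

lemma pullback_compl: "u \<in> X \<Longrightarrow> pullback u (X - E) = X - pullback u E"
  using closed by (auto simp: pullback_def)

lemma returns_Int:
  assumes "q \<in> beta X"
  shows "returns q (E \<inter> E') = returns q E \<inter> returns q E'"
proof -
  have "A \<inter> B \<in> q \<longleftrightarrow> A \<in> q \<and> B \<in> q" if "A \<subseteq> X" "B \<subseteq> X" for A B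
    using betaD(4)[OF assms, of A B] betaD(5)[OF assms, of "A \<inter> B" A]
      betaD(5)[OF assms, of "A \<inter> B" B] that by auto
  then have "pullback u E \<inter> pullback u E' \<in> q \<longleftrightarrow> pullback u E \<in> q \<and> pullback u E' \<in> q" for u
    using pullback_subset by auto
  then show ?thesis
    unfolding returns_def pullback_Int by auto
qed

lemma returns_compl:
  assumes "q \<in> beta X"
  shows "returns q (X - E) = X - returns q E"
  unfolding returns_def using betaD(6)[OF assms pullback_subset] by (auto simp: pullback_compl)

lemma returns_mono:
  assumes "q \<in> beta X" "E \<subseteq> E'"
  shows "returns q E \<subseteq> returns q E'"
  using returns_Int[OF assms(1), of E E'] assms(2) by (simp add: inf.absorb_iff1)

lemma mem_prod: "E \<in> prod p q \<longleftrightarrow> E \<subseteq> X \<and> returns q E \<in> p"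
  by (simp add: prod_def)

lemma prod_beta:
  assumes "p \<in> beta X" "q \<in> beta X"
  shows "prod p q \<in> beta X"
  unfolding beta_iff ultrafilter_on_def
proof (intro conjI ballI allI impI)
  show "prod p q \<subseteq> Pow X" by (auto simp: prod_def)
  have "returns q X = X"
    unfolding returns_def using betaD(2)[OF assms(2)] closed
    by (auto simp: pullback_def intro: back_subst[of "\<lambda>A. A \<in> q" X])
  then show "X \<in> prod p q" using betaD(2)[OF assms(1)] by (simp add: mem_prod)
  have "returns q {} = {}"
    unfolding returns_def pullback_def using betaD(3)[OF assms(2)] by simp
  then show "{} \<notin> prod p q" using betaD(3)[OF assms(1)] by (simp add: mem_prod)
  show "E \<inter> E' \<in> prod p q" if "E \<in> prod p q" "E' \<in> prod p q" for E E'
    using that betaD(4)[OF assms(1)] by (auto simp: mem_prod returns_Int[OF assms(2)])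
  show "E' \<in> prod p q" if "E \<in> prod p q" "E \<subseteq> E' \<and> E' \<subseteq> X" for E E'
    using that betaD(5)[OF assms(1), of "returns q E" "returns q E'"] returns_subset
      returns_mono[OF assms(2), of E E'] by (auto simp: mem_prod)
  show "E \<in> prod p q \<or> X - E \<in> prod p q" if "E \<subseteq> X" for E
    using that betaD(6)[OF assms(1) returns_subset] by (auto simp: mem_prod returns_compl[OF assms(2)])
qed

lemma mem_prod_principal:
  assumes "u \<in> X"
  shows "E \<in> prod (principal_ultrafilter X u) q \<longleftrightarrow> E \<subseteq> X \<and> pullback u E \<in> q"
  using assms returns_subset by (auto simp: mem_prod principal_ultrafilter_def returns_def)

lemma prod_betaT:
  assumes "p \<in> betaT" "q \<in> betaT"
  shows "prod p q \<in> betaT"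
proof -
  have pq: "p \<in> beta X" "q \<in> beta X" "T \<in> p" "T \<in> q" using assms by (auto simp: betaT_def)
  have "T \<subseteq> returns q T"
  proof
    fix u assume "u \<in> T"
    then have "T \<subseteq> pullback u T" using T_closed T_subset by (auto simp: pullback_def)
    then have "pullback u T \<in> q" using betaD(5)[OF pq(2,4)] pullback_subset by simp
    then show "u \<in> returns q T" using \<open>u \<in> T\<close> T_subset by (auto simp: returns_def)
  qed
  then have "returns q T \<in> p" using betaD(5)[OF pq(1,3)] returns_subset by simp
  then show ?thesis using prod_beta[OF pq(1,2)] T_subset by (simp add: betaT_def mem_prod)
qed

text \<open>Forming \<open>returns\<close> commutes with \<open>pullback\<close>, so both sides ask
  for the same set in \<open>p\<close>.\<close>

lemma prod_assoc: "prod (prod p q) r = prod p (prod q r)"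
proof -
  have "returns q (returns r E) = returns (prod q r) E" for E
  proof -
    have *: "pullback v (pullback u E) = pullback (f u v) E" if "u \<in> X" "v \<in> X" for u v
      unfolding pullback_def using that by (auto simp: assoc closed)
    have "pullback u (returns r E) = returns r (pullback u E)" if "u \<in> X" for u
      unfolding pullback_def[of u "returns r E"] using that by (auto simp: returns_def * closed)
    moreover have "pullback u E \<subseteq> X" for u by (rule pullback_subset)
    ultimately show ?thesis
      unfolding returns_def[of q] returns_def[of "prod q r"] by (auto simp: mem_prod)
  qed
  then show ?thesis using returns_subset by (auto simp: mem_prod)
qed

text \<open>With \<open>q\<close> fixed the product is continuous in \<open>p\<close>, so
  \<open>prod p q\<close> is in the closure of the orbit of \<open>q\<close> under \<open>T\<close>:
  each of its members already belongs to the translate of \<open>q\<close> by some \<open>u\<close>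
  in \<open>T\<close>.\<close>

lemma invariant_prod:
  assumes "beta_closed X Y" "invariant Y" "q \<in> Y" "p \<in> betaT"
  shows "prod p q \<in> Y"
proof (rule beta_closedD(2)[OF assms(1)])
  have q: "q \<in> beta X" using beta_closedD(1)[OF assms(1)] assms(3) by (rule subsetD)
  note p = betaT_beta[OF assms(4)]
  show "prod p q \<in> beta X" using p q by (rule prod_beta)
  fix E assume "E \<in> prod p q"
  then have E: "returns q E \<in> p" "E \<subseteq> X" by (auto simp: mem_prod)
  then have "returns q E \<inter> T \<in> p" using betaD(4)[OF p] assms(4) by (simp add: betaT_def)
  then obtain u where u: "u \<in> returns q E" "u \<in> T" using beta_nonempty_mem[OF p] by (metis IntE ex_in_conv)
  then have "E \<in> prod (principal_ultrafilter X u) q"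
    using E by (auto simp: returns_def mem_prod_principal)
  moreover have "prod (principal_ultrafilter X u) q \<in> Y"
    using assms(2,3) u(2) by (simp add: invariant_def)
  ultimately show "\<exists>q\<in>Y. E \<in> q" by (rule rev_bexI[rotated])
qed

text \<open>The image of a compact set under the continuous map \<open>p \<mapsto> prod p q\<close>.
  An ultrafilter \<open>p\<close> that contains the sets common to \<open>S\<close> and all
  \<open>returns q E\<close> with \<open>E\<close> in the limit point \<open>r\<close> lies in
  \<open>S\<close> and has \<open>prod p q = r\<close>.\<close>

lemma beta_closed_image_prod:
  assumes S: "beta_closed X S" and q: "q \<in> beta X"
  shows "beta_closed X ((\<lambda>p. prod p q) ` S)"
proof (rule beta_closedI)
  note S_sub = beta_closedD(1)[OF S]
  show "(\<lambda>p. prod p q) ` S \<subseteq> beta X" using S_sub prod_beta q by auto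
  fix r assume r: "r \<in> beta X" "\<And>E. E \<in> r \<Longrightarrow> \<exists>s\<in>(\<lambda>p. prod p q) ` S. E \<in> s"
  define \<Phi> where "\<Phi> = {D \<inter> returns q E | D E. D \<subseteq> X \<and> (\<forall>s\<in>S. D \<in> s) \<and> E \<in> r}"
  have "\<Phi> \<subseteq> Pow X" unfolding \<Phi>_def by auto
  moreover have "A \<inter> B \<in> \<Phi>" if AB: "A \<in> \<Phi>" "B \<in> \<Phi>" for A B
  proof -
    obtain D E D' E' where *: "A = D \<inter> returns q E" "D \<subseteq> X" "\<forall>s\<in>S. D \<in> s" "E \<in> r"
      "B = D' \<inter> returns q E'" "\<forall>s\<in>S. D' \<in> s" "E' \<in> r"
      using AB unfolding \<Phi>_def by auto
    have "A \<inter> B = (D \<inter> D') \<inter> returns q (E \<inter> E')"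
      using * by (auto simp: returns_Int[OF q])
    moreover have "\<forall>s\<in>S. D \<inter> D' \<in> s" using * betaD(4) S_sub by (metis subsetD)
    moreover have "E \<inter> E' \<in> r" using * betaD(4)[OF r(1)] by simp
    moreover have "D \<inter> D' \<subseteq> X" using * by auto
    ultimately show ?thesis unfolding \<Phi>_def mem_Collect_eq by metis
  qed
  moreover have "{} \<notin> \<Phi>"
  proof
    assume "{} \<in> \<Phi>"
    then obtain D E where *: "{} = D \<inter> returns q E" "\<forall>s\<in>S. D \<in> s" "E \<in> r" unfolding \<Phi>_def by auto
    then obtain s where s: "s \<in> S" "E \<in> prod s q" using r(2)[OF *(3)] by auto
    then have "D \<in> s" "returns q E \<in> s" using *(2) by (simp_all add: mem_prod)
    then have "D \<inter> returns q E \<in> s" by (rule betaD(4)[OF subsetD[OF S_sub s(1)]])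
    then show False using * betaD(3)[OF subsetD[OF S_sub s(1)]] by simp
  qed
  moreover have XX: "D \<in> \<Phi>" if "D \<subseteq> X" "\<And>s. s \<in> S \<Longrightarrow> D \<in> s" for D
  proof -
    have "returns q X = X"
      using returns_compl[OF q, of "{}"] betaD(3)[OF q] by (simp add: returns_def pullback_def)
    then have "D = D \<inter> returns q X" using that by auto
    then show ?thesis using that betaD(2)[OF r(1)] unfolding \<Phi>_def mem_Collect_eq by metis
  qed
  moreover have "\<Phi> \<noteq> {}" using XX[of X] betaD(2)[OF subsetD[OF S_sub]] by auto
  ultimately have "\<exists>p. p \<in> beta X \<and> \<Phi> \<subseteq> p"
    using beta_extend[of \<Phi> X] by metis
  then obtain p where p: "p \<in> beta X" "\<Phi> \<subseteq> p" by auto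
  have "p \<in> S" by (rule beta_closed_filter[OF S p(1)]) (use XX p(2) in auto)
  moreover have "r \<subseteq> prod p q"
  proof
    fix E assume E: "E \<in> r"
    have "returns q E = X \<inter> returns q E" using returns_subset by auto
    then have "returns q E \<in> \<Phi>" using E betaD(2)[OF subsetD[OF S_sub]] unfolding \<Phi>_def by auto
    then show "E \<in> prod p q" using p betaD(1)[OF r(1) E] by (auto simp: mem_prod)
  qed
  then have "r = prod p q" using beta_subset_imp_eq[OF r(1) prod_beta[OF p(1) q]] by simp
  ultimately show "r \<in> (\<lambda>p. prod p q) ` S" by simp
qed

lemma invariant_image_prod:
  assumes "invariant S" "q \<in> betaT"
  shows "invariant ((\<lambda>p. prod p q) ` S)"
  unfolding invariant_def
proof (intro conjI ballI)
  show "(\<lambda>p. prod p q) ` S \<subseteq> betaT" using assms prod_betaT by (auto simp: invariant_def)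
  fix r u assume "r \<in> (\<lambda>p. prod p q) ` S" "u \<in> T"
  then obtain p where "p \<in> S" "r = prod p q" by auto
  moreover from this have "prod (principal_ultrafilter X u) p \<in> S"
    using assms \<open>u \<in> T\<close> by (simp add: invariant_def)
  ultimately show "prod (principal_ultrafilter X u) r \<in> (\<lambda>p. prod p q) ` S"
    by (simp add: prod_assoc[symmetric])
qed

lemma invariant_betaT: "invariant betaT"
proof -
  have "principal_ultrafilter X u \<in> betaT" if "u \<in> T" for u
    using that T_subset principal_in_beta[of u X] by (auto simp: betaT_def principal_ultrafilter_def)
  then show ?thesis using prod_betaT by (simp add: invariant_def)
qed

lemma minimalD:
  assumes "minimal Y"
  shows "Y \<noteq> {}" "beta_closed X Y" "invariant Y" "Y \<subseteq> betaT"
    "Z \<noteq> {} \<Longrightarrow> beta_closed X Z \<Longrightarrow> invariant Z \<Longrightarrow> Z \<subseteq> Y \<Longrightarrow> Z = Y"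
  using assms unfolding minimal_def minimal_set_def by (simp_all add: invariant_def)

text \<open>The left ideal of all \<open>prod p q\<close> with \<open>p\<close> in
  \<open>betaT\<close> is closed, invariant and inside \<open>Y\<close>, hence all of
  \<open>Y\<close>.\<close>

lemma minimal_generated:
  assumes "minimal Y" "q \<in> Y" "r \<in> Y"
  obtains p where "p \<in> betaT" "r = prod p q"
proof -
  note Y = minimalD[OF assms(1)]
  have q: "q \<in> betaT" using Y(4) assms(2) by (rule subsetD)
  have "(\<lambda>p. prod p q) ` betaT = Y"
  proof (rule Y(5))
    show "(\<lambda>p. prod p q) ` betaT \<noteq> {}" using q by auto
    show "(\<lambda>p. prod p q) ` betaT \<subseteq> Y"
      using invariant_prod[OF Y(2,3) assms(2)] by auto
  qed (use q betaT_beta beta_closed_image_prod beta_closed_betaT invariant_image_prod invariant_betaT in auto)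
  then show ?thesis using assms(3) by (auto intro: that)
qed

lemma minimal_exists:
  assumes "beta_closed X Y" "Y \<noteq> {}" "invariant Y"
  obtains Z where "Z \<subseteq> Y" "minimal Z"
proof (rule beta_minimal_closed[where Q = invariant])
  show "invariant (\<Inter>\<C>)" if C: "\<C> \<noteq> {}" "\<And>Z. Z \<in> \<C> \<Longrightarrow> invariant Z" for \<C>
    unfolding invariant_def
  proof (intro conjI ballI InterI)
    show "\<Inter>\<C> \<subseteq> betaT" using C by (auto simp: invariant_def)
    show "prod (principal_ultrafilter X u) p \<in> Z" if "p \<in> \<Inter>\<C>" "u \<in> T" "Z \<in> \<C>" for p u Z
    proof -
      have "p \<in> Z" using that(1,3) by (rule InterD)
      then show ?thesis using C(2)[OF that(3)] that(2) by (simp add: invariant_def)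
    qed
  qed
qed (use assms that in \<open>auto simp: minimal_def\<close>)

text \<open>Turns membership in a minimal closed invariant set into an equation between products. In
  this form minimality can be carried over by maps that respect \<open>prod\<close>, as in
  \<open>dilate_AMI\<close>, without transporting any minimal set.\<close>

lemma minimal_iff_recurrent:
  assumes "p \<in> betaT"
  shows "(\<exists>Y. minimal Y \<and> p \<in> Y) \<longleftrightarrow> (\<forall>r\<in>betaT. \<exists>s\<in>betaT. prod s (prod r p) = p)"
proof
  assume "\<exists>Y. minimal Y \<and> p \<in> Y"
  then obtain Y where Y: "minimal Y" "p \<in> Y" by auto
  show "\<forall>r\<in>betaT. \<exists>s\<in>betaT. prod s (prod r p) = p"
  proof
    fix r assume "r \<in> betaT"
    then have "prod r p \<in> Y" by (rule invariant_prod[OF minimalD(2,3)[OF Y(1)] Y(2)])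
    then obtain s where "s \<in> betaT" "p = prod s (prod r p)" by (rule minimal_generated[OF Y(1) _ Y(2)])
    then show "\<exists>s\<in>betaT. prod s (prod r p) = p" by auto
  qed
next
  assume *: "\<forall>r\<in>betaT. \<exists>s\<in>betaT. prod s (prod r p) = p"
  define Y where "Y = (\<lambda>s. prod s p) ` betaT"
  have cl: "beta_closed X Y" "invariant Y"
    unfolding Y_def using assms
    by (auto intro: beta_closed_image_prod beta_closed_betaT betaT_beta invariant_image_prod invariant_betaT)
  have "minimal_set (\<lambda>Y. Y \<noteq> {} \<and> beta_closed X Y \<and> invariant Y) Y"
    unfolding minimal_set_def
  proof (intro conjI allI impI)
    show "Y \<noteq> {}" using assms by (auto simp: Y_def)
    fix Z assume Z: "(Z \<noteq> {} \<and> beta_closed X Z \<and> invariant Z) \<and> Z \<subseteq> Y"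
    then obtain z where z: "z \<in> Z" by auto
    then have "z \<in> Y" using Z by auto
    then obtain r where "r \<in> betaT" "z = prod r p" by (auto simp: Y_def)
    then obtain s where "s \<in> betaT" "prod s z = p" using * by auto
    then have "p \<in> Z" using invariant_prod[of Z z s] Z z by auto
    then have "Y \<subseteq> Z" using invariant_prod[of Z p] Z by (auto simp: Y_def)
    then show "Z = Y" using Z by auto
  qed (use cl in auto)
  moreover obtain s where "s \<in> betaT" "prod s (prod p p) = p" using * assms by auto
  then have "prod s p \<in> betaT" "p = prod (prod s p) p" using prod_betaT assms by (simp_all add: prod_assoc)
  then have "p \<in> Y" unfolding Y_def by (rule rev_image_eqI)
  ultimately show "\<exists>Y. minimal Y \<and> p \<in> Y" by (auto simp: minimal_def)
qed

text \<open>The Ellis--Numakura lemma.\<close>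

lemma idempotent_exists:
  assumes "beta_closed X Y" "Y \<noteq> {}" and mult: "\<And>p q. p \<in> Y \<Longrightarrow> q \<in> Y \<Longrightarrow> prod p q \<in> Y"
  obtains p where "p \<in> Y" "prod p p = p"
proof -
  define Q where "Q Z \<longleftrightarrow> (\<forall>p\<in>Z. \<forall>q\<in>Z. prod p q \<in> Z)" for Z
  obtain Z where Z: "Z \<subseteq> Y" "minimal_set (\<lambda>Z. Z \<noteq> {} \<and> beta_closed X Z \<and> Q Z) Z"
  proof (rule beta_minimal_closed[where Q = Q, OF assms(1,2)])
    show "Q Y" using mult by (simp add: Q_def)
    show "Q (\<Inter>\<C>)" if "\<And>Z. Z \<in> \<C> \<Longrightarrow> Q Z" for \<C>
      using that unfolding Q_def by (meson InterI InterD)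
  qed
  have Z': "Z \<noteq> {}" "beta_closed X Z" "Q Z"
    and Zmin: "\<And>W. W \<noteq> {} \<Longrightarrow> beta_closed X W \<Longrightarrow> Q W \<Longrightarrow> W \<subseteq> Z \<Longrightarrow> W = Z"
    using Z(2) by (auto simp: minimal_set_def)
  obtain q where q: "q \<in> Z" using Z'(1) by auto
  have Z_beta: "p \<in> beta X" if "p \<in> Z" for p using beta_closedD(1)[OF Z'(2)] that by (rule subsetD)
  \<comment> \<open>Minimality makes \<open>Z q\<close> equal to \<open>Z\<close>, so some
    \<open>e\<close> in \<open>Z\<close> fixes \<open>q\<close> from the left. The left fixers of
    \<open>q\<close> in \<open>Z\<close> form another closed subsemigroup, again all of
    \<open>Z\<close>, and so contain \<open>q\<close> itself.\<close>
  have "(\<lambda>p. prod p q) ` Z = Z"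
  proof (rule Zmin)
    show "beta_closed X ((\<lambda>p. prod p q) ` Z)" by (rule beta_closed_image_prod[OF Z'(2) Z_beta[OF q]])
    show "(\<lambda>p. prod p q) ` Z \<subseteq> Z" using Z'(3) q by (auto simp: Q_def)
    show "Q ((\<lambda>p. prod p q) ` Z)"
      unfolding Q_def
    proof (intro ballI)
      fix r s assume "r \<in> (\<lambda>p. prod p q) ` Z" "s \<in> (\<lambda>p. prod p q) ` Z"
      then obtain r' s' where *: "r' \<in> Z" "s' \<in> Z" "r = prod r' q" "s = prod s' q" by auto
      then have "prod r s = prod (prod (prod r' q) s') q" by (simp add: prod_assoc)
      moreover have "prod (prod r' q) s' \<in> Z" using Z'(3) * q by (simp add: Q_def)
      ultimately show "prod r s \<in> (\<lambda>p. prod p q) ` Z" by simp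
    qed
  qed (use q in auto)
  then obtain e where e: "e \<in> Z" "prod e q = q" using q by (metis (no_types, lifting) imageE)
  define W where "W = {p \<in> Z. prod p q = q}"
  have "W = Z"
  proof (rule Zmin)
    show "W \<noteq> {}" "W \<subseteq> Z" using e by (auto simp: W_def)
    show "Q W" using Z'(3) by (auto simp: Q_def W_def prod_assoc)
    show "beta_closed X W"
    proof (rule beta_closedI)
      show "W \<subseteq> beta X" using Z_beta by (auto simp: W_def)
      fix p assume p: "p \<in> beta X" "\<And>E. E \<in> p \<Longrightarrow> \<exists>r\<in>W. E \<in> r"
      have "p \<in> Z"
        by (rule beta_closedD(2)[OF Z'(2) p(1)]) (use p(2) in \<open>force simp: W_def\<close>)
      moreover have "prod p q \<subseteq> q"
      proof
        fix E assume "E \<in> prod p q"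
        then have "E \<subseteq> X" "returns q E \<in> p" by (auto simp: mem_prod)
        then obtain r where "r \<in> W" "returns q E \<in> r" using p(2) by metis
        then show "E \<in> q" using \<open>E \<subseteq> X\<close> mem_prod[of E r q] by (simp add: W_def)
      qed
      then have "prod p q = q"
        using beta_subset_imp_eq[OF prod_beta[OF p(1) Z_beta[OF q]] Z_beta[OF q]] by simp
      ultimately show "p \<in> W" by (simp add: W_def)
    qed
  qed
  then have "prod q q = q" using q by (auto simp: W_def)
  then show ?thesis using q Z(1) that by auto
qed

lemma minimal_idempotent:
  assumes "minimal Y"
  obtains p where "p \<in> Y" "prod p p = p"
proof (rule idempotent_exists)
  note Y = minimalD[OF assms]
  show "beta_closed X Y" "Y \<noteq> {}" by (fact Y)+
  show "prod p q \<in> Y" if "p \<in> Y" "q \<in> Y" for p q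
    using invariant_prod[OF Y(2,3) that(2)] Y(4) that(1) by auto
qed

end

section \<open>Large ideal domains\<close>

locale lid =
  fixes R :: "'a::comm_ring_1 set"
  assumes large_ideal_domain: "large_ideal_domain R"
begin

lemma subring: "0 \<in> R" "1 \<in> R" "x \<in> R \<Longrightarrow> - x \<in> R" "x \<in> R \<Longrightarrow> y \<in> R \<Longrightarrow> x + y \<in> R"
    "x \<in> R \<Longrightarrow> y \<in> R \<Longrightarrow> x * y \<in> R" "x \<in> R \<Longrightarrow> y \<in> R \<Longrightarrow> x - y \<in> R"
  and domain: "x \<in> R \<Longrightarrow> y \<in> R \<Longrightarrow> x * y = 0 \<Longrightarrow> x = 0 \<or> y = 0"
  and infinite_ring: "infinite R"
  and finite_cosets: "x \<in> R \<Longrightarrow> x \<noteq> 0 \<Longrightarrow> finite (additive_cosets R ((\<lambda>r. x * r) ` R))"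
proof -
  note l = large_ideal_domain[unfolded large_ideal_domain_def is_subring_def]
  show "0 \<in> R" "1 \<in> R" "x \<in> R \<Longrightarrow> - x \<in> R" "x \<in> R \<Longrightarrow> y \<in> R \<Longrightarrow> x + y \<in> R"
    "x \<in> R \<Longrightarrow> y \<in> R \<Longrightarrow> x * y \<in> R" "x \<in> R \<Longrightarrow> y \<in> R \<Longrightarrow> x * y = 0 \<Longrightarrow> x = 0 \<or> y = 0" "infinite R"
    "x \<in> R \<Longrightarrow> x \<noteq> 0 \<Longrightarrow> finite (additive_cosets R ((\<lambda>r. x * r) ` R))"
    using l by auto
  show "x \<in> R \<Longrightarrow> y \<in> R \<Longrightarrow> x - y \<in> R"
    using l by (metis diff_conv_add_uminus)
qed

sublocale add: acting_semigroup R R "\<lambda>u x. x + u"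
  by unfold_locales (auto simp: subring algebra_simps)

sublocale mul: acting_semigroup R "R - {0}" "\<lambda>u x. u * x"
  using domain by unfold_locales (auto simp: subring algebra_simps)

lemma beta_plus_eq: "beta_plus R = add.prod"
  by (auto simp: fun_eq_iff beta_plus_def add.prod_def add.returns_def add.pullback_def)

lemma beta_times_eq: "beta_times R = mul.prod"
  by (auto simp: fun_eq_iff beta_times_def mul.prod_def mul.returns_def mul.pullback_def)

lemma add_betaT [simp]: "add.betaT = beta R"
  using betaD(2) by (auto simp: add.betaT_def)

lemma beta_star_eq: "beta_star R = mul.betaT"
  by (simp add: beta_star_def mul.betaT_def)

lemma minimal_SA_eq: "minimal_SA R = add.minimal"
  unfolding minimal_SA_def add.minimal_def compactin_beta_iff SA_invariant_def add.invariant_def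
  by (simp add: beta_plus_eq)

lemma minimal_SM_eq: "minimal_SM R = mul.minimal"
  unfolding minimal_SM_def mul.minimal_def compactin_beta_iff SM_invariant_def mul.invariant_def
  by (simp add: beta_times_eq beta_star_eq)

lemma AMI_iff:
  "p \<in> AMI R \<longleftrightarrow> p \<in> beta R \<and> nonprincipal R p \<and> add.prod p p = p \<and>
     (\<forall>r\<in>beta R. \<exists>s\<in>beta R. add.prod s (add.prod r p) = p)"
  using add.minimal_iff_recurrent[of p]
  by (auto simp: AMI_def beta_plus_eq minimal_SA_eq)

section \<open>Dilations by elements of \<open>R\<close>\<close>

definition dilate :: "'a \<Rightarrow> 'a set set \<Rightarrow> 'a set set" where
  "dilate c p = mul.prod (principal_ultrafilter R c) p"

lemma mem_dilate:
  assumes "c \<in> R"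
  shows "E \<in> dilate c p \<longleftrightarrow> E \<subseteq> R \<and> {x \<in> R. c * x \<in> E} \<in> p"
  unfolding dilate_def mul.mem_prod_principal[OF assms] by (simp add: mul.pullback_def)

lemma dilate_beta: "c \<in> R \<Longrightarrow> p \<in> beta R \<Longrightarrow> dilate c p \<in> beta R"
  unfolding dilate_def by (intro mul.prod_beta principal_in_beta)

text \<open>Distributivity: multiplication by \<open>c\<close> is an endomorphism of the additive
  group, and its extension to ultrafilters inherits this.\<close>

lemma dilate_add:
  assumes "c \<in> R"
  shows "dilate c (add.prod p q) = add.prod (dilate c p) (dilate c q)"
proof -
  have "{u \<in> R. {x \<in> R. x + u \<in> {x \<in> R. c * x \<in> E}} \<in> q} = {u \<in> R. c * u \<in> {u \<in> R. {x \<in> R. x + u \<in> E} \<in> dilate c q}}" for E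
  proof -
    have "{x \<in> R. x + u \<in> {x \<in> R. c * x \<in> E}} = {x \<in> R. c * x \<in> {x \<in> R. x + c * u \<in> E}}" if "u \<in> R" for u
      using that assms by (auto simp: subring algebra_simps)
    then show ?thesis using assms by (auto simp: mem_dilate subring)
  qed
  then show ?thesis
    by (auto simp: mem_dilate[OF assms] add.prod_def add.returns_def add.pullback_def)
qed

lemma finite_solutions:
  assumes "c \<in> R" "c \<noteq> 0"
  shows "finite {y \<in> R. c * y = x}"
proof -
  have "y = z" if "y \<in> R" "z \<in> R" "c * y = x" "c * z = x" for y z
  proof -
    have "c * (y - z) = 0" using that by (simp add: algebra_simps)
    then show ?thesis using domain[of c "y - z"] that assms subring(6) by auto
  qed
  then have "{y \<in> R. c * y = x} = {} \<or> (\<exists>z. {y \<in> R. c * y = x} = {z})" by blast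
  then show ?thesis by (metis finite.emptyI finite.insertI)
qed

lemma dilate_nonprincipal:
  assumes "c \<in> R" "c \<noteq> 0" "p \<in> beta R" "nonprincipal R p"
  shows "nonprincipal R (dilate c p)"
  unfolding nonprincipal_iff[OF dilate_beta[OF assms(1,3)]]
proof
  fix x assume "x \<in> R"
  have "R - {y \<in> R. c * y = x} \<in> p"
    using assms by (intro nonprincipal_cofinite finite_solutions)
  also have "R - {y \<in> R. c * y = x} = {y \<in> R. c * y \<in> R - {x}}"
    using assms subring by auto
  finally show "R - {x} \<in> dilate c p" by (simp add: mem_dilate[OF assms(1)])
qed

text \<open>The preimages of the members of \<open>r\<close> have nonempty finite intersections
  because each member meets \<open>c R\<close>; an ultrafilter containing them is carried to
  \<open>r\<close>.\<close>

lemma dilate_surj: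
  assumes c: "c \<in> R" and r: "r \<in> beta R" "(\<lambda>x. c * x) ` R \<in> r"
  obtains q where "q \<in> beta R" "r = dilate c q"
proof -
  define \<Phi> where "\<Phi> = {{x \<in> R. c * x \<in> E} | E. E \<in> r}"
  have "{} \<notin> \<Phi>"
  proof
    assume "{} \<in> \<Phi>"
    then obtain E where E: "E \<in> r" "{} = {x \<in> R. c * x \<in> E}" unfolding \<Phi>_def by auto
    from E(2) have "E \<inter> (\<lambda>x. c * x) ` R = {}" by auto
    then show False using betaD(4)[OF r(1) E(1) r(2)] betaD(3)[OF r(1)] by simp
  qed
  moreover have "A \<inter> B \<in> \<Phi>" if AB: "A \<in> \<Phi>" "B \<in> \<Phi>" for A B
  proof -
    obtain E E' where E: "A = {x \<in> R. c * x \<in> E}" "E \<in> r" "B = {x \<in> R. c * x \<in> E'}" "E' \<in> r"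
      using AB by (auto simp: \<Phi>_def)
    then have "A \<inter> B = {x \<in> R. c * x \<in> E \<inter> E'}" by auto
    moreover have "E \<inter> E' \<in> r" using betaD(4)[OF r(1) E(2,4)] .
    ultimately show ?thesis unfolding \<Phi>_def by (intro CollectI exI[of _ "E \<inter> E'"] conjI)
  qed
  moreover have "\<Phi> \<subseteq> Pow R" by (auto simp: \<Phi>_def)
  moreover have "\<Phi> \<noteq> {}" using r(2) by (auto simp: \<Phi>_def)
  ultimately have "\<exists>q. q \<in> beta R \<and> \<Phi> \<subseteq> q" using beta_extend[of \<Phi> R] by metis
  then obtain q where q: "q \<in> beta R" "\<Phi> \<subseteq> q" by auto
  have "r \<subseteq> dilate c q"
  proof
    fix E assume E: "E \<in> r"
    then have "{x \<in> R. c * x \<in> E} \<in> \<Phi>" by (auto simp: \<Phi>_def)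
    then show "E \<in> dilate c q" using q(2) betaD(1)[OF r(1) E] by (auto simp: mem_dilate[OF c])
  qed
  then have "r = dilate c q" by (rule beta_subset_imp_eq[OF r(1) dilate_beta[OF c q(1)]])
  then show ?thesis using q(1) that by simp
qed

lemma add_principal:
  assumes "u \<in> R" "v \<in> R"
  shows "add.prod (principal_ultrafilter R u) (add.prod (principal_ultrafilter R v) p)
    = add.prod (principal_ultrafilter R (u + v)) p"
proof -
  have "add.prod (principal_ultrafilter R u) (principal_ultrafilter R v) = principal_ultrafilter R (u + v)"
    unfolding set_eq_iff add.mem_prod_principal[OF assms(1)] using assms
    by (auto simp: add.pullback_def subring principal_ultrafilter_def) (auto simp: ac_simps)
  then show ?thesis by (simp add: add.prod_assoc[symmetric])
qed

lemma add_principal_0: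
  assumes "p \<in> beta R"
  shows "add.prod (principal_ultrafilter R 0) p = p"
proof -
  have "add.pullback 0 E = E" if "E \<subseteq> R" for E using that by (auto simp: add.pullback_def)
  then show ?thesis
    unfolding set_eq_iff[of _ p] add.mem_prod_principal[OF subring(1)] using betaD(1)[OF assms] by metis
qed

text \<open>The finite index of \<open>cR\<close> enters only here.\<close>

lemma beta_coset:
  assumes c: "c \<in> R" "c \<noteq> 0" and r: "r \<in> beta R"
  obtains a q where "a \<in> R" "q \<in> beta R" "r = add.prod (principal_ultrafilter R a) (dilate c q)"
proof -
  \<comment> \<open>Finitely many cosets cover \<open>R\<close>, so one of them is in
    \<open>r\<close>; subtracting its representative moves \<open>r\<close> onto
    \<open>c R\<close>.\<close>
  have "\<exists>H\<in>additive_cosets R ((\<lambda>r. c * r) ` R). H \<in> r"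
  proof (rule ccontr)
    assume neg: "\<not> ?thesis"
    have sub: "H \<subseteq> R" if "H \<in> additive_cosets R ((\<lambda>r. c * r) ` R)" for H
      using that c by (auto simp: additive_cosets_def subring)
    have "R \<inter> \<Inter>((\<lambda>H. R - H) ` additive_cosets R ((\<lambda>r. c * r) ` R)) \<in> r"
    proof (rule beta_Inter_mem[OF r])
      show "finite ((\<lambda>H. R - H) ` additive_cosets R ((\<lambda>r. c * r) ` R))"
        using finite_cosets[OF c] by simp
      fix A assume "A \<in> (\<lambda>H. R - H) ` additive_cosets R ((\<lambda>r. c * r) ` R)"
      then obtain H where H: "H \<in> additive_cosets R ((\<lambda>r. c * r) ` R)" "A = R - H" by auto
      then have "H \<notin> r" using neg by auto
      then show "A \<in> r" using betaD(6)[OF r sub[OF H(1)]] H(2) by simp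
    qed
    moreover have "x \<notin> R \<inter> \<Inter>((\<lambda>H. R - H) ` additive_cosets R ((\<lambda>r. c * r) ` R))" for x
    proof -
      have "x \<in> (\<lambda>y. x + y) ` (\<lambda>r. c * r) ` R" using subring(1) by (force simp: image_image)
      then show ?thesis by (auto simp: additive_cosets_def)
    qed
    ultimately show False using beta_nonempty_mem[OF r] by blast
  qed
  then obtain a where a: "a \<in> R" "(\<lambda>y. a + y) ` (\<lambda>r. c * r) ` R \<in> r"
    by (auto simp: additive_cosets_def)
  define r' where "r' = add.prod (principal_ultrafilter R (- a)) r"
  have r': "r' \<in> beta R" using a r by (auto simp: r'_def intro!: add.prod_beta principal_in_beta subring)
  have "add.pullback (- a) ((\<lambda>r. c * r) ` R) = (\<lambda>y. a + y) ` (\<lambda>r. c * r) ` R"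
  proof (intro equalityI subsetI)
    fix x assume "x \<in> add.pullback (- a) ((\<lambda>r. c * r) ` R)"
    then obtain y where "y \<in> R" "x + - a = c * y" by (auto simp: add.pullback_def)
    then have "x = a + c * y" by (simp add: algebra_simps)
    then show "x \<in> (\<lambda>y. a + y) ` (\<lambda>r. c * r) ` R" using \<open>y \<in> R\<close> by auto
  qed (use a c in \<open>auto simp: add.pullback_def subring\<close>)
  then have "(\<lambda>r. c * r) ` R \<in> r'"
    using a c subring by (auto simp: r'_def add.mem_prod_principal)
  then obtain q where q: "q \<in> beta R" "r' = dilate c q" using dilate_surj[OF c(1) r'] by auto
  have "r = add.prod (principal_ultrafilter R a) r'"
    using a r by (simp add: r'_def add_principal subring add_principal_0)
  then show ?thesis using that a(1) q by simp
qed

text \<open>To return from \<open>r + c p\<close> to \<open>c p\<close>, write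
  \<open>r = a + c q\<close>, take \<open>s\<close> with \<open>s + (q + p) = p\<close> from the
  minimality of \<open>p\<close>, and put \<open>t = c s + (- a)\<close>: the translations cancel
  and the dilation factors out.\<close>

lemma dilate_AMI:
  assumes c: "c \<in> R" "c \<noteq> 0" and p: "p \<in> AMI R"
  shows "dilate c p \<in> AMI R"
  unfolding AMI_iff
proof (intro conjI ballI)
  note p' = p[unfolded AMI_iff]
  show "dilate c p \<in> beta R" using p' c dilate_beta by simp
  show "nonprincipal R (dilate c p)" using p' c dilate_nonprincipal by simp
  show "add.prod (dilate c p) (dilate c p) = dilate c p"
    using p' dilate_add[OF c(1), of p p] by simp
  fix r assume "r \<in> beta R"
  then obtain a q where a: "a \<in> R" "q \<in> beta R" "r = add.prod (principal_ultrafilter R a) (dilate c q)"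
    using beta_coset[OF c] by metis
  then obtain s where s: "s \<in> beta R" "add.prod s (add.prod q p) = p" using p' by auto
  define t where "t = add.prod (dilate c s) (principal_ultrafilter R (- a))"
  have qp: "add.prod q p \<in> beta R" using a(2) p' add.prod_beta by simp
  have "add.prod t (add.prod r (dilate c p))
    = add.prod (dilate c s) (add.prod (principal_ultrafilter R (- a))
        (add.prod (principal_ultrafilter R a) (dilate c (add.prod q p))))"
    by (simp add: t_def a(3) add.prod_assoc dilate_add[OF c(1)])
  also have "\<dots> = add.prod (dilate c s) (dilate c (add.prod q p))"
    using a(1) dilate_beta[OF c(1) qp] by (simp add: add_principal subring add_principal_0)
  also have "\<dots> = dilate c p" using s(2) by (simp flip: dilate_add[OF c(1)])
  finally have "add.prod t (add.prod r (dilate c p)) = dilate c p" .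
  moreover have "t \<in> beta R"
    using a(1) s(1) c(1) by (auto simp: t_def intro!: add.prod_beta dilate_beta principal_in_beta subring)
  ultimately show "\<exists>s\<in>beta R. add.prod s (add.prod r (dilate c p)) = dilate c p" by auto
qed

lemma AMI_subset: "AMI R \<subseteq> beta R"
  by (auto simp: AMI_def)

lemmas in_closure_AMI = in_closure_of_beta[OF AMI_subset]

text \<open>Principal ultrafilters are isolated points, so one in the closure would already be in
  \<open>AMI R\<close>.\<close>

lemma closure_AMI_nonprincipal:
  assumes "p \<in> beta_topology R closure_of AMI R"
  shows "nonprincipal R p"
proof -
  have p: "p \<in> beta R" "\<And>E. E \<in> p \<Longrightarrow> \<exists>q\<in>AMI R. E \<in> q" using assms in_closure_AMI by auto
  have "R - {x} \<in> p" if "x \<in> R" for x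
  proof (rule ccontr)
    assume "R - {x} \<notin> p"
    then have "{x} \<in> p" using betaD(6)[OF p(1), of "{x}"] that by auto
    then obtain q where q: "q \<in> AMI R" "{x} \<in> q" using p(2) by metis
    then have "q \<in> beta R" "R - {x} \<in> q" using that by (auto simp: AMI_iff nonprincipal_iff)
    then show False using betaD(6)[of q R "{x}"] that q(2) by auto
  qed
  then show ?thesis by (simp add: nonprincipal_iff[OF p(1)])
qed

lemma dilate_closure_AMI:
  assumes c: "c \<in> R" "c \<noteq> 0" and p: "p \<in> beta_topology R closure_of AMI R"
  shows "dilate c p \<in> beta_topology R closure_of AMI R"
  unfolding in_closure_AMI
proof (intro conjI ballI)
  note p' = p[unfolded in_closure_AMI]
  show "dilate c p \<in> beta R" using p' c dilate_beta by simp
  fix E assume "E \<in> dilate c p"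
  then have E: "E \<subseteq> R" "{x \<in> R. c * x \<in> E} \<in> p" by (auto simp: mem_dilate[OF c(1)])
  then obtain q where "q \<in> AMI R" "{x \<in> R. c * x \<in> E} \<in> q" using p' by metis
  then show "\<exists>q\<in>AMI R. E \<in> q"
    using dilate_AMI[OF c] E(1) mem_dilate[OF c(1), of E q] by (auto intro!: bexI[of _ "dilate c q"])
qed

text \<open>A principal idempotent must sit at 0, as \<open>a + a = a\<close>. Recurrence then gives
  \<open>s + (r + 0) = 0\<close> for a nonprincipal \<open>r\<close>, which forces a finite set into
  \<open>r\<close>.\<close>

lemma minimal_idempotent_nonprincipal:
  assumes p: "p \<in> beta R" "add.prod p p = p" and rec: "\<forall>r\<in>beta R. \<exists>s\<in>beta R. add.prod s (add.prod r p) = p"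
  shows "nonprincipal R p"
proof -
  have "\<exists>r\<in>beta R. nonprincipal R r"
  proof -
    define \<Phi> where "\<Phi> = {R - A | A. finite A}"
    have "A \<inter> B \<in> \<Phi>" if AB: "A \<in> \<Phi>" "B \<in> \<Phi>" for A B
    proof -
      obtain A' B' where "A = R - A'" "B = R - B'" "finite A'" "finite B'" using AB by (auto simp: \<Phi>_def)
      then have "A \<inter> B = R - (A' \<union> B')" "finite (A' \<union> B')" by auto
      then show ?thesis unfolding \<Phi>_def by blast
    qed
    moreover have "R - A \<noteq> {}" if "finite A" for A
      using that infinite_ring by (metis Diff_eq_empty_iff finite_subset)
    then have "{} \<notin> \<Phi>" by (auto simp: \<Phi>_def)
    moreover have "\<Phi> \<subseteq> Pow R" "\<Phi> \<noteq> {}" by (auto simp: \<Phi>_def)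
    ultimately have "\<exists>r. r \<in> beta R \<and> \<Phi> \<subseteq> r" using beta_extend[of \<Phi> R] by metis
    then obtain r where r: "r \<in> beta R" "\<Phi> \<subseteq> r" by auto
    have "R - {x} \<in> \<Phi>" for x by (auto simp: \<Phi>_def)
    then have "nonprincipal R r" using r(2) by (auto simp: nonprincipal_iff[OF r(1)])
    then show ?thesis using r(1) by auto
  qed
  then obtain r where r: "r \<in> beta R" "nonprincipal R r" by auto
  show ?thesis
    unfolding nonprincipal_def
  proof (intro ballI notI)
    fix a assume a: "a \<in> R" "p = principal_ultrafilter R a"
    then have "{a} \<in> p" by (simp add: principal_ultrafilter_def)
    then have "{a} \<in> add.prod (principal_ultrafilter R a) p" using p(2) a by simp
    then have "{x \<in> R. x + a \<in> {a}} \<in> p" using a(1) by (simp add: add.mem_prod_principal add.pullback_def)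
    then have "a + a = a" by (simp add: a(2) principal_ultrafilter_def)
    then have "a = 0" by simp
    obtain s where s: "s \<in> beta R" "add.prod s (add.prod r p) = p" using rec r(1) by auto
    then have "{0} \<in> add.prod s (add.prod r p)" using \<open>{a} \<in> p\<close> \<open>a = 0\<close> by simp
    then have "{0} \<in> add.prod (add.prod s r) p" by (simp add: add.prod_assoc)
    then have "add.returns p {0} \<in> add.prod s r" by (simp add: add.mem_prod)
    moreover have "add.returns p {0} = {0}"
      unfolding add.returns_def a(2) \<open>a = 0\<close> using subring by (auto simp: principal_ultrafilter_def add.pullback_def)
    ultimately have "add.returns r {0} \<in> s" by (simp add: add.mem_prod)
    then obtain u where "u \<in> add.returns r {0}" using beta_nonempty_mem[OF s(1)] by blast
    then have u: "u \<in> R" "{x \<in> R. x + u \<in> {0}} \<in> r" by (auto simp: add.returns_def add.pullback_def)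
    have "{x \<in> R. x + u \<in> {0}} \<subseteq> {- u}" by (auto simp: add_eq_0_iff2)
    then have "finite {x \<in> R. x + u \<in> {0}}" by (rule finite_subset) simp
    then have "R - {x \<in> R. x + u \<in> {0}} \<in> r" by (rule nonprincipal_cofinite[OF r])
    then show False using u(2) betaD(6)[OF r(1), of "{x \<in> R. x + u \<in> {0}}"] by auto
  qed
qed

text \<open>\<open>Y\<close> is invariant under both actions because composing an affine map with a
  translation or a dilation is again affine. A minimal additive idempotent is found in
  \<open>Y\<close> first. The multiplicative step needs a closed set, so \<open>Y\<close> is cut
  with the closure of \<open>AMI R\<close>, which dilations preserve; the idempotent just found
  shows that the intersection is nonempty.\<close>

lemma thick_imp_DC:
  assumes T: "T \<subseteq> R" and thick: "\<And>G. finite G \<Longrightarrow> G \<subseteq> (R - {0}) \<times> R \<Longrightarrow> \<exists>x\<in>R. \<forall>(u, v)\<in>G. u * x + v \<in> T"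
  obtains p where "p \<in> DC_ultrafilters R" "T \<in> p"
proof -
  define D where "D = (\<lambda>(u, v). {x \<in> R. u * x + v \<in> T})"
  define I where "I = (R - {0}) \<times> R"
  define Y where "Y = {q \<in> beta R. \<forall>i\<in>I. D i \<in> q}"
  have I_ne: "(1, 0) \<in> I" if "(1::'a) \<noteq> 0" using that by (auto simp: I_def subring)
  have one: "(1::'a) \<noteq> 0"
  proof
    assume "(1::'a) = 0"
    then have "x = 0" for x :: 'a by (metis mult_1 mult_zero_left)
    then have "R \<subseteq> {0}" by auto
    then show False using infinite_ring finite_subset by auto
  qed
  have Y_eq: "Y = \<Inter>((\<lambda>i. {q \<in> beta R. D i \<in> q}) ` I)"
    using I_ne[OF one] unfolding Y_def by auto
  have Y_closed: "beta_closed R Y"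
    unfolding Y_eq by (rule beta_closed_Inter) (use I_ne[OF one] beta_closed_mem in auto)
  have Y_mem: "D i \<in> q" if "q \<in> Y" "i \<in> I" for q i using that by (simp add: Y_def)
  have Y_beta: "q \<in> beta R" if "q \<in> Y" for q using that by (simp add: Y_def)
  have "Y \<noteq> {}"
  proof -
    define \<Phi> where "\<Phi> = {R \<inter> \<Inter>(D ` G) | G. finite G \<and> G \<subseteq> I}"
    have "{} \<notin> \<Phi>"
    proof
      assume "{} \<in> \<Phi>"
      then obtain G where G: "finite G" "G \<subseteq> I" "{} = R \<inter> \<Inter>(D ` G)" by (auto simp: \<Phi>_def)
      then obtain x where "x \<in> R" "\<forall>(u, v)\<in>G. u * x + v \<in> T" using thick[of G] unfolding I_def by auto
      then have "x \<in> R \<inter> \<Inter>(D ` G)" by (auto simp: D_def)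
      then show False using G(3) by simp
    qed
    moreover have "A \<inter> B \<in> \<Phi>" if AB: "A \<in> \<Phi>" "B \<in> \<Phi>" for A B
    proof -
      obtain G G' where G: "A = R \<inter> \<Inter>(D ` G)" "finite G" "G \<subseteq> I" "B = R \<inter> \<Inter>(D ` G')" "finite G'" "G' \<subseteq> I"
        using AB by (auto simp: \<Phi>_def)
      then have "A \<inter> B = R \<inter> \<Inter>(D ` (G \<union> G'))" by auto
      moreover have "finite (G \<union> G')" "G \<union> G' \<subseteq> I" using G by auto
      ultimately show ?thesis unfolding \<Phi>_def by blast
    qed
    moreover have "\<Phi> \<subseteq> Pow R" by (auto simp: \<Phi>_def)
    moreover have "\<Phi> \<noteq> {}" by (auto simp: \<Phi>_def)
    ultimately have "\<exists>r. r \<in> beta R \<and> \<Phi> \<subseteq> r" using beta_extend[of \<Phi> R] by metis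
    then obtain r where r: "r \<in> beta R" "\<Phi> \<subseteq> r" by auto
    have "D i \<in> r" if "i \<in> I" for i
    proof -
      have "D i = R \<inter> \<Inter>(D ` {i})" by (auto simp: D_def)
      then have "D i \<in> \<Phi>" using that unfolding \<Phi>_def by blast
      then show ?thesis using r(2) by auto
    qed
    then show ?thesis using r(1) by (auto simp: Y_def)
  qed
  moreover have "add.invariant Y"
    unfolding add.invariant_def
  proof (intro conjI ballI)
    show "Y \<subseteq> add.betaT" using Y_beta by auto
    fix q w assume q: "q \<in> Y" and w: "w \<in> R"
    have "D i \<in> add.prod (principal_ultrafilter R w) q" if "i \<in> I" for i
    proof -
      obtain u v where i: "i = (u, v)" "u \<in> R - {0}" "v \<in> R" using \<open>i \<in> I\<close> by (auto simp: I_def)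
      have "add.pullback w (D i) = D (u, u * w + v)"
        using w unfolding add.pullback_def D_def i(1) by (auto simp: subring algebra_simps)
      moreover have "(u, u * w + v) \<in> I" using i w by (auto simp: I_def subring)
      ultimately show ?thesis
        using Y_mem[OF q] w by (auto simp: add.mem_prod_principal D_def)
    qed
    then show "add.prod (principal_ultrafilter R w) q \<in> Y"
      using Y_beta[OF q] w by (simp add: Y_def add.prod_beta principal_in_beta)
  qed
  ultimately obtain L where L: "L \<subseteq> Y" "add.minimal L" using add.minimal_exists[OF Y_closed] by metis
  then obtain p0 where p0: "p0 \<in> L" "add.prod p0 p0 = p0" using add.minimal_idempotent by metis
  have p0_beta: "p0 \<in> beta R" using L(1) p0(1) Y_beta by auto
  have rec: "\<forall>r\<in>beta R. \<exists>s\<in>beta R. add.prod s (add.prod r p0) = p0"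
    using add.minimal_iff_recurrent[of p0] p0_beta L(2) p0(1) by auto
  have "p0 \<in> AMI R"
    using p0_beta p0(2) rec minimal_idempotent_nonprincipal by (simp add: AMI_iff)
  define V where "V = Y \<inter> (beta_topology R closure_of AMI R)"
  have "p0 \<in> V"
    using \<open>p0 \<in> AMI R\<close> L(1) p0(1) closure_of_subset[of "AMI R" "beta_topology R"] AMI_subset
    unfolding V_def by auto
  have V_closed: "beta_closed R V"
    unfolding V_def by (intro beta_closed_Int Y_closed beta_closed_closure_of AMI_subset)
  have "mul.invariant V"
    unfolding mul.invariant_def
  proof (intro conjI ballI)
    show "V \<subseteq> mul.betaT"
    proof
      fix q assume "q \<in> V"
      then have "q \<in> beta R" "nonprincipal R q"
        using closure_AMI_nonprincipal Y_beta by (auto simp: V_def)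
      then show "q \<in> mul.betaT" using subring(1) by (simp add: mul.betaT_def nonprincipal_iff)
    qed
    fix q c assume q: "q \<in> V" and c: "c \<in> R - {0}"
    have "D i \<in> dilate c q" if "i \<in> I" for i
    proof -
      obtain u v where i: "i = (u, v)" "u \<in> R - {0}" "v \<in> R" using \<open>i \<in> I\<close> by (auto simp: I_def)
      have "{x \<in> R. c * x \<in> D i} = D (u * c, v)"
        using c by (auto simp: D_def i(1) algebra_simps subring)
      moreover have "(u * c, v) \<in> I" using i c domain[of u c] by (auto simp: I_def subring)
      ultimately show ?thesis
        using Y_mem q c by (auto simp: mem_dilate V_def) (auto simp: D_def)
    qed
    then have "dilate c q \<in> V"
      using q c dilate_closure_AMI[of c q] dilate_beta[of c q] by (auto simp: V_def Y_def)
    then show "mul.prod (principal_ultrafilter R c) q \<in> V" by (simp add: dilate_def)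
  qed
  then obtain Z where Z: "Z \<subseteq> V" "mul.minimal Z" using mul.minimal_exists[OF V_closed] \<open>p0 \<in> V\<close> by blast
  then obtain p where p: "p \<in> Z" "mul.prod p p = p" using mul.minimal_idempotent by metis
  have "p \<in> MMI R"
    unfolding MMI_def beta_star_eq beta_times_eq minimal_SM_eq
    using mul.minimalD(4)[OF Z(2)] p Z closure_AMI_nonprincipal by (auto simp: V_def)
  then have "p \<in> DC_ultrafilters R" using p(1) Z(1) by (auto simp: DC_ultrafilters_def V_def)
  moreover have "D (1, 0) = T" using T by (auto simp: D_def)
  then have "T \<in> p" using Y_mem[OF _ I_ne[OF one]] p(1) Z(1) by (auto simp: V_def)
  ultimately show ?thesis by (rule that)
qed

lemma DC_star_affinely_syndetic:
  assumes S: "S \<subseteq> R" and mem: "\<And>p. p \<in> DC_ultrafilters R \<Longrightarrow> S \<in> p"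
  shows "DC_star R S \<and> affinely_syndetic R S"
proof
  have DC_beta: "p \<in> beta R" if "p \<in> DC_ultrafilters R" for p
    using that by (simp add: DC_ultrafilters_def MMI_def beta_star_def)
  show "DC_star R S"
    unfolding DC_star_def DC_def
  proof (intro conjI allI impI S)
    fix C assume "C \<subseteq> R \<and> (\<exists>p\<in>DC_ultrafilters R. C \<in> p)"
    then obtain p where p: "p \<in> DC_ultrafilters R" "C \<in> p" by auto
    show "S \<inter> C \<noteq> {}"
      by (rule beta_nonempty_mem[OF DC_beta[OF p(1)] betaD(4)[OF DC_beta[OF p(1)] mem[OF p(1)] p(2)]])
  qed
  show "affinely_syndetic R S"
  proof (rule ccontr)
    assume neg: "\<not> affinely_syndetic R S"
    have thick: "\<exists>x\<in>R. \<forall>(u, v)\<in>G. u * x + v \<in> R - S" if G: "finite G" "G \<subseteq> (R - {0}) \<times> R" for G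
    proof -
      define H where "H = (\<lambda>(u, v). restrict (\<lambda>x. u * x + v) R) ` G"
      have "finite H" using G by (simp add: H_def)
      moreover have "H \<subseteq> affine_maps R"
      proof
        fix g assume "g \<in> H"
        then obtain u v where "(u, v) \<in> G" "g = restrict (\<lambda>x. u * x + v) R" by (auto simp: H_def)
        moreover from this have "u \<in> R - {0} \<and> v \<in> R" using G(2) by blast
        ultimately show "g \<in> affine_maps R" unfolding affine_maps_def by blast
      qed
      ultimately have "\<not> (\<forall>x\<in>R. \<exists>g\<in>H. g x \<in> S)"
        using neg S unfolding affinely_syndetic_def by (metis (no_types, lifting))
      then have "\<exists>x\<in>R. \<forall>g\<in>H. g x \<notin> S" by simp
      then obtain x where x: "x \<in> R" "\<forall>g\<in>H. g x \<notin> S" by (elim bexE)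
      have "u * x + v \<in> R - S" if "(u, v) \<in> G" for u v
      proof -
        have "restrict (\<lambda>x. u * x + v) R \<in> H" using that by (force simp: H_def)
        then have "u * x + v \<notin> S" using x by force
        then show ?thesis using x(1) that G(2) by (auto simp: subring)
      qed
      then show ?thesis using x(1) by auto
    qed
    obtain p where p: "p \<in> DC_ultrafilters R" "R - S \<in> p"
      using thick_imp_DC[OF Diff_subset thick] .
    then show False using mem[OF p(1)] betaD(6)[OF DC_beta[OF p(1)] S] by simp
  qed
qed

end

section \<open>Limits along ultrafilters\<close>

text \<open>Ultrafilters as elements of the type \<open>filter\<close>, so that limits can be taken
  along them; used for \<open>ufilt p\<close> on the ring and for the index filter on the natural
  numbers.\<close>

definition ultra :: "'a filter \<Rightarrow> bool" where
  "ultra F \<longleftrightarrow> F \<noteq> bot \<and> (\<forall>P. eventually P F \<or> eventually (\<lambda>x. \<not> P x) F)"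

lemma ultra_not_eventually: "ultra F \<Longrightarrow> \<not> eventually P F \<longleftrightarrow> eventually (\<lambda>x. \<not> P x) F"
proof
  assume F: "ultra F" and "eventually (\<lambda>x. \<not> P x) F"
  show "\<not> eventually P F"
  proof
    assume "eventually P F"
    with \<open>eventually (\<lambda>x. \<not> P x) F\<close> have "eventually (\<lambda>x. False) F" by eventually_elim simp
    then show False using F by (simp add: ultra_def eventually_False)
  qed
qed (auto simp: ultra_def)

text \<open>\<open>Lim\<close> makes this total; the value is informative only where a limit exists,
  which \<open>ultra_tendsto_ulim\<close> ensures for eventually bounded functions.\<close>

definition ulim :: "'a filter \<Rightarrow> ('a \<Rightarrow> real) \<Rightarrow> real" where
  "ulim F \<phi> = Lim F \<phi>"

text \<open>Compactness of the interval gives a cluster point, and along an ultrafilter a cluster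
  point is a limit.\<close>

lemma ultra_tendsto_ulim:
  assumes F: "ultra F" and bd: "eventually (\<lambda>x. \<bar>\<phi> x\<bar> \<le> C) F"
  shows "(\<phi> \<longlongrightarrow> ulim F \<phi>) F"
proof -
  have "filtermap \<phi> F \<noteq> bot" using F by (simp add: ultra_def filtermap_bot_iff)
  moreover have "eventually (\<lambda>y. y \<in> {-C..C}) (filtermap \<phi> F)"
    using bd by (auto simp: eventually_filtermap abs_le_iff elim!: eventually_mono)
  ultimately have "\<exists>l\<in>{-C..C}. inf (nhds l) (filtermap \<phi> F) \<noteq> bot"
    using compact_Icc[of "-C" C] unfolding compact_filter by (elim allE impE)
  then obtain l where l: "inf (nhds l) (filtermap \<phi> F) \<noteq> bot" by (elim bexE)
  have "(\<phi> \<longlongrightarrow> l) F"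
  proof (rule topological_tendstoI, rule ccontr)
    fix S assume S: "open S" "l \<in> S" "\<not> eventually (\<lambda>x. \<phi> x \<in> S) F"
    then have "eventually (\<lambda>y. y \<notin> S) (filtermap \<phi> F)"
      using F by (simp add: eventually_filtermap ultra_not_eventually)
    moreover have "eventually (\<lambda>y. y \<in> S) (nhds l)" using S by (simp add: eventually_nhds_in_open)
    ultimately have "eventually (\<lambda>_. False) (inf (nhds l) (filtermap \<phi> F))"
      unfolding eventually_inf by blast
    then show False using l by (simp add: eventually_False)
  qed
  moreover from this have "ulim F \<phi> = l" using F unfolding ulim_def by (intro tendsto_Lim) (auto simp: ultra_def)
  ultimately show ?thesis by simp
qed

lemma ulim_eqI: "ultra F \<Longrightarrow> (\<phi> \<longlongrightarrow> l) F \<Longrightarrow> ulim F \<phi> = l"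
  unfolding ulim_def by (intro tendsto_Lim) (auto simp: ultra_def)

lemma ultra_ne_bot: "ultra F \<Longrightarrow> F \<noteq> bot"
  by (simp add: ultra_def)

lemma tendsto_dist_bound:
  fixes \<phi> :: "'a \<Rightarrow> real"
  assumes "F \<noteq> bot" "(\<phi> \<longlongrightarrow> l) F" "eventually (\<lambda>x. \<bar>\<phi> x - a\<bar> \<le> e) F"
  shows "\<bar>l - a\<bar> \<le> e"
proof -
  have "((\<lambda>x. \<bar>\<phi> x - a\<bar>) \<longlongrightarrow> \<bar>l - a\<bar>) F" by (intro tendsto_intros assms)
  from this assms(3,1) show ?thesis by (rule tendsto_upperbound)
qed

lemma tendsto_dist_bound2:
  fixes \<phi> \<psi> :: "'a \<Rightarrow> real"
  assumes "F \<noteq> bot" "(\<phi> \<longlongrightarrow> l) F" "(\<psi> \<longlongrightarrow> m) F" "eventually (\<lambda>x. \<bar>\<phi> x - \<psi> x\<bar> \<le> e) F"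
  shows "\<bar>l - m\<bar> \<le> e"
proof -
  have "((\<lambda>x. \<phi> x - \<psi> x) \<longlongrightarrow> l - m) F" by (intro tendsto_intros assms)
  then show ?thesis using tendsto_dist_bound[of F "\<lambda>x. \<phi> x - \<psi> x" "l - m" 0 e] assms by simp
qed

text \<open>Source of the Cauchy--Schwarz inequality, of \<open>approx_Riesz\<close> and of
  \<open>mixing_limit\<close>. The form may be degenerate, hence the case
  \<open>c = 0\<close>.\<close>

lemma quadratic_discriminant_le:
  fixes a b c :: real
  assumes "\<And>t. 0 \<le> a - 2 * t * b + t\<^sup>2 * c" "0 \<le> c"
  shows "b\<^sup>2 \<le> a * c"
proof (cases "c = 0")
  case True
  have "b = 0"
  proof (rule ccontr)
    assume "b \<noteq> 0"
    \<comment> \<open>This \<open>t\<close> is chosen to give the expression the value -1.\<close>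
    have "0 \<le> a - 2 * ((a + 1) / (2 * b)) * b" using assms(1)[of "(a + 1) / (2 * b)"] True by simp
    also have "\<dots> = -1" using \<open>b \<noteq> 0\<close> by (simp add: field_simps)
    finally show False by simp
  qed
  then show ?thesis using True by simp
next
  case False
  then have c: "c > 0" using assms(2) by simp
  have "0 \<le> a - 2 * (b / c) * b + (b / c)\<^sup>2 * c" by (rule assms(1))
  also have "\<dots> = a - b\<^sup>2 / c" using c by (simp add: power2_eq_square field_simps)
  finally show ?thesis using c by (simp add: field_simps)
qed

section \<open>Semi-inner products\<close>

text \<open>Only semidefinite: a nonzero bounded function can have mean square 0. The form is a
  parameter because it depends on the Folner sequence and on the ultrafilter along which averages
  are taken.\<close>

locale semi_inner =
  fixes ip :: "'v::real_vector \<Rightarrow> 'v \<Rightarrow> real"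
  assumes ip_add: "ip (x + y) z = ip x z + ip y z"
    and ip_scale: "ip (c *\<^sub>R x) z = c * ip x z"
    and ip_sym: "ip x y = ip y x"
    and ip_nonneg: "0 \<le> ip x x"
begin

definition nrm :: "'v \<Rightarrow> real" where
  "nrm x = sqrt (ip x x)"

lemma ip_add2: "ip z (x + y) = ip z x + ip z y"
  using ip_add[of x y z] by (simp add: ip_sym)

lemma ip_scale2: "ip z (c *\<^sub>R x) = c * ip z x"
  using ip_scale[of c x z] by (simp add: ip_sym)

lemma ip_zero [simp]: "ip 0 z = 0" "ip z 0 = 0"
  using ip_scale[of 0 0 z] ip_scale2[of z 0 0] by simp_all

lemma ip_minus: "ip (- x) z = - ip x z" "ip z (- x) = - ip z x"
  using ip_scale[of "-1" x z] ip_scale2[of z "-1" x] by simp_all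

lemma ip_diff: "ip (x - y) z = ip x z - ip y z" "ip z (x - y) = ip z x - ip z y"
  using ip_add[of x "- y" z] ip_add2[of z x "- y"] by (simp_all add: ip_minus)

lemmas ip_simps = ip_add ip_add2 ip_scale ip_scale2 ip_minus ip_diff

lemma nrm_nonneg [simp]: "0 \<le> nrm x"
  by (simp add: nrm_def ip_nonneg)

lemma nrm_power2: "(nrm x)\<^sup>2 = ip x x"
  by (simp add: nrm_def ip_nonneg)

lemma Cauchy_Schwarz: "\<bar>ip x y\<bar> \<le> nrm x * nrm y"
proof -
  have "0 \<le> ip x x - 2 * t * ip x y + t\<^sup>2 * ip y y" for t
    using ip_nonneg[of "x - t *\<^sub>R y"] ip_sym[of x y]
    by (simp add: ip_simps power2_eq_square algebra_simps)
  then have "(ip x y)\<^sup>2 \<le> ip x x * ip y y" by (rule quadratic_discriminant_le) (rule ip_nonneg)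
  then have "(ip x y)\<^sup>2 \<le> (nrm x * nrm y)\<^sup>2" by (simp add: power_mult_distrib nrm_power2)
  then show ?thesis by (simp add: abs_le_square_iff[symmetric])
qed

lemma nrm_diff_le: "nrm (x - y) \<le> nrm x + nrm y"
proof (rule power2_le_imp_le)
  have "(nrm (x - y))\<^sup>2 = (nrm x)\<^sup>2 - 2 * ip x y + (nrm y)\<^sup>2"
    unfolding nrm_power2 using ip_sym[of x y] by (simp add: ip_simps)
  also have "\<dots> \<le> (nrm x + nrm y)\<^sup>2"
    using Cauchy_Schwarz[of x y] by (simp add: power2_sum)
  finally show "(nrm (x - y))\<^sup>2 \<le> (nrm x + nrm y)\<^sup>2" .
qed simp

text \<open>A substitute for the Riesz representation theorem in the absence of completeness: a
  near-maximiser of \<open>h \<mapsto> 2 L h - \<parallel>h\<parallel>\<^sup>2\<close> almost represents \<open>L\<close>.\<close>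

lemma approx_Riesz:
  assumes lin: "\<And>x y t. L (x + t *\<^sub>R y) = L x + t * L y"
    and bd: "\<And>x. \<bar>L x\<bar> \<le> C * nrm x" and "0 \<le> C" "\<delta> > 0"
  obtains h where "\<And>g. \<bar>L g - ip h g\<bar> \<le> \<delta> * nrm g" "nrm h \<le> C + \<delta>"
proof -
  define J where "J h = 2 * L h - ip h h" for h
  have J_le: "J h \<le> C\<^sup>2" for h
  proof -
    have "J h \<le> 2 * (C * nrm h) - (nrm h)\<^sup>2" using bd[of h] by (simp add: J_def nrm_power2)
    also have "\<dots> = C\<^sup>2 - (C - nrm h)\<^sup>2" by (simp add: power2_diff)
    also have "\<dots> \<le> C\<^sup>2" by simp
    finally show ?thesis .
  qed
  define s where "s = (SUP h. J h)"
  have bdd: "bdd_above (range J)" using J_le by (auto simp: bdd_above_def)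
  \<comment> \<open>The tolerance is \<open>\<delta>\<^sup>2\<close> because it becomes the constant
    term of the quadratic in \<open>t\<close> below, whose discriminant bound then reads
    \<open>\<delta> * nrm g\<close>.\<close>
  have "s - \<delta>\<^sup>2 < s" using \<open>\<delta> > 0\<close> by simp
  then obtain h where h: "s - \<delta>\<^sup>2 < J h"
    unfolding s_def using less_cSUP_iff[OF _ bdd] by auto
  have approx: "\<bar>L g - ip h g\<bar> \<le> \<delta> * nrm g" for g
  proof -
    have "0 \<le> \<delta>\<^sup>2 - 2 * t * (L g - ip h g) + t\<^sup>2 * ip g g" for t
    proof -
      have "J (h + t *\<^sub>R g) \<le> s" unfolding s_def using bdd by (intro cSUP_upper) auto
      moreover have "J (h + t *\<^sub>R g) = J h + 2 * t * (L g - ip h g) - t\<^sup>2 * ip g g"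
        using ip_sym[of h g] by (simp add: J_def lin ip_simps power2_eq_square algebra_simps)
      ultimately show ?thesis using h by simp
    qed
    then have "(L g - ip h g)\<^sup>2 \<le> \<delta>\<^sup>2 * ip g g" by (rule quadratic_discriminant_le) (rule ip_nonneg)
    then have "(L g - ip h g)\<^sup>2 \<le> (\<delta> * nrm g)\<^sup>2" by (simp add: power_mult_distrib nrm_power2)
    then show ?thesis using \<open>\<delta> > 0\<close> by (simp add: abs_le_square_iff[symmetric])
  qed
  moreover have "nrm h \<le> C + \<delta>"
  proof -
    have "(nrm h)\<^sup>2 \<le> \<bar>L h\<bar> + \<delta> * nrm h" using approx[of h] by (simp add: nrm_power2)
    also have "\<dots> \<le> (C + \<delta>) * nrm h" using bd[of h] by (simp add: algebra_simps)
    finally have "nrm h * nrm h \<le> (C + \<delta>) * nrm h" by (simp add: power2_eq_square)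
    then show ?thesis using nrm_nonneg[of h] \<open>0 \<le> C\<close> \<open>\<delta> > 0\<close> by (auto simp: mult_le_cancel_right)
  qed
  ultimately show ?thesis by (rule that)
qed

lemma ip_bounded:
  assumes "nrm x \<le> C" "nrm y \<le> D"
  shows "\<bar>ip x y\<bar> \<le> C * D"
proof -
  have "0 \<le> C" using assms(1) nrm_nonneg[of x] by linarith
  then have "nrm x * nrm y \<le> C * D" by (intro mult_mono assms nrm_nonneg)
  then show ?thesis using Cauchy_Schwarz[of x y] by linarith
qed

lemma ip_sum_list:
  "ip (\<Sum>x\<leftarrow>xs. c x) z = (\<Sum>x\<leftarrow>xs. ip (c x) z)"
  "ip z (\<Sum>x\<leftarrow>xs. c x) = (\<Sum>x\<leftarrow>xs. ip z (c x))"
  by (induction xs) (simp_all add: ip_add ip_add2)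

lemma Gram_nonneg: "0 \<le> (\<Sum>x\<leftarrow>xs. \<Sum>y\<leftarrow>xs. ip (c x) (c y))"
proof -
  have "(\<Sum>x\<leftarrow>xs. \<Sum>y\<leftarrow>xs. ip (c x) (c y)) = ip (\<Sum>x\<leftarrow>xs. c x) (\<Sum>y\<leftarrow>xs. c y)"
    by (simp only: ip_sum_list(1)) (simp only: ip_sum_list(2))
  then show ?thesis by (simp add: ip_nonneg)
qed

lemma tendsto_ulim_ip:
  assumes "ultra F" "\<And>u. nrm (a u) \<le> C" "\<And>u. nrm (b u) \<le> D"
  shows "((\<lambda>u. ip (a u) (b u)) \<longlongrightarrow> ulim F (\<lambda>u. ip (a u) (b u))) F"
  using assms by (intro ultra_tendsto_ulim[of F _ "C * D"]) (auto simp: ip_bounded)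

lemma ulim_ip_abs_le:
  assumes "ultra F" "\<And>u. nrm (a u) \<le> C" "\<And>u. nrm (b u) \<le> D"
  shows "\<bar>ulim F (\<lambda>u. ip (a u) (b u))\<bar> \<le> C * D"
  using tendsto_dist_bound[OF ultra_ne_bot[OF assms(1)] tendsto_ulim_ip[OF assms], where a = 0 and e = "C * D"]
    ip_bounded[OF assms(2,3)] by simp

lemma ulim_ip_linear:
  assumes "ultra F" "\<And>u. nrm (a u) \<le> C"
  shows "ulim F (\<lambda>u. ip (a u) (x + t *\<^sub>R y)) = ulim F (\<lambda>u. ip (a u) x) + t * ulim F (\<lambda>u. ip (a u) y)"
proof (rule ulim_eqI[OF assms(1)])
  show "((\<lambda>u. ip (a u) (x + t *\<^sub>R y)) \<longlongrightarrow> ulim F (\<lambda>u. ip (a u) x) + t * ulim F (\<lambda>u. ip (a u) y)) F"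
    unfolding ip_add2 ip_scale2
    by (intro tendsto_intros tendsto_ulim_ip[OF assms(1), of _ C _ "nrm x"]
        tendsto_ulim_ip[OF assms(1), of _ C _ "nrm y"]) (auto simp: assms(2))
qed

text \<open>Grothendieck's double limit criterion.\<close>

lemma ulim_commute:
  assumes F: "ultra F" "ultra G" and bd: "\<And>v. nrm (a v) \<le> C" "\<And>u. nrm (b u) \<le> C"
  shows "ulim F (\<lambda>u. ulim G (\<lambda>v. ip (a v) (b u))) = ulim G (\<lambda>v. ulim F (\<lambda>u. ip (a v) (b u)))"
proof -
  have C: "0 \<le> C" using bd(1) nrm_nonneg order_trans by blast
  define L where "L g = ulim G (\<lambda>v. ip (a v) g)" for g
  define M where "M g = ulim F (\<lambda>u. ip (b u) g)" for g
  have L_le: "\<bar>L g\<bar> \<le> C * nrm g" for g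
    unfolding L_def by (rule ulim_ip_abs_le) (use F bd in auto)
  have M_le: "\<bar>M g\<bar> \<le> C * nrm g" for g
    unfolding M_def by (rule ulim_ip_abs_le) (use F bd in auto)
  have L_bd: "\<bar>L (b u)\<bar> \<le> C * C" for u
    using L_le[of "b u"] mult_left_mono[OF bd(2)[of u] C] by linarith
  have M_bd: "\<bar>M (a v)\<bar> \<le> C * C" for v
    using M_le[of "a v"] mult_left_mono[OF bd(1)[of v] C] by linarith
  define l where "l = ulim F (\<lambda>u. L (b u))"
  define m where "m = ulim G (\<lambda>v. M (a v))"
  have l: "((\<lambda>u. L (b u)) \<longlongrightarrow> l) F"
    unfolding l_def using L_bd by (intro ultra_tendsto_ulim[OF F(1), of _ "C * C"]) auto
  have m: "((\<lambda>v. M (a v)) \<longlongrightarrow> m) G"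
    unfolding m_def using M_bd by (intro ultra_tendsto_ulim[OF F(2), of _ "C * C"]) auto
  have "\<bar>l - m\<bar> \<le> \<delta> * (4 * (C + 1))" if \<delta>: "0 < \<delta>" "\<delta> \<le> 1" for \<delta>
  proof -
    obtain h where h: "\<And>g. \<bar>L g - ip h g\<bar> \<le> \<delta> * nrm g" "nrm h \<le> C + \<delta>"
    proof (rule approx_Riesz[of L C \<delta>])
      show "L (x + t *\<^sub>R y) = L x + t * L y" for x y t
        unfolding L_def by (rule ulim_ip_linear) (use F bd in auto)
    qed (use L_le C \<delta> in auto)
    obtain k where k: "\<And>g. \<bar>M g - ip k g\<bar> \<le> \<delta> * nrm g" "nrm k \<le> C + \<delta>"
    proof (rule approx_Riesz[of M C \<delta>])
      show "M (x + t *\<^sub>R y) = M x + t * M y" for x y t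
        unfolding M_def by (rule ulim_ip_linear) (use F bd in auto)
    qed (use M_le C \<delta> in auto)
    have d: "\<delta> * nrm (b u) \<le> \<delta> * C" "\<delta> * nrm (a v) \<le> \<delta> * C" for u v
      using bd \<delta> by (auto intro: mult_left_mono)
    have d': "\<delta> * nrm h \<le> \<delta> * (C + 1)" "\<delta> * nrm k \<le> \<delta> * (C + 1)"
      using h(2) k(2) \<delta> by (auto intro!: mult_left_mono)
    have Mh: "((\<lambda>u. ip h (b u)) \<longlongrightarrow> M h) F"
      using tendsto_ulim_ip[OF F(1), of b C "\<lambda>_. h" "nrm h"] bd(2) by (simp add: M_def ip_sym[of h])
    have Lk: "((\<lambda>v. ip k (a v)) \<longlongrightarrow> L k) G"
      using tendsto_ulim_ip[OF F(2), of a C "\<lambda>_. k" "nrm k"] bd(1) by (simp add: L_def ip_sym[of k])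
    \<comment> \<open>Both iterated limits are close to \<open>ip h k\<close>, by the chain
      \<open>l\<close>, \<open>M h\<close>, \<open>ip h k\<close>, \<open>L k\<close>,
      \<open>m\<close>. The outer links replace \<open>L\<close> by \<open>ip h\<close> and
      \<open>M\<close> by \<open>ip k\<close> before a limit is taken, the inner ones at the fixed
      vectors \<open>k\<close> and \<open>h\<close>.\<close>
    have "\<bar>l - M h\<bar> \<le> \<delta> * C"
      using order_trans[OF h(1) d(1)] by (intro tendsto_dist_bound2[OF ultra_ne_bot[OF F(1)] l Mh]) auto
    moreover have "\<bar>m - L k\<bar> \<le> \<delta> * C"
      using order_trans[OF k(1) d(2)] by (intro tendsto_dist_bound2[OF ultra_ne_bot[OF F(2)] m Lk]) auto
    moreover have "\<bar>L k - ip h k\<bar> \<le> \<delta> * (C + 1)" using h(1)[of k] d' by linarith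
    moreover have "\<bar>M h - ip h k\<bar> \<le> \<delta> * (C + 1)" using k(1)[of h] d' ip_sym[of h k] by linarith
    moreover have "\<delta> * C \<le> \<delta> * (C + 1)" using \<delta> by simp
    ultimately have "\<bar>l - m\<bar> \<le> 4 * (\<delta> * (C + 1))" by linarith
    then show ?thesis by (simp add: algebra_simps)
  qed
  then have ev: "eventually (\<lambda>\<delta>. \<bar>l - m\<bar> \<le> \<delta> * (4 * (C + 1))) (at_right 0)"
    using eventually_at_right_real[of 0 1] by (auto elim!: eventually_mono)
  have "((\<lambda>\<delta>. \<delta> * (4 * (C + 1))) \<longlongrightarrow> 0 * (4 * (C + 1))) (at_right 0)" by (intro tendsto_intros)
  then have "\<bar>l - m\<bar> \<le> 0 * (4 * (C + 1))"
    using ev by (intro tendsto_lowerbound[where F = "at_right 0"]) auto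
  then have "l = m" by simp
  then show ?thesis by (simp add: l_def m_def L_def M_def ip_sym[of "b _"])
qed

end

section \<open>Ultrafilters as filters\<close>

definition ufilt :: "'a set set \<Rightarrow> 'a filter" where
  "ufilt p = (INF A\<in>p. principal A)"

lemma eventually_ufilt:
  assumes p: "p \<in> beta X"
  shows "eventually P (ufilt p) \<longleftrightarrow> {x \<in> X. P x} \<in> p"
proof -
  have "eventually P (ufilt p) \<longleftrightarrow> (\<exists>A\<in>p. eventually P (principal A))"
    unfolding ufilt_def
  proof (rule eventually_INF_base)
    show "p \<noteq> {}" using betaD(2)[OF p] by auto
    show "\<exists>C\<in>p. principal C \<le> inf (principal A) (principal B)" if "A \<in> p" "B \<in> p" for A B
      using betaD(4)[OF p that] by (auto intro!: bexI[of _ "A \<inter> B"])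
  qed
  also have "\<dots> \<longleftrightarrow> {x \<in> X. P x} \<in> p"
  proof
    assume "\<exists>A\<in>p. eventually P (principal A)"
    then obtain A where A: "A \<in> p" "\<forall>x\<in>A. P x" by (auto simp: eventually_principal)
    then have "A \<subseteq> {x \<in> X. P x}" using betaD(1)[OF p A(1)] by auto
    then show "{x \<in> X. P x} \<in> p" using betaD(5)[OF p A(1)] by simp
  next
    assume "{x \<in> X. P x} \<in> p"
    then show "\<exists>A\<in>p. eventually P (principal A)"
      by (intro bexI[of _ "{x \<in> X. P x}"]) (auto simp: eventually_principal)
  qed
  finally show ?thesis .
qed

lemma ultra_ufilt:
  assumes p: "p \<in> beta X"
  shows "ultra (ufilt p)"
  unfolding ultra_def
proof (intro conjI allI)
  show "ufilt p \<noteq> bot"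
    using betaD(3)[OF p] eventually_ufilt[OF p, of "\<lambda>_. False"] by (auto simp: eventually_False[symmetric])
  fix P
  have "X - {x \<in> X. P x} = {x \<in> X. \<not> P x}" by auto
  then show "eventually P (ufilt p) \<or> eventually (\<lambda>x. \<not> P x) (ufilt p)"
    using betaD(6)[OF p, of "{x \<in> X. P x}"] by (auto simp: eventually_ufilt[OF p])
qed

lemma eventually_ufilt_cofinite:
  assumes "p \<in> beta X" "nonprincipal X p" "finite A"
  shows "eventually (\<lambda>x. x \<in> X - A) (ufilt p)"
  using nonprincipal_cofinite[OF assms] by (simp add: eventually_ufilt[OF assms(1)] set_diff_eq)

text \<open>A member of \<open>p\<close> on which \<phi> avoids a neighbourhood of \<open>l\<close>
  is also a member of some \<open>q\<close> in \<open>Y\<close>, so a limit common to all points of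
  \<open>Y\<close> survives. This extends limits from \<open>AMI R\<close> to its closure.\<close>

lemma tendsto_ufilt_closure:
  fixes \<phi> :: "'a \<Rightarrow> 'b::topological_space"
  assumes Y: "Y \<subseteq> beta X" and p: "p \<in> beta_topology X closure_of Y"
    and lim: "\<And>q. q \<in> Y \<Longrightarrow> (\<phi> \<longlongrightarrow> l) (ufilt q)"
  shows "(\<phi> \<longlongrightarrow> l) (ufilt p)"
proof (rule topological_tendstoI, rule ccontr)
  have p': "p \<in> beta X" "\<And>E. E \<in> p \<Longrightarrow> \<exists>q\<in>Y. E \<in> q" using p in_closure_of_beta[OF Y] by auto
  fix S assume S: "open S" "l \<in> S" "\<not> eventually (\<lambda>x. \<phi> x \<in> S) (ufilt p)"
  then have "{x \<in> X. \<phi> x \<notin> S} \<in> p"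
    using ultra_not_eventually[OF ultra_ufilt[OF p'(1)]] by (simp add: eventually_ufilt[OF p'(1)])
  then obtain q where q: "q \<in> Y" "{x \<in> X. \<phi> x \<notin> S} \<in> q" using p'(2) by metis
  have q': "q \<in> beta X" using Y q(1) by (rule subsetD)
  have "eventually (\<lambda>x. \<phi> x \<notin> S) (ufilt q)" using q(2) by (simp add: eventually_ufilt[OF q'])
  then show False
    using topological_tendstoD[OF lim[OF q(1)] S(1,2)] ultra_not_eventually[OF ultra_ufilt[OF q']] by blast
qed

section \<open>Limits along products, and positivity along idempotents\<close>

context acting_semigroup
begin

lemma eventually_ufilt_prod:
  assumes "p \<in> beta X" "q \<in> beta X"
  shows "eventually P (ufilt (prod p q)) \<longleftrightarrow>
    eventually (\<lambda>u. eventually (\<lambda>x. P (f u x)) (ufilt q)) (ufilt p)"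
proof -
  have "{u \<in> X. {x \<in> X. f u x \<in> {x \<in> X. P x}} \<in> q} = {u \<in> X. {x \<in> X. P (f u x)} \<in> q}"
  proof -
    have "{x \<in> X. f u x \<in> {x \<in> X. P x}} = {x \<in> X. P (f u x)}" if "u \<in> X" for u
      using that closed by auto
    then show ?thesis by auto
  qed
  then show ?thesis
    unfolding eventually_ufilt[OF prod_beta[OF assms]] eventually_ufilt[OF assms(1)]
      eventually_ufilt[OF assms(2)] mem_prod returns_def pullback_def by simp
qed

lemma ulim_prod:
  fixes \<phi> :: "'a \<Rightarrow> real"
  assumes pq: "p \<in> beta X" "q \<in> beta X" and bd: "\<And>x. \<bar>\<phi> x\<bar> \<le> C"
  shows "ulim (ufilt (prod p q)) \<phi> = ulim (ufilt p) (\<lambda>u. ulim (ufilt q) (\<lambda>x. \<phi> (f u x)))"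
proof (rule ulim_eqI[OF ultra_ufilt, symmetric])
  show "p \<in> beta X" by fact
  define l where "l = ulim (ufilt (prod p q)) \<phi>"
  have l: "(\<phi> \<longlongrightarrow> l) (ufilt (prod p q))"
    unfolding l_def by (rule ultra_tendsto_ulim[OF ultra_ufilt[OF prod_beta[OF pq]], of _ C]) (simp add: bd)
  have q: "((\<lambda>x. \<phi> (f u x)) \<longlongrightarrow> ulim (ufilt q) (\<lambda>x. \<phi> (f u x))) (ufilt q)" for u
    by (rule ultra_tendsto_ulim[OF ultra_ufilt[OF pq(2)], of _ C]) (simp add: bd)
  show "((\<lambda>u. ulim (ufilt q) (\<lambda>x. \<phi> (f u x))) \<longlongrightarrow> l) (ufilt p)"
  proof (rule tendstoI)
    fix \<epsilon> :: real assume "\<epsilon> > 0"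
    then have "eventually (\<lambda>x. \<bar>\<phi> x - l\<bar> < \<epsilon> / 2) (ufilt (prod p q))"
      using tendstoD[OF l, of "\<epsilon> / 2"] by (simp add: dist_real_def)
    then have "eventually (\<lambda>u. eventually (\<lambda>x. \<bar>\<phi> (f u x) - l\<bar> < \<epsilon> / 2) (ufilt q)) (ufilt p)"
      by (simp add: eventually_ufilt_prod[OF pq])
    then show "eventually (\<lambda>u. dist (ulim (ufilt q) (\<lambda>x. \<phi> (f u x))) l < \<epsilon>) (ufilt p)"
    proof eventually_elim
      case (elim u)
      then have "eventually (\<lambda>x. \<bar>\<phi> (f u x) - l\<bar> \<le> \<epsilon> / 2) (ufilt q)"
        by eventually_elim simp
      then have "\<bar>ulim (ufilt q) (\<lambda>x. \<phi> (f u x)) - l\<bar> \<le> \<epsilon> / 2"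
        by (rule tendsto_dist_bound[OF ultra_ne_bot[OF ultra_ufilt[OF pq(2)]] q])
      then show ?case using \<open>\<epsilon> > 0\<close> by (simp add: dist_real_def)
    qed
  qed
qed

text \<open>The set from Galvin's proof of Hindman's theorem. For an idempotent \<open>p\<close> and
  \<open>E\<close> in \<open>p\<close> it is again in \<open>p\<close> and reproduces itself under
  \<open>pullback\<close> (\<open>pullback_star\<close>), which keeps the inductive choice of
  factors going.\<close>

definition star :: "'a set set \<Rightarrow> 'a set \<Rightarrow> 'a set" where
  "star p E = E \<inter> returns p E"

lemma star_mem:
  assumes "p \<in> beta X" "prod p p = p" "E \<in> p"
  shows "star p E \<in> p"
proof -
  have "returns p E \<in> p" using assms mem_prod[of E p p] by simp
  then show ?thesis unfolding star_def using betaD(4)[OF assms(1,3)] by simp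
qed

lemma pullback_star:
  assumes p: "p \<in> beta X" "prod p p = p" and "E \<in> p" "x \<in> star p E"
  shows "pullback x (star p E) \<in> p"
proof -
  have x: "x \<in> X" "pullback x E \<in> p" using assms(4) by (auto simp: star_def returns_def)
  have "pullback v (pullback x E) = pullback (f x v) E" if "v \<in> X" for v
    unfolding pullback_def using that x(1) by (auto simp: assoc closed)
  then have "pullback x (returns p E) = returns p (pullback x E)"
    unfolding pullback_def[of x "returns p E"] using x(1) by (auto simp: returns_def closed)
  moreover have "returns p (pullback x E) \<in> p" using x(2) p(2) mem_prod[of "pullback x E" p p] by simp
  ultimately show ?thesis unfolding star_def pullback_Int using betaD(4)[OF p(1) x(2)] by simp
qed

text \<open>A Galvin-type construction: the first components are the tails \<open>b\<^sub>i b\<^sub>i\<^sub>+\<^sub>1 \<cdots> b\<^sub>n\<close> of a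
  product whose factors are chosen one after the other.\<close>

lemma idempotent_tails:
  assumes p: "p \<in> beta X" "prod p p = p" and Q: "Q \<in> p" and D: "\<And>b. b \<in> Q \<Longrightarrow> D b \<in> p"
  shows "\<exists>ws. length ws = n \<and> (\<forall>i\<in>set ws. snd i \<in> p \<and> snd i \<subseteq> Q \<and> fst i \<in> star p (snd i)) \<and>
    sorted_wrt (\<lambda>i j. \<exists>b\<in>Q. fst i = f b (fst j) \<and> snd j \<subseteq> D b) ws"
proof (induction n)
  case 0
  show ?case by (intro exI[of _ "[]"]) simp
next
  case (Suc n)
  then obtain ws where ws: "length ws = n" "\<And>i. i \<in> set ws \<Longrightarrow> snd i \<in> p \<and> snd i \<subseteq> Q \<and> fst i \<in> star p (snd i)"
    "sorted_wrt (\<lambda>i j. \<exists>b\<in>Q. fst i = f b (fst j) \<and> snd j \<subseteq> D b) ws" by auto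
  have QX: "Q \<subseteq> X" by (rule betaD(1)[OF p(1) Q])
  have wQ: "fst i \<in> Q" if "i \<in> set ws" for i using ws(2)[OF that] by (auto simp: star_def)
  \<comment> \<open>The label \<open>snd i\<close> is a set that the first component must not leave
    when later factors are multiplied on. An older entry becomes \<open>f (fst i) x\<close>, so the
    factor between it and the new entry \<open>x\<close> is \<open>fst i\<close>; therefore the new
    label must lie in every \<open>D (fst i)\<close>.\<close>
  define S where "S = Q \<inter> (X \<inter> \<Inter>((\<lambda>i. D (fst i)) ` set ws))"
  have "X \<inter> \<Inter>((\<lambda>i. D (fst i)) ` set ws) \<in> p"
    using D wQ by (intro beta_Inter_mem[OF p(1)]) auto
  then have S: "S \<in> p" unfolding S_def by (rule betaD(4)[OF p(1) Q])
  have "X \<inter> \<Inter>((\<lambda>i. pullback (fst i) (star p (snd i))) ` set ws) \<in> p"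
    using ws(2) pullback_star[OF p] by (intro beta_Inter_mem[OF p(1)]) auto
  then have "star p S \<inter> (X \<inter> \<Inter>((\<lambda>i. pullback (fst i) (star p (snd i))) ` set ws)) \<in> p"
    by (rule betaD(4)[OF p(1) star_mem[OF p S]])
  then obtain x where x: "x \<in> star p S \<inter> (X \<inter> \<Inter>((\<lambda>i. pullback (fst i) (star p (snd i))) ` set ws))"
    using beta_nonempty_mem[OF p(1)] by (metis ex_in_conv)
  have xX: "x \<in> X" using x by auto
  have fx: "f (fst i) x \<in> star p (snd i)" if "i \<in> set ws" for i
  proof -
    have "x \<in> pullback (fst i) (star p (snd i))" using x that by auto
    then show ?thesis by (simp add: pullback_def)
  qed
  define g where "g i = (f (fst i) x, snd i)" for i :: "'a \<times> 'a set"
  define vs where "vs = map g ws @ [(x, S)]"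
  have "length vs = Suc n" using ws(1) by (simp add: vs_def)
  moreover have "\<forall>i\<in>set vs. snd i \<in> p \<and> snd i \<subseteq> Q \<and> fst i \<in> star p (snd i)"
  proof
    fix i assume "i \<in> set vs"
    then consider "i = (x, S)" | j where "j \<in> set ws" "i = g j" unfolding vs_def by auto
    then show "snd i \<in> p \<and> snd i \<subseteq> Q \<and> fst i \<in> star p (snd i)"
    proof cases
      case 1
      then show ?thesis using S x by (simp add: S_def)
    next
      case 2
      then show ?thesis using ws(2)[OF 2(1)] fx by (simp add: g_def)
    qed
  qed
  moreover have "sorted_wrt (\<lambda>i j. \<exists>b\<in>Q. fst i = f b (fst j) \<and> snd j \<subseteq> D b) vs"
    unfolding vs_def sorted_wrt_append
  proof (intro conjI ballI)
    show "sorted_wrt (\<lambda>i j. \<exists>b\<in>Q. fst i = f b (fst j) \<and> snd j \<subseteq> D b) (map g ws)"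
      unfolding sorted_wrt_map
    proof (rule sorted_wrt_mono_rel[OF _ ws(3)])
      fix i j assume ij: "i \<in> set ws" "j \<in> set ws"
        and "\<exists>b\<in>Q. fst i = f b (fst j) \<and> snd j \<subseteq> D b"
      then obtain b where b: "b \<in> Q" "fst i = f b (fst j)" "snd j \<subseteq> D b" by auto
      have "fst j \<in> X" "b \<in> X" using wQ[OF ij(2)] b(1) QX by auto
      then have "f (fst i) x = f b (f (fst j) x)" using b(2) xX by (simp add: assoc)
      then show "\<exists>b\<in>Q. fst (g i) = f b (fst (g j)) \<and> snd (g j) \<subseteq> D b"
        using b by (auto simp: g_def)
    qed
    fix i j assume "i \<in> set (map g ws)" "j \<in> set [(x, S)]"
    then obtain k where k: "k \<in> set ws" "i = g k" "j = (x, S)" by auto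
    show "\<exists>b\<in>Q. fst i = f b (fst j) \<and> snd j \<subseteq> D b"
    proof
      show "fst k \<in> Q" by (rule wQ[OF k(1)])
      show "fst i = f (fst k) (fst j) \<and> snd j \<subseteq> D (fst k)" using k by (auto simp: g_def S_def)
    qed
  qed simp
  ultimately show ?case by blast
qed

text \<open>The core of the van der Corput trick for limits along an idempotent.\<close>

lemma kernel_nonneg:
  fixes \<kappa> :: "'a \<Rightarrow> 'a \<Rightarrow> real"
  assumes p: "p \<in> betaT" "prod p p = p"
    and sym: "\<And>x y. \<kappa> x y = \<kappa> y x"
    and psd: "\<And>xs. set xs \<subseteq> T \<Longrightarrow> 0 \<le> (\<Sum>x\<leftarrow>xs. \<Sum>y\<leftarrow>xs. \<kappa> x y)"
    and diag: "\<And>x. x \<in> T \<Longrightarrow> \<kappa> x x \<le> C"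
    and ev: "eventually (\<lambda>b. eventually (\<lambda>u. \<kappa> (f b u) u \<le> l) (ufilt p)) (ufilt p)"
  shows "0 \<le> l"
proof (rule ccontr)
  assume "\<not> 0 \<le> l"
  have p': "p \<in> beta X" "T \<in> p" using p(1) by (auto simp: betaT_def)
  define D where "D b = {u \<in> X. \<kappa> (f b u) u \<le> l}" for b
  define Q where "Q = T \<inter> {b \<in> X. D b \<in> p}"
  have "Q \<in> p" unfolding Q_def
    using betaD(4)[OF p'] ev by (simp add: eventually_ufilt[OF p'(1)] D_def)
  \<comment> \<open>A diagonal of \<open>n\<close> entries and \<open>n (n - 1)\<close> others, each
    at most \<open>l\<close>. The tails supply such a list: an earlier point is \<open>f b u\<close>
    for a later point \<open>u\<close> in \<open>D b\<close>, and symmetry covers the transposed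
    pairs.\<close>
  have sum_le: "(\<Sum>x\<leftarrow>xs. \<Sum>y\<leftarrow>xs. \<kappa> x y) \<le> length xs * C + length xs * (real (length xs) - 1) * l"
    if "set xs \<subseteq> T" "sorted_wrt (\<lambda>x y. \<kappa> x y \<le> l) xs" for xs
    using that
  proof (induction xs)
    case (Cons x xs)
    have "(\<Sum>y\<leftarrow>xs. \<kappa> x y) \<le> (\<Sum>y\<leftarrow>xs. l)"
      using Cons.prems(2) by (intro sum_list_mono) simp
    then have le: "(\<Sum>y\<leftarrow>xs. \<kappa> x y) \<le> length xs * l" by (simp add: sum_list_triv)
    have "(\<Sum>y\<leftarrow>xs. \<kappa> y x) = (\<Sum>y\<leftarrow>xs. \<kappa> x y)" by (simp add: sym[of _ x])
    then have "(\<Sum>z\<leftarrow>x # xs. \<Sum>y\<leftarrow>x # xs. \<kappa> z y)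
      = \<kappa> x x + 2 * (\<Sum>y\<leftarrow>xs. \<kappa> x y) + (\<Sum>z\<leftarrow>xs. \<Sum>y\<leftarrow>xs. \<kappa> z y)"
      by (simp add: sum_list_addf)
    also have "\<dots> \<le> C + 2 * (length xs * l) + (length xs * C + length xs * (real (length xs) - 1) * l)"
      using Cons diag[of x] le by (intro add_mono) auto
    also have "\<dots> = length (x # xs) * C + length (x # xs) * (real (length (x # xs)) - 1) * l"
      by (simp add: algebra_simps)
    finally show ?case .
  qed simp
  \<comment> \<open>Obtained from \<open>n + 1\<close> points after division by
    \<open>n + 1\<close>; for negative \<open>l\<close> it fails once \<open>n\<close> exceeds
    \<open>C / - l\<close>.\<close>
  have "0 \<le> C + real n * l" for n
  proof -
    obtain ws where ws: "length ws = Suc n" "\<And>i. i \<in> set ws \<Longrightarrow> snd i \<in> p \<and> snd i \<subseteq> Q \<and> fst i \<in> star p (snd i)"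
      "sorted_wrt (\<lambda>i j. \<exists>b\<in>Q. fst i = f b (fst j) \<and> snd j \<subseteq> D b) ws"
      using idempotent_tails[OF p'(1) p(2) \<open>Q \<in> p\<close>, of D "Suc n"] unfolding Q_def by auto
    define xs where "xs = map fst ws"
    have fst_snd: "fst i \<in> snd i" if "i \<in> set ws" for i using ws(2)[OF that] by (auto simp: star_def)
    have "fst i \<in> T" if "i \<in> set ws" for i
      using ws(2)[OF that] fst_snd[OF that] unfolding Q_def by auto
    then have "set xs \<subseteq> T" unfolding xs_def by auto
    moreover have "sorted_wrt (\<lambda>x y. \<kappa> x y \<le> l) xs"
      unfolding xs_def sorted_wrt_map
    proof (rule sorted_wrt_mono_rel[OF _ ws(3)])
      fix i j assume ij: "i \<in> set ws" "j \<in> set ws" and "\<exists>b\<in>Q. fst i = f b (fst j) \<and> snd j \<subseteq> D b"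
      then obtain b where b: "fst i = f b (fst j)" "snd j \<subseteq> D b" by auto
      then have "fst j \<in> D b" using fst_snd[OF ij(2)] by auto
      then show "\<kappa> (fst i) (fst j) \<le> l" using b(1) by (simp add: D_def)
    qed
    ultimately have "0 \<le> real (Suc n) * C + real (Suc n) * (real (Suc n) - 1) * l"
      using psd[of xs] sum_le[of xs] ws(1) by (simp add: xs_def)
    also have "\<dots> = real (Suc n) * (C + real n * l)" by (simp add: algebra_simps)
    finally show ?thesis by (simp add: zero_le_mult_iff)
  qed
  moreover obtain n where "C / - l < real n" using reals_Archimedean2 by blast
  then have "C + real n * l < 0" using \<open>\<not> 0 \<le> l\<close> by (simp add: field_simps)
  ultimately show False by (metis not_less)
qed

end

section \<open>Isometric representations of the affine semigroup\<close>

text \<open>The indices run over the whole field, as \<open>M (inverse u)\<close> is needed for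
  \<open>u\<close> in \<open>R\<close>; only the ultrafilters live on \<open>R\<close>. In the
  application \<open>e\<close> is the constant function 1, so \<open>ip x e\<close> is the mean of
  \<open>x\<close>, and \<open>A_M\<close> expresses
  \<open>f (u * (x + v)) = f (u * x + u * v)\<close>.\<close>

locale affine_representation = semi_inner ip + lid R
  for ip :: "'v::real_vector \<Rightarrow> 'v \<Rightarrow> real" and R :: "'k::field set" +
  fixes A M :: "'k \<Rightarrow> 'v \<Rightarrow> 'v" and e :: 'v
  assumes A_linear: "linear (A u)" and M_linear: "linear (M u)"
    and ip_A: "ip (A u x) (A u y) = ip x y"
    and ip_M: "u \<noteq> 0 \<Longrightarrow> ip (M u x) (M u y) = ip x y"
    and A_A: "A u (A v x) = A (u + v) x" and A_0: "A 0 x = x"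
    and M_M: "M u (M v x) = M (u * v) x" and M_1: "M 1 x = x"
    and A_M: "A v (M u x) = M u (A (u * v) x)"
    and A_e: "A u e = e" and M_e: "M u e = e" and ip_e: "ip e e = 1"
begin

lemma nrm_A [simp]: "nrm (A u x) = nrm x"
  by (simp add: nrm_def ip_A)

lemma nrm_M: "u \<noteq> 0 \<Longrightarrow> nrm (M u x) = nrm x"
  by (simp add: nrm_def ip_M)

lemma nrm_e: "nrm e = 1"
  by (simp add: nrm_def ip_e)

lemma ip_A_shift: "ip (A u x) y = ip x (A (- u) y)"
  using ip_A[of u x "A (- u) y"] by (simp add: A_A A_0)

lemma ip_M_shift:
  assumes "u \<noteq> 0"
  shows "ip x (M u y) = ip (M (inverse u) x) y"
  using ip_M[OF assms, of "M (inverse u) x" y] assms by (simp add: M_M M_1)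

lemma M_A: "M u (A v x) = A (inverse u * v) (M u x)" if "u \<noteq> 0"
  using that by (simp add: A_M mult.assoc[symmetric])

text \<open>Matrix coefficients of the weak limit of \<open>A u\<close> along \<open>p\<close>; the
  limit operator itself need not exist on an incomplete space.\<close>

definition coef :: "'k set set \<Rightarrow> 'v \<Rightarrow> 'v \<Rightarrow> real" where
  "coef p x y = ulim (ufilt p) (\<lambda>u. ip (A u x) y)"

lemma tendsto_coef:
  assumes "p \<in> beta R"
  shows "((\<lambda>u. ip (A u x) y) \<longlongrightarrow> coef p x y) (ufilt p)"
  unfolding coef_def by (rule tendsto_ulim_ip[OF ultra_ufilt[OF assms], of _ "nrm x" _ "nrm y"]) simp_all

lemma coef_prod:
  assumes "p \<in> beta R" "q \<in> beta R"
  shows "coef (add.prod p q) x y = ulim (ufilt p) (\<lambda>u. coef q x (A (- u) y))"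
proof -
  have bd: "\<bar>ip (A u x) y\<bar> \<le> nrm x * nrm y" for u by (rule ip_bounded) simp_all
  have "ip (A (v + u) x) y = ip (A v x) (A (- u) y)" for u v
    using ip_A_shift[of u "A v x" y] by (simp add: A_A add.commute)
  then show ?thesis
    unfolding coef_def add.ulim_prod[OF assms bd] by simp
qed

text \<open>Both sides are iterated limits of \<open>ip (A v x) (A (- u) y)\<close>, an expression
  symmetric in \<open>u\<close> and \<open>v\<close>, and \<open>ulim_commute\<close> exchanges the
  limits. Addition in \<open>beta R\<close> itself need not commute.\<close>

lemma coef_commute:
  assumes "p \<in> beta R" "q \<in> beta R"
  shows "coef (add.prod p q) = coef (add.prod q p)"
proof (intro ext)
  fix x y
  have bd: "nrm (A v x) \<le> max (nrm x) (nrm y)" "nrm (A (- u) y) \<le> max (nrm x) (nrm y)" for u v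
    by simp_all
  have eq: "ip (A v x) (A (- u) y) = ip (A u x) (A (- v) y)" for u v
    by (metis A_A add.commute ip_A_shift)
  have "coef (add.prod p q) x y = ulim (ufilt p) (\<lambda>u. ulim (ufilt q) (\<lambda>v. ip (A v x) (A (- u) y)))"
    using coef_prod[OF assms, of x y] by (simp add: coef_def)
  also have "\<dots> = ulim (ufilt q) (\<lambda>v. ulim (ufilt p) (\<lambda>u. ip (A v x) (A (- u) y)))"
    by (rule ulim_commute[OF ultra_ufilt[OF assms(1)] ultra_ufilt[OF assms(2)] bd])
  also have "\<dots> = ulim (ufilt q) (\<lambda>v. ulim (ufilt p) (\<lambda>u. ip (A u x) (A (- v) y)))"
    unfolding eq ..
  also have "\<dots> = coef (add.prod q p) x y"
    using coef_prod[OF assms(2,1), of x y] by (simp add: coef_def)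
  finally show "coef (add.prod p q) x y = coef (add.prod q p) x y" .
qed

lemma coef_cong:
  assumes "p \<in> beta R" "q \<in> beta R" "q' \<in> beta R" "coef q = coef q'"
  shows "coef (add.prod p q) = coef (add.prod p q')"
  using assms by (intro ext) (simp add: coef_prod)

text \<open>On coefficients \<open>\<beta>R\<close> acts as a commutative semigroup, whose minimal ideal contains a
  single idempotent.\<close>

lemma coef_AMI_unique:
  assumes "p \<in> AMI R" "q \<in> AMI R"
  shows "coef p = coef q"
proof -
  \<comment> \<open>Up to coefficients: \<open>q + p\<close> absorbs a further \<open>q\<close>,
    because \<open>q\<close> can be moved next to \<open>q\<close> and \<open>q + q = q\<close>.
    Hence so does \<open>p = s + (q + p)\<close>.\<close>
  have absorb: "coef (add.prod q p) = coef p" if pq: "p \<in> AMI R" "q \<in> AMI R" for p q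
  proof -
    have p: "p \<in> beta R" and q: "q \<in> beta R" "add.prod q q = q"
      using pq by (auto simp: AMI_iff)
    obtain s where s: "s \<in> beta R" "add.prod s (add.prod q p) = p"
      using pq unfolding AMI_iff by metis
    note [simp] = p q s(1) add.prod_beta
    have "coef (add.prod (add.prod q p) q) = coef (add.prod q (add.prod q p))" by (rule coef_commute) simp_all
    also have "\<dots> = coef (add.prod q p)" using q(2) by (simp flip: add.prod_assoc)
    finally have *: "coef (add.prod (add.prod q p) q) = coef (add.prod q p)" .
    have "coef (add.prod q p) = coef (add.prod p q)" by (rule coef_commute) simp_all
    also have "add.prod p q = add.prod s (add.prod (add.prod q p) q)"
      using s(2) by (metis add.prod_assoc)
    also have "coef \<dots> = coef (add.prod s (add.prod q p))" by (rule coef_cong) (simp_all add: *)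
    finally show ?thesis using s(2) by simp
  qed
  have "coef (add.prod q p) = coef (add.prod p q)"
    using assms by (intro coef_commute) (auto simp: AMI_iff)
  then show ?thesis using absorb[OF assms] absorb[OF assms(2,1)] by simp
qed

text \<open>Plays the role of \<open>ip (V x) y\<close>. The choice of \<open>p\<close> is
  immaterial by \<open>coef_AMI_unique\<close>; the value has a meaning only if \<open>AMI R\<close>
  is nonempty, hence that hypothesis in the lemmas below.\<close>

definition avg :: "'v \<Rightarrow> 'v \<Rightarrow> real" where
  "avg = coef (SOME p. p \<in> AMI R)"

lemma coef_AMI: "p \<in> AMI R \<Longrightarrow> coef p = avg"
  unfolding avg_def by (rule coef_AMI_unique) (auto intro: someI)

lemma ufilt_dilate:
  assumes "c \<in> R" "q \<in> beta R"
  shows "ufilt (dilate c q) = filtermap (\<lambda>x. c * x) (ufilt q)"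
proof -
  have "{x \<in> R. c * x \<in> {x \<in> R. P x}} = {x \<in> R. P (c * x)}" for P
    using assms(1) by (auto simp: subring)
  then show ?thesis
    by (simp add: filter_eq_iff eventually_filtermap eventually_ufilt[OF dilate_beta[OF assms]]
        eventually_ufilt[OF assms(2)] mem_dilate[OF assms(1)])
qed

text \<open>For \<open>q\<close> in \<open>AMI R\<close>, the limit of \<open>A (c * u)\<close>
  along \<open>q\<close> is that of \<open>A u\<close> along \<open>dilate c q\<close>, which is in
  \<open>AMI R\<close> too and so has the same coefficients. The common value then passes to the
  closure.\<close>

lemma tendsto_avg:
  assumes p: "p \<in> beta_topology R closure_of AMI R" and c: "c \<in> R" "c \<noteq> 0"
  shows "((\<lambda>u. ip (A (c * u) x) y) \<longlongrightarrow> avg x y) (ufilt p)"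
proof (rule tendsto_ufilt_closure[OF AMI_subset p])
  fix q assume q: "q \<in> AMI R"
  have q': "q \<in> beta R" using AMI_subset q by (rule subsetD)
  have "dilate c q \<in> AMI R" by (rule dilate_AMI[OF c q])
  then have "((\<lambda>u. ip (A u x) y) \<longlongrightarrow> avg x y) (ufilt (dilate c q))"
    using tendsto_coef[OF dilate_beta[OF c(1) q'], of x y] by (simp add: coef_AMI)
  then show "((\<lambda>u. ip (A (c * u) x) y) \<longlongrightarrow> avg x y) (ufilt q)"
    by (simp add: ufilt_dilate[OF c(1) q'] filterlim_filtermap)
qed

lemma tendsto_avg_1:
  assumes "p \<in> beta_topology R closure_of AMI R"
  shows "((\<lambda>u. ip (A u x) y) \<longlongrightarrow> avg x y) (ufilt p)"
  using tendsto_avg[OF assms, of 1 x y] subring(2) by simp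

lemma avg_abs_le:
  assumes "AMI R \<noteq> {}"
  shows "\<bar>avg x y\<bar> \<le> nrm x * nrm y"
proof -
  obtain q where q: "q \<in> AMI R" using assms by auto
  have "q \<in> beta R" using AMI_subset q by (rule subsetD)
  then have "\<bar>coef q x y\<bar> \<le> nrm x * nrm y"
    unfolding coef_def by (intro ulim_ip_abs_le ultra_ufilt) auto
  then show ?thesis using coef_AMI[OF q] by simp
qed

lemma avg_e:
  assumes "AMI R \<noteq> {}"
  shows "avg x e = ip x e"
proof -
  obtain q where q: "q \<in> AMI R" using assms by auto
  have q': "q \<in> beta R" using AMI_subset q by (rule subsetD)
  have "((\<lambda>u. ip (A u x) e) \<longlongrightarrow> ip x e) (ufilt q)"
    by (simp add: ip_A_shift A_e)
  then have "coef q x e = ip x e" unfolding coef_def by (rule ulim_eqI[OF ultra_ufilt[OF q']])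
  then show ?thesis using coef_AMI[OF q] by simp
qed

text \<open>The vector \<open>h\<close> approximates the projection of \<open>x\<close> to the compact part.\<close>

lemma compact_approximation:
  assumes ne: "AMI R \<noteq> {}" and "0 < \<delta>"
  obtains h where "\<And>y. \<bar>avg x y - ip h y\<bar> \<le> \<delta> * nrm y" "nrm h \<le> nrm x + \<delta>"
    "\<And>y. \<bar>avg (x - h) y\<bar> \<le> \<delta> * nrm y" "\<And>y. \<bar>avg h y - avg x y\<bar> \<le> \<delta> * nrm y"
proof -
  obtain q where q: "q \<in> AMI R" using ne by auto
  have q': "q \<in> beta R" "add.prod q q = q" using q by (auto simp: AMI_iff)
  note coef_q = coef_AMI[OF q]
  obtain h where h: "\<And>y. \<bar>avg x y - ip h y\<bar> \<le> \<delta> * nrm y" "nrm h \<le> nrm x + \<delta>"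
  proof (rule approx_Riesz[of "avg x" "nrm x" \<delta>])
    show "avg x (y + t *\<^sub>R z) = avg x y + t * avg x z" for y z t
      unfolding coef_q[symmetric] coef_def by (rule ulim_ip_linear[OF ultra_ufilt[OF q'(1)], of _ "nrm x"]) simp
  qed (use assms avg_abs_le[OF ne] in auto)
  \<comment> \<open>The coefficient form of \<open>V V = V\<close>: as \<open>q + q = q\<close>, the
    limit of \<open>avg x (A (- u) y)\<close> is \<open>avg x y\<close>, while \<open>ip h\<close>
    approximates \<open>avg x\<close> uniformly on the translates of \<open>y\<close>.\<close>
  have close: "\<bar>avg h y - avg x y\<bar> \<le> \<delta> * nrm y" for y
  proof -
    have "\<bar>avg x (A (- u) y)\<bar> \<le> nrm x * nrm y" for u
      using avg_abs_le[OF ne, of x "A (- u) y"] by simp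
    then have "((\<lambda>u. avg x (A (- u) y)) \<longlongrightarrow> ulim (ufilt q) (\<lambda>u. avg x (A (- u) y))) (ufilt q)"
      by (intro ultra_tendsto_ulim[OF ultra_ufilt[OF q'(1)], of _ "nrm x * nrm y"]) simp
    moreover have "ulim (ufilt q) (\<lambda>u. avg x (A (- u) y)) = avg x y"
      using coef_prod[OF q'(1) q'(1), of x y] q'(2) coef_q by simp
    ultimately have "((\<lambda>u. avg x (A (- u) y)) \<longlongrightarrow> avg x y) (ufilt q)" by simp
    moreover have "((\<lambda>u. ip h (A (- u) y)) \<longlongrightarrow> avg h y) (ufilt q)"
      using tendsto_coef[OF q'(1), of h y] by (simp add: coef_q ip_A_shift)
    moreover have "\<bar>ip h (A (- u) y) - avg x (A (- u) y)\<bar> \<le> \<delta> * nrm y" for u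
      using h(1)[of "A (- u) y"] by (simp add: abs_minus_commute)
    ultimately show ?thesis
      by (intro tendsto_dist_bound2[OF ultra_ne_bot[OF ultra_ufilt[OF q'(1)]]]) auto
  qed
  have "avg (x - h) y = avg x y - avg h y" for y
  proof -
    have "((\<lambda>u. ip (A u x) y - ip (A u h) y) \<longlongrightarrow> avg x y - avg h y) (ufilt q)"
      using tendsto_coef[OF q'(1), of x y] tendsto_coef[OF q'(1), of h y]
      unfolding coef_q by (rule tendsto_diff)
    then have "coef q (x - h) y = avg x y - avg h y"
      unfolding coef_def by (intro ulim_eqI[OF ultra_ufilt[OF q'(1)]])
        (simp add: linear_diff[OF A_linear] ip_diff)
    then show ?thesis using coef_q by simp
  qed
  then have "\<bar>avg (x - h) y\<bar> \<le> \<delta> * nrm y" for y using close[of y] by (simp add: abs_minus_commute)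
  then show ?thesis using h close by (intro that)
qed

section \<open>Limits along DC ultrafilters\<close>

lemma DC_ultrafiltersD:
  assumes "p \<in> DC_ultrafilters R"
  shows "p \<in> beta R" "p \<in> beta_topology R closure_of AMI R" "p \<in> mul.betaT" "mul.prod p p = p"
    "nonprincipal R p" "AMI R \<noteq> {}"
    "finite B \<Longrightarrow> eventually (\<lambda>u. u \<in> R - B) (ufilt p)"
proof -
  show p: "p \<in> beta R" "p \<in> beta_topology R closure_of AMI R" "p \<in> mul.betaT" "mul.prod p p = p" "nonprincipal R p"
    using assms by (auto simp: DC_ultrafilters_def MMI_def beta_times_eq beta_star_eq mul.betaT_def)
  show "AMI R \<noteq> {}" using p(2) by (metis closure_of_empty empty_iff)
  show "finite B \<Longrightarrow> eventually (\<lambda>u. u \<in> R - B) (ufilt p)"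
    by (rule eventually_ufilt_cofinite[OF p(1,5)])
qed

text \<open>A quantitative form of "\<open>V w = 0\<close> makes the limit vanish": \<open>D\<close>
  measures how far \<open>w\<close> is from that. \<open>mul.kernel_nonneg\<close> is applied to the
  vectors \<open>a u - t *\<^sub>R x\<close> for every real \<open>t\<close>, and the bound is the
  discriminant of the resulting quadratic.\<close>

lemma mixing_limit:
  assumes p: "p \<in> DC_ultrafilters R" and w: "\<And>y. \<bar>avg w y\<bar> \<le> D * nrm y"
    and l: "((\<lambda>u. ip (A u w) (M u x)) \<longlongrightarrow> l) (ufilt p)"
  shows "l\<^sup>2 \<le> D * nrm w * (nrm x)\<^sup>2"
proof -
  note p' = DC_ultrafiltersD[OF p]
  define a where "a u = M (inverse u) (A u w)" for u
  have nrm_a: "nrm (a u) = nrm w" if "u \<noteq> 0" for u using that by (simp add: a_def nrm_M)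
  have ip_a_x: "ip (a u) x = ip (A u w) (M u x)" if "u \<noteq> 0" for u
    using ip_M_shift[OF that, of "A u w" x] by (simp add: a_def)
  \<comment> \<open>Moving \<open>A (b * u)\<close> past \<open>M (inverse b)\<close> multiplies its
    index by \<open>b\<close> once more; transposing it to the other side leaves the index
    \<open>u - b * b * u\<close>.\<close>
  have ip_a_a: "ip (a (b * u)) (a u) = ip (A ((1 - b * b) * u) w) (M (inverse b) w)"
    if bu: "b \<noteq> 0" "u \<noteq> 0" for b u
  proof -
    have "ip (a (b * u)) (a u) = ip (A (b * u) w) (M (b * u) (M (inverse u) (A u w)))"
      using ip_M_shift[of "b * u" "A (b * u) w" "a u"] bu by (simp add: a_def)
    also have "\<dots> = ip (M (inverse b) (A (b * u) w)) (A u w)"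
      using ip_M_shift[OF bu(1), of "A (b * u) w" "A u w"] bu by (simp add: M_M mult.assoc)
    also have "\<dots> = ip (A (b * b * u) (M (inverse b) w)) (A u w)"
      using M_A[of "inverse b" "b * u" w] bu by (simp add: mult.assoc)
    also have "\<dots> = ip (A u w) (A (b * b * u) (M (inverse b) w))" by (rule ip_sym)
    also have "\<dots> = ip (A (- (b * b * u)) (A u w)) (M (inverse b) w)"
      using ip_A_shift[of "- (b * b * u)" "A u w" "M (inverse b) w"] by simp
    also have "A (- (b * b * u)) (A u w) = A ((1 - b * b) * u) w" by (simp add: A_A algebra_simps)
    finally show ?thesis .
  qed
  have "0 \<le> D * nrm w - 2 * t * l + t\<^sup>2 * ip x x" for t
  proof (rule field_le_epsilon)
    fix \<epsilon> :: real assume "\<epsilon> > 0"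
    \<comment> \<open>Splits the error: one \<eta> for the correlation of \<open>a (b * u)\<close>
      with \<open>a u\<close>, and \<open>\<bar>t\<bar> * \<eta>\<close> for each of the two cross
      terms with \<open>x\<close>.\<close>
    define \<eta> where "\<eta> = \<epsilon> / (1 + 2 * \<bar>t\<bar>)"
    have "1 + 2 * \<bar>t\<bar> > 0" by simp
    then have "\<eta> > 0" "\<eta> * (1 + 2 * \<bar>t\<bar>) = \<epsilon>" using \<open>\<epsilon> > 0\<close> by (simp_all add: \<eta>_def)
    then have \<eta>: "\<eta> > 0" "\<eta> + 2 * \<bar>t\<bar> * \<eta> = \<epsilon>" by (simp_all add: algebra_simps)
    define c where "c u = a u - t *\<^sub>R x" for u
    define \<kappa> where "\<kappa> u v = ip (c u) (c v)" for u v
    have "0 \<le> D * nrm w - 2 * t * l + t\<^sup>2 * ip x x + \<epsilon>"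
    proof (rule mul.kernel_nonneg[OF p'(3,4), of \<kappa>])
      show "\<kappa> u v = \<kappa> v u" for u v by (simp add: \<kappa>_def ip_sym)
      show "0 \<le> (\<Sum>x\<leftarrow>xs. \<Sum>y\<leftarrow>xs. \<kappa> x y)" for xs unfolding \<kappa>_def by (rule Gram_nonneg)
      show "\<kappa> u u \<le> (nrm w + nrm (t *\<^sub>R x))\<^sup>2" if "u \<in> R - {0}" for u
      proof -
        have "nrm (c u) \<le> nrm w + nrm (t *\<^sub>R x)"
          using nrm_diff_le[of "a u" "t *\<^sub>R x"] nrm_a[of u] that by (simp add: c_def)
        then have "(nrm (c u))\<^sup>2 \<le> (nrm w + nrm (t *\<^sub>R x))\<^sup>2" by (intro power_mono) auto
        then show ?thesis by (simp add: \<kappa>_def nrm_power2)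
      qed
      have ev_l: "eventually (\<lambda>u. \<bar>ip (A u w) (M u x) - l\<bar> < \<eta>) (ufilt p)"
        using tendstoD[OF l \<eta>(1)] by (simp add: dist_real_def)
      then have "eventually (\<lambda>u. \<bar>ip (A u w) (M u x) - l\<bar> < \<eta>) (ufilt (mul.prod p p))"
        by (simp add: p'(4))
      \<comment> \<open>Multiplicative idempotence gives the cross term at \<open>b * u\<close> the
        same limit as the one at \<open>u\<close>.\<close>
      then have ev_l': "eventually (\<lambda>b. eventually (\<lambda>u. \<bar>ip (A (b * u) w) (M (b * u) x) - l\<bar> < \<eta>) (ufilt p)) (ufilt p)"
        by (simp add: mul.eventually_ufilt_prod[OF p'(1,1)])
      show "eventually (\<lambda>b. eventually (\<lambda>u. \<kappa> (b * u) u \<le> D * nrm w - 2 * t * l + t\<^sup>2 * ip x x + \<epsilon>) (ufilt p)) (ufilt p)"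
        using ev_l' p'(7)[of "{0, 1, - 1}", simplified]
      proof eventually_elim
        case (elim b)
        \<comment> \<open>Excluding 0, 1 and -1 makes \<open>b\<close> invertible and
          \<open>1 - b * b\<close> nonzero, as \<open>tendsto_avg\<close> requires.\<close>
        then have b: "b \<in> R" "b \<noteq> 0" "b \<noteq> 1" "b \<noteq> - 1" by auto
        have "1 - b * b \<in> R" using b subring by auto
        moreover have "1 - b * b \<noteq> 0"
        proof
          assume "1 - b * b = 0"
          then have "(1 - b) * (1 + b) = 0" by (simp add: algebra_simps)
          then have "1 - b = 0 \<or> 1 + b = 0" by (rule iffD1[OF mult_eq_0_iff])
          then show False using b(3,4) by (metis add_eq_0_iff right_minus_eq)
        qed
        ultimately have lim: "((\<lambda>u. ip (A ((1 - b * b) * u) w) (M (inverse b) w)) \<longlongrightarrow> avg w (M (inverse b) w)) (ufilt p)"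
          by (rule tendsto_avg[OF p'(2)])
        have "avg w (M (inverse b) w) \<le> D * nrm w"
          using w[of "M (inverse b) w"] b by (simp add: nrm_M)
        then have "avg w (M (inverse b) w) < D * nrm w + \<eta>" using \<eta> by simp
        then have "eventually (\<lambda>u. ip (A ((1 - b * b) * u) w) (M (inverse b) w) < D * nrm w + \<eta>) (ufilt p)"
          using lim by (rule order_tendstoD(2)[rotated])
        with elim(1) ev_l p'(7)[of "{0}", simplified] show ?case
        proof eventually_elim
          case (elim u)
          then have u: "u \<noteq> 0" by simp
          have "\<kappa> (b * u) u = ip (a (b * u)) (a u) - t * ip (a (b * u)) x - t * ip (a u) x + t\<^sup>2 * ip x x"
            using ip_sym[of x "a u"] by (simp add: \<kappa>_def c_def ip_simps power2_eq_square algebra_simps)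
          moreover have "ip (a (b * u)) (a u) < D * nrm w + \<eta>" using elim(4) by (simp add: ip_a_a[OF b(2) u])
          moreover have "\<bar>t * (ip (a (b * u)) x - l)\<bar> \<le> \<bar>t\<bar> * \<eta>"
            unfolding abs_mult using elim(1) b u by (intro mult_left_mono) (auto simp: ip_a_x)
          moreover have "\<bar>t * (ip (a u) x - l)\<bar> \<le> \<bar>t\<bar> * \<eta>"
            unfolding abs_mult using elim(2) u by (intro mult_left_mono) (auto simp: ip_a_x)
          ultimately show ?case using \<eta>(2) by (simp add: algebra_simps)
        qed
      qed
    qed
    then show "0 \<le> D * nrm w - 2 * t * l + t\<^sup>2 * ip x x + \<epsilon>" .
  qed
  then have "l\<^sup>2 \<le> D * nrm w * ip x x" by (rule quadratic_discriminant_le) (rule ip_nonneg)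
  then show ?thesis by (simp add: nrm_power2)
qed

text \<open>Subtracting \<open>m *\<^sub>R e\<close> with \<open>m = ip h e\<close> centres the
  vectors \<open>M u h\<close>. As \<open>M\<close> is commutative and isometric, the kernel at
  \<open>b * u\<close> and \<open>u\<close> is \<open>ip h (M b h) - m\<^sup>2\<close> for nonzero
  \<open>b\<close> and \<open>u\<close>, so its limit must be nonnegative by
  \<open>mul.kernel_nonneg\<close>.\<close>

lemma multiplicative_limit:
  assumes p: "p \<in> DC_ultrafilters R"
    and l: "((\<lambda>u. ip h (M u h)) \<longlongrightarrow> l) (ufilt p)"
  shows "(ip h e)\<^sup>2 \<le> l"
proof -
  note p' = DC_ultrafiltersD[OF p]
  define m where "m = ip h e"
  have ip_M_e: "ip (M u h) e = m" if "u \<noteq> 0" for u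
    using ip_M[OF that, of h e] by (simp add: M_e m_def)
  define c where "c u = M u h - m *\<^sub>R e" for u
  define \<kappa> where "\<kappa> u v = ip (c u) (c v)" for u v
  have \<kappa>: "\<kappa> u v = ip (M u h) (M v h) - m\<^sup>2" if "u \<noteq> 0" "v \<noteq> 0" for u v
    using ip_M_e[OF that(1)] ip_M_e[OF that(2)] ip_sym[of e "M v h"]
    by (simp add: \<kappa>_def c_def ip_simps ip_e power2_eq_square algebra_simps)
  have "0 \<le> l - m\<^sup>2"
  proof (rule field_le_epsilon)
    fix \<epsilon> :: real assume "\<epsilon> > 0"
    show "0 \<le> l - m\<^sup>2 + \<epsilon>"
    proof (rule mul.kernel_nonneg[OF p'(3,4), of \<kappa>])
      show "\<kappa> u v = \<kappa> v u" for u v by (simp add: \<kappa>_def ip_sym)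
      show "0 \<le> (\<Sum>x\<leftarrow>xs. \<Sum>y\<leftarrow>xs. \<kappa> x y)" for xs unfolding \<kappa>_def by (rule Gram_nonneg)
      show "\<kappa> u u \<le> ip h h" if "u \<in> R - {0}" for u
        using that by (simp add: \<kappa> ip_M)
      have "eventually (\<lambda>b. ip h (M b h) < l + \<epsilon>) (ufilt p)"
        using order_tendstoD(2)[OF l] \<open>\<epsilon> > 0\<close> by simp
      then show "eventually (\<lambda>b. eventually (\<lambda>u. \<kappa> (b * u) u \<le> l - m\<^sup>2 + \<epsilon>) (ufilt p)) (ufilt p)"
        using p'(7)[of "{0}", simplified]
      proof eventually_elim
        case (elim b)
        show ?case
          using p'(7)[of "{0}", simplified]
        proof eventually_elim
          case (elim u)
          have "ip (M (b * u) h) (M u h) = ip (M u (M b h)) (M u h)" by (simp add: M_M mult.commute)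
          also have "\<dots> = ip h (M b h)" using elim by (simp add: ip_M ip_sym)
          finally show ?case using \<open>ip h (M b h) < l + \<epsilon>\<close> elim \<open>b \<in> R \<and> b \<noteq> 0\<close> by (simp add: \<kappa>)
        qed
      qed
    qed
  qed
  then show ?thesis by (simp add: m_def)
qed

text \<open>With \<open>x = w + h\<close> the correlation splits into four limits: \<open>l1\<close>
  sees the mixing part \<open>w\<close>, \<open>l2\<close> the displacement of \<open>h\<close>
  under \<open>A\<close>, \<open>l3\<close> is a cross term and \<open>l4\<close> the main term. The
  square roots bound \<open>l1\<close> and \<open>l2\<close>; \<open>7 = 5 + 2\<close> adds the
  errors of \<open>l3\<close> and of replacing \<open>ip x e\<close> by \<open>ip h e\<close>. As
  \<open>\<delta> \<le> 1\<close>, \<open>N\<close> dominates \<open>nrm h\<close>.\<close>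

lemma affine_limit_lower_bound:
  assumes p: "p \<in> DC_ultrafilters R"
    and l: "((\<lambda>u. ip (A u x) (M u x)) \<longlongrightarrow> l) (ufilt p)"
    and \<delta>: "0 < \<delta>" "\<delta> \<le> 1" and N: "N = nrm x + 1"
  shows "(ip x e)\<^sup>2 - 7 * \<delta> * N - 2 * sqrt (4 * \<delta> * N ^ 3) \<le> l"
proof -
  note p' = DC_ultrafiltersD[OF p]
  note ultra_p = ultra_ufilt[OF p'(1)]
  note nonbot = ultra_ne_bot[OF ultra_p]
  obtain h where h: "\<And>y. \<bar>avg x y - ip h y\<bar> \<le> \<delta> * nrm y" "nrm h \<le> nrm x + \<delta>"
    "\<And>y. \<bar>avg (x - h) y\<bar> \<le> \<delta> * nrm y" "\<And>y. \<bar>avg h y - avg x y\<bar> \<le> \<delta> * nrm y"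
    using compact_approximation[OF p'(6) \<delta>(1)] by metis
  define w where "w = x - h"
  have nrm: "nrm x \<le> N" "nrm h \<le> N" "nrm w \<le> 2 * N" "1 \<le> N"
    using h(2) \<delta> nrm_diff_le[of x h] N by (auto simp: w_def)
  have ev0: "eventually (\<lambda>u. u \<in> R \<and> u \<noteq> 0) (ufilt p)" using p'(7)[of "{0}"] by simp
  have ex_lim: "((\<lambda>u. ip (g u) (M u y)) \<longlongrightarrow> ulim (ufilt p) (\<lambda>u. ip (g u) (M u y))) (ufilt p)"
    if g: "\<And>u. nrm (g u) \<le> C" for g y C
  proof (rule ultra_tendsto_ulim[OF ultra_p])
    show "eventually (\<lambda>u. \<bar>ip (g u) (M u y)\<bar> \<le> C * nrm y) (ufilt p)"
      using ev0 by eventually_elim (auto intro!: ip_bounded g simp: nrm_M)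
  qed

  obtain l1 where l1: "((\<lambda>u. ip (A u w) (M u x)) \<longlongrightarrow> l1) (ufilt p)"
    using ex_lim[of "\<lambda>u. A u w" "nrm w" x] by auto
  obtain l2 where l2: "((\<lambda>u. ip (A u h - h) (M u x)) \<longlongrightarrow> l2) (ufilt p)"
    using ex_lim[of "\<lambda>u. A u h - h" "nrm h + nrm h" x] nrm_diff_le[of "A _ h" h] by auto
  obtain l3 where l3: "((\<lambda>u. ip h (M u w)) \<longlongrightarrow> l3) (ufilt p)"
    using ex_lim[of "\<lambda>u. h" "nrm h" w] by auto
  obtain l4 where l4: "((\<lambda>u. ip h (M u h)) \<longlongrightarrow> l4) (ufilt p)"
    using ex_lim[of "\<lambda>u. h" "nrm h" h] by auto
  have "ip (A u x) (M u x) = ip (A u w) (M u x) + ip (A u h - h) (M u x) + ip h (M u w) + ip h (M u h)" for u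
    by (simp add: w_def linear_diff[OF A_linear] linear_diff[OF M_linear] ip_diff)
  then have "((\<lambda>u. ip (A u x) (M u x)) \<longlongrightarrow> l1 + l2 + l3 + l4) (ufilt p)"
    using l1 l2 l3 l4 by (auto intro!: tendsto_add)
  then have l_eq: "l = l1 + l2 + l3 + l4" by (rule tendsto_unique[OF nonbot l])

  have "l1\<^sup>2 \<le> \<delta> * nrm w * (nrm x)\<^sup>2"
    by (rule mixing_limit[OF p _ l1]) (use h(3) in \<open>simp add: w_def\<close>)
  also have "\<dots> \<le> \<delta> * (2 * N) * N\<^sup>2"
    using nrm \<delta> by (intro mult_mono power_mono) auto
  also have "\<dots> \<le> 4 * \<delta> * N ^ 3" using nrm(4) \<delta> by (simp add: power2_eq_square power3_eq_cube)
  finally have l1_le: "\<bar>l1\<bar> \<le> sqrt (4 * \<delta> * N ^ 3)" by (metis real_sqrt_abs real_sqrt_le_mono)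

  \<comment> \<open>The square of \<open>nrm (A u h - h)\<close> is
    \<open>2 * ip h h - 2 * ip (A u h) h\<close>, whose limit is small because
    \<open>avg h h\<close>, \<open>avg x h\<close> and \<open>ip h h\<close> nearly agree: weak
    convergence without loss of norm is convergence in norm.\<close>
  have "l2\<^sup>2 \<le> (2 * ip h h - 2 * avg h h) * N\<^sup>2"
  proof (rule tendsto_le[OF nonbot])
    show "((\<lambda>u. (2 * ip h h - 2 * ip (A u h) h) * N\<^sup>2) \<longlongrightarrow> (2 * ip h h - 2 * avg h h) * N\<^sup>2) (ufilt p)"
      by (intro tendsto_intros tendsto_avg_1[OF p'(2)])
    show "((\<lambda>u. (ip (A u h - h) (M u x))\<^sup>2) \<longlongrightarrow> l2\<^sup>2) (ufilt p)" by (intro tendsto_intros l2)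
    show "eventually (\<lambda>u. (ip (A u h - h) (M u x))\<^sup>2 \<le> (2 * ip h h - 2 * ip (A u h) h) * N\<^sup>2) (ufilt p)"
      using ev0
    proof eventually_elim
      case (elim u)
      have "\<bar>ip (A u h - h) (M u x)\<bar> \<le> nrm (A u h - h) * N"
        using nrm(1) elim by (intro ip_bounded) (auto simp: nrm_M)
      then have "(ip (A u h - h) (M u x))\<^sup>2 \<le> (nrm (A u h - h) * N)\<^sup>2"
        by (metis abs_ge_zero power2_abs power_mono)
      also have "\<dots> = ip (A u h - h) (A u h - h) * N\<^sup>2" by (simp add: power_mult_distrib nrm_power2)
      also have "ip (A u h - h) (A u h - h) = 2 * ip h h - 2 * ip (A u h) h"
        using ip_sym[of h "A u h"] by (simp add: ip_diff ip_A)
      finally show ?case .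
    qed
  qed
  also have "\<dots> \<le> (4 * \<delta> * N) * N\<^sup>2"
  proof (rule mult_right_mono)
    have "\<delta> * nrm h \<le> \<delta> * N" using nrm(2) \<delta> by simp
    then show "2 * ip h h - 2 * avg h h \<le> 4 * \<delta> * N" using h(1)[of h] h(4)[of h] by linarith
  qed simp
  also have "\<dots> = 4 * \<delta> * N ^ 3" by (simp add: power2_eq_square power3_eq_cube)
  finally have l2_le: "\<bar>l2\<bar> \<le> sqrt (4 * \<delta> * N ^ 3)" by (metis real_sqrt_abs real_sqrt_le_mono)

  have l3_le: "\<bar>l3\<bar> \<le> 5 * \<delta> * N"
  proof -
    have "\<bar>l3 - 0\<bar> \<le> 5 * \<delta> * N"
    proof (rule tendsto_dist_bound[OF nonbot l3])
      show "eventually (\<lambda>u. \<bar>ip h (M u w) - 0\<bar> \<le> 5 * \<delta> * N) (ufilt p)"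
        using ev0
      proof eventually_elim
        case (elim u)
        define g where "g = M u w"
        \<comment> \<open>Up to transposition \<open>V\<close> commutes with the multiplicative
          action: the index \<open>- u * v\<close> is a dilate of \<open>v\<close> by a nonzero
          element of \<open>R\<close>, so \<open>tendsto_avg\<close> applies. Thus
          \<open>avg h g\<close> is a coefficient of \<open>w\<close> and hence small.\<close>
        have "ip (A v h) g = ip (A (- u * v) w) (M (inverse u) h)" for v
        proof -
          have "ip (A v h) g = ip (M (inverse u) (A v h)) w"
            unfolding g_def using ip_M_shift elim by blast
          also have "\<dots> = ip (A (u * v) (M (inverse u) h)) w" using M_A[of "inverse u" v h] elim by simp
          also have "\<dots> = ip (A (- u * v) w) (M (inverse u) h)"
            by (simp add: ip_A_shift ip_sym[of w] ip_sym[of "A _ w"])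
          finally show ?thesis .
        qed
        then have "((\<lambda>v. ip (A v h) g) \<longlongrightarrow> avg w (M (inverse u) h)) (ufilt p)"
          using tendsto_avg[OF p'(2), of "- u" w "M (inverse u) h"] elim subring(3) by simp
        then have "avg h g = avg w (M (inverse u) h)"
          by (rule tendsto_unique[OF nonbot tendsto_avg_1[OF p'(2)]])
        then have "\<bar>avg h g\<bar> \<le> \<delta> * nrm h"
          using h(3)[of "M (inverse u) h"] elim by (simp add: w_def nrm_M)
        moreover have "nrm g = nrm w" using elim by (simp add: g_def nrm_M)
        moreover have "\<delta> * nrm h \<le> \<delta> * N" "\<delta> * nrm w \<le> \<delta> * (2 * N)" using nrm \<delta> by (auto intro: mult_left_mono)
        \<comment> \<open>Passing from \<open>ip h g\<close> through \<open>avg x g\<close> to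
          \<open>avg h g\<close> costs \<open>2 * \<delta> * nrm g\<close> with
          \<open>nrm g \<le> 2 * N\<close>; adding \<open>\<delta> * nrm h\<close> gives the factor
          5.\<close>
        ultimately have "\<bar>ip h g\<bar> \<le> 5 * (\<delta> * N)" using h(1)[of g] h(4)[of g] by auto
        then show ?case by (simp add: g_def)
      qed
    qed
    then show ?thesis by simp
  qed

  have "(ip x e)\<^sup>2 - 2 * \<delta> * N \<le> (ip h e)\<^sup>2"
  proof -
    define d where "d = ip h e - ip x e"
    \<comment> \<open>Since \<open>A\<close> fixes \<open>e\<close>, averaging preserves the mean:
      \<open>avg x e = ip x e\<close>.\<close>
    have "\<bar>d\<bar> \<le> \<delta>" using h(1)[of e] by (simp add: d_def avg_e[OF p'(6)] nrm_e abs_minus_commute)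
    moreover have "\<bar>ip x e\<bar> \<le> N" using Cauchy_Schwarz[of x e] nrm(1) by (simp add: nrm_e)
    ultimately have "\<bar>ip x e\<bar> * \<bar>d\<bar> \<le> N * \<delta>" by (intro mult_mono) auto
    then have "\<bar>ip x e * d\<bar> \<le> N * \<delta>" by (simp add: abs_mult)
    moreover have "(ip h e)\<^sup>2 = (ip x e)\<^sup>2 + 2 * (ip x e * d) + d\<^sup>2"
      by (simp add: d_def power2_eq_square algebra_simps)
    ultimately show ?thesis using zero_le_power2[of d] by (simp add: algebra_simps abs_le_iff)
  qed
  then have "(ip x e)\<^sup>2 - 2 * \<delta> * N \<le> l4" using multiplicative_limit[OF p l4] by linarith
  then show ?thesis using l1_le l2_le l3_le unfolding l_eq by linarith
qed

lemma affine_recurrence: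
  assumes p: "p \<in> DC_ultrafilters R" and "\<epsilon> > 0"
  shows "eventually (\<lambda>u. ip (A u x) (M u x) > (ip x e)\<^sup>2 - \<epsilon>) (ufilt p)"
proof -
  note p' = DC_ultrafiltersD[OF p]
  define N where "N = nrm x + 1"
  define l where "l = ulim (ufilt p) (\<lambda>u. ip (A u x) (M u x))"
  have l: "((\<lambda>u. ip (A u x) (M u x)) \<longlongrightarrow> l) (ufilt p)"
    unfolding l_def
  proof (rule ultra_tendsto_ulim[OF ultra_ufilt[OF p'(1)]])
    show "eventually (\<lambda>u. \<bar>ip (A u x) (M u x)\<bar> \<le> nrm x * nrm x) (ufilt p)"
      using p'(7)[of "{0}", simplified] by eventually_elim (auto intro!: ip_bounded simp: nrm_M)
  qed
  have "((\<lambda>\<delta>. (ip x e)\<^sup>2 - 7 * \<delta> * N - 2 * sqrt (4 * \<delta> * N ^ 3))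
      \<longlongrightarrow> (ip x e)\<^sup>2 - 7 * 0 * N - 2 * sqrt (4 * 0 * N ^ 3)) (at_right 0)"
    by (intro tendsto_intros)
  moreover have "eventually (\<lambda>\<delta>. (ip x e)\<^sup>2 - 7 * \<delta> * N - 2 * sqrt (4 * \<delta> * N ^ 3) \<le> l) (at_right 0)"
    using eventually_at_right_real[of 0 1, OF zero_less_one]
    by (rule eventually_mono) (auto intro: affine_limit_lower_bound[OF p l] simp: N_def)
  ultimately have "(ip x e)\<^sup>2 - 7 * 0 * N - 2 * sqrt (4 * 0 * N ^ 3) \<le> l"
    by (rule tendsto_upperbound) simp
  then have "(ip x e)\<^sup>2 - \<epsilon> < l" using \<open>\<epsilon> > 0\<close> by simp
  then show ?thesis by (rule order_tendstoD(1)[OF l])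
qed

end

section \<open>The mean along a double Folner sequence\<close>

text \<open>Boundedness of the functions makes their averages bounded, so that limits along an
  ultrafilter exist; a type is required because the vectors of \<open>semi_inner\<close> form a
  \<open>real_vector\<close> type.\<close>

typedef 'a bounded_fun = "{f :: 'a \<Rightarrow> real. bounded (range f)}"
  morphisms apply_bf Bf
  by (rule exI[of _ "\<lambda>_. 0"]) auto

setup_lifting type_definition_bounded_fun

instantiation bounded_fun :: (type) real_vector
begin

lift_definition zero_bounded_fun :: "'a bounded_fun" is "\<lambda>_. 0" by auto
lift_definition plus_bounded_fun :: "'a bounded_fun \<Rightarrow> 'a bounded_fun \<Rightarrow> 'a bounded_fun"
  is "\<lambda>f g x. f x + g x" by (rule bounded_plus_comp)
lift_definition uminus_bounded_fun :: "'a bounded_fun \<Rightarrow> 'a bounded_fun" is "\<lambda>f x. - f x"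
  by (auto simp: bounded_iff)
lift_definition minus_bounded_fun :: "'a bounded_fun \<Rightarrow> 'a bounded_fun \<Rightarrow> 'a bounded_fun"
  is "\<lambda>f g x. f x - g x" by (rule bounded_minus_comp)
lift_definition scaleR_bounded_fun :: "real \<Rightarrow> 'a bounded_fun \<Rightarrow> 'a bounded_fun" is "\<lambda>c f x. c * f x"
  using bounded_scaling[of "range _"] by (force simp: image_image)

instance
  by standard (transfer; simp add: fun_eq_iff algebra_simps)+

end

lift_definition translate :: "'k::field \<Rightarrow> 'k bounded_fun \<Rightarrow> 'k bounded_fun" is "\<lambda>u f x. f (x + u)"
  by (auto elim!: bounded_subset)

lift_definition rescale :: "'k::field \<Rightarrow> 'k bounded_fun \<Rightarrow> 'k bounded_fun" is "\<lambda>u f x. f (u * x)"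
  by (auto elim!: bounded_subset)

lift_definition one_bf :: "'k bounded_fun" is "\<lambda>_. 1" by auto

lift_definition indicator_bf :: "'k set \<Rightarrow> 'k bounded_fun" is "\<lambda>E x. indicator E x"
  by (auto simp: bounded_iff indicator_def)

lemma apply_bf_bounded:
  obtains C where "0 \<le> C" "\<And>x. \<bar>apply_bf f x\<bar> \<le> C"
proof -
  have "bounded (range (apply_bf f))" using apply_bf[of f] by simp
  then obtain C where C: "\<And>x. \<bar>apply_bf f x\<bar> \<le> C" by (auto simp: bounded_iff)
  then show ?thesis using that[of C] abs_ge_zero order_trans by blast
qed

definition average :: "(nat \<Rightarrow> 'a set) \<Rightarrow> ('a \<Rightarrow> real) \<Rightarrow> nat \<Rightarrow> real" where
  "average F \<phi> N = (\<Sum>x\<in>F N. \<phi> x) / card (F N)"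

lemma ultra_nat_exists:
  obtains G :: "nat filter" where "ultra G" "G \<le> sequentially"
proof -
  define \<Phi> where "\<Phi> = range (\<lambda>n::nat. {n..})"
  have "A \<inter> B \<in> \<Phi>" if AB: "A \<in> \<Phi>" "B \<in> \<Phi>" for A B
  proof -
    obtain m n where "A = {m..}" "B = {n..}" using AB by (auto simp: \<Phi>_def)
    then have "A \<inter> B = {max m n..}" by auto
    then show ?thesis by (auto simp: \<Phi>_def)
  qed
  moreover have "{} \<notin> \<Phi>" "\<Phi> \<noteq> {}" "\<Phi> \<subseteq> Pow UNIV" by (auto simp: \<Phi>_def)
  ultimately have "\<exists>p. p \<in> beta UNIV \<and> \<Phi> \<subseteq> p" using beta_extend[of \<Phi> UNIV] by metis
  then obtain p where p: "p \<in> beta (UNIV :: nat set)" "\<Phi> \<subseteq> p" by auto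
  have "ufilt p \<le> sequentially"
  proof (rule filter_leI)
    fix P :: "nat \<Rightarrow> bool" assume "eventually P sequentially"
    then obtain n where "\<And>m. m \<ge> n \<Longrightarrow> P m" by (auto simp: eventually_sequentially)
    then have "{n..} \<subseteq> {x \<in> UNIV. P x}" by auto
    moreover have "{n..} \<in> p" using p(2) by (auto simp: \<Phi>_def)
    ultimately show "eventually P (ufilt p)"
      using betaD(5)[OF p(1)] by (simp add: eventually_ufilt[OF p(1)])
  qed
  then show ?thesis using that ultra_ufilt[OF p(1)] by metis
qed

text \<open>An ultrafilter is pushed forward along a subsequence realising the limsup. The density
  of \<open>E\<close> thereby becomes a genuine limit along \<open>G\<close>; for other sets
  \<open>tendsto_le_limsup\<close> gives an inequality, in the direction that a lower bound asks
  for.\<close>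

lemma ultra_limsup:
  fixes X :: "nat \<Rightarrow> ereal"
  obtains G where "ultra G" "G \<le> sequentially" "(X \<longlongrightarrow> limsup X) G"
proof -
  obtain r where r: "strict_mono r" "(X \<circ> r) \<longlonglongrightarrow> limsup X" using limsup_subseq_lim by metis
  obtain G :: "nat filter" where G: "ultra G" "G \<le> sequentially" by (rule ultra_nat_exists)
  have "ultra (filtermap r G)"
    using G(1) by (simp add: ultra_def filtermap_bot_iff eventually_filtermap)
  moreover have "filtermap r G \<le> sequentially"
    using filtermap_mono[OF G(2), of r] filterlim_subseq[OF r(1)] by (simp add: filterlim_def)
  moreover have "(X \<longlongrightarrow> limsup X) (filtermap r G)"
    using tendsto_mono[OF G(2) r(2)] by (simp add: filterlim_filtermap comp_def)
  ultimately show ?thesis by (rule that)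
qed

lemma tendsto_le_limsup:
  fixes X :: "nat \<Rightarrow> ereal"
  assumes "G \<noteq> bot" "G \<le> sequentially" "(X \<longlongrightarrow> l) G"
  shows "l \<le> limsup X"
proof -
  have "Limsup G X \<le> limsup X"
    unfolding Limsup_def by (rule INF_superset_mono) (use assms(2) in \<open>auto simp: le_filter_def\<close>)
  then show ?thesis using lim_imp_Limsup[OF assms(1,3)] by simp
qed

locale Folner_mean =
  fixes F :: "nat \<Rightarrow> 'k::field set" and G :: "nat filter"
  assumes Folner: "double_Folner F" and ultra_G: "ultra G" and G_le: "G \<le> sequentially"
begin

lemma F_finite: "finite (F N)" "F N \<noteq> {}" "card (F N) > 0"
  using Folner by (auto simp: double_Folner_def card_gt_0_iff)

definition mean_ip :: "'k bounded_fun \<Rightarrow> 'k bounded_fun \<Rightarrow> real" where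
  "mean_ip f g = ulim G (average F (\<lambda>x. apply_bf f x * apply_bf g x))"

lemma average_abs_le:
  assumes "\<And>x. \<bar>\<phi> x\<bar> \<le> C"
  shows "\<bar>average F \<phi> N\<bar> \<le> C"
proof -
  have "\<bar>\<Sum>x\<in>F N. \<phi> x\<bar> \<le> (\<Sum>x\<in>F N. C)" by (rule order_trans[OF sum_abs sum_mono]) (rule assms)
  then show ?thesis using F_finite[of N] by (simp add: average_def field_simps abs_divide)
qed

lemma tendsto_mean_ip: "(average F (\<lambda>x. apply_bf f x * apply_bf g x) \<longlongrightarrow> mean_ip f g) G"
  unfolding mean_ip_def
proof -
  obtain C where C: "0 \<le> C" "\<And>x. \<bar>apply_bf f x\<bar> \<le> C" using apply_bf_bounded[of f] by auto
  obtain D where D: "0 \<le> D" "\<And>x. \<bar>apply_bf g x\<bar> \<le> D" using apply_bf_bounded[of g] by auto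
  have "\<bar>apply_bf f x * apply_bf g x\<bar> \<le> C * D" for x
    unfolding abs_mult by (intro mult_mono C D) auto
  then have "\<bar>average F (\<lambda>x. apply_bf f x * apply_bf g x) N\<bar> \<le> C * D" for N by (rule average_abs_le)
  then show "(average F (\<lambda>x. apply_bf f x * apply_bf g x) \<longlongrightarrow>
      ulim G (average F (\<lambda>x. apply_bf f x * apply_bf g x))) G"
    by (intro ultra_tendsto_ulim[OF ultra_G, of _ "C * D"]) simp
qed

lemma mean_ip_eqI: "(average F (\<lambda>x. apply_bf f x * apply_bf g x) \<longlongrightarrow> l) G \<Longrightarrow> mean_ip f g = l"
  unfolding mean_ip_def by (rule ulim_eqI[OF ultra_G])

text \<open>Substitution by \<open>T\<close> replaces \<open>F N\<close> by its image. The two sums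
  differ only on the symmetric difference, whose halves have equal size because \<open>T\<close> is
  injective; this is the factor 2.\<close>

lemma average_invariant:
  assumes bd: "\<And>x. \<bar>\<phi> x\<bar> \<le> C" and inj: "inj T"
    and lim: "(\<lambda>N. real (card (F N \<inter> T ` F N)) / real (card (F N))) \<longlonglongrightarrow> 1"
  shows "(\<lambda>N. average F (\<lambda>x. \<phi> (T x)) N - average F \<phi> N) \<longlonglongrightarrow> 0"
proof (rule Lim_null_comparison)
  show "(\<lambda>N. 2 * C * (1 - real (card (F N \<inter> T ` F N)) / real (card (F N)))) \<longlonglongrightarrow> 0"
    using tendsto_mult[OF tendsto_const tendsto_diff[OF tendsto_const lim], of "2 * C" 1] by simp
  show "eventually (\<lambda>N. norm (average F (\<lambda>x. \<phi> (T x)) N - average F \<phi> N)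
      \<le> 2 * C * (1 - real (card (F N \<inter> T ` F N)) / real (card (F N)))) sequentially"
  proof (rule always_eventually, rule allI)
    fix N
    define S where "S = T ` F N"
    have S: "finite S" "card S = card (F N)"
      using F_finite card_image[OF inj_on_subset[OF inj]] by (auto simp: S_def)
    have bd_sum: "\<bar>\<Sum>x\<in>B. \<phi> x\<bar> \<le> C * card B" for B
      using order_trans[OF sum_abs sum_mono[of B "\<lambda>x. \<bar>\<phi> x\<bar>" "\<lambda>_. C"]] bd by (simp add: mult.commute)
    have "(\<Sum>x\<in>F N. \<phi> (T x)) = (\<Sum>x\<in>S. \<phi> x)"
      unfolding S_def using sum.reindex[OF inj_on_subset[OF inj], of "F N" \<phi>] by simp
    also have "\<dots> = (\<Sum>x\<in>F N \<inter> S. \<phi> x) + (\<Sum>x\<in>S - F N. \<phi> x)"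
      using sum.Int_Diff[OF S(1), of \<phi> "F N"] by (simp add: Int_commute)
    finally have "(\<Sum>x\<in>F N. \<phi> (T x)) - (\<Sum>x\<in>F N. \<phi> x) = (\<Sum>x\<in>S - F N. \<phi> x) - (\<Sum>x\<in>F N - S. \<phi> x)"
      using sum.Int_Diff[OF F_finite(1), of \<phi> N S] by simp
    then have "\<bar>(\<Sum>x\<in>F N. \<phi> (T x)) - (\<Sum>x\<in>F N. \<phi> x)\<bar> \<le> C * card (S - F N) + C * card (F N - S)"
      using bd_sum[of "S - F N"] bd_sum[of "F N - S"] by linarith
    also have "real (card (S - F N)) = real (card (F N)) - real (card (F N \<inter> S))"
      using S card_Int_Diff[OF S(1), of "F N"] by (simp add: Int_commute)
    also have "real (card (F N - S)) = real (card (F N)) - real (card (F N \<inter> S))"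
      using card_Int_Diff[OF F_finite(1), of N S] by simp
    finally have "\<bar>(\<Sum>x\<in>F N. \<phi> (T x)) - (\<Sum>x\<in>F N. \<phi> x)\<bar> \<le> 2 * C * (real (card (F N)) - real (card (F N \<inter> S)))"
      by simp
    then show "norm (average F (\<lambda>x. \<phi> (T x)) N - average F \<phi> N)
        \<le> 2 * C * (1 - real (card (F N \<inter> T ` F N)) / real (card (F N)))"
      using F_finite(3)[of N] unfolding S_def[symmetric] average_def
      by (simp add: diff_divide_distrib[symmetric] abs_divide field_simps)
  qed
qed

lemma mean_ip_invariant:
  assumes inj: "inj T" and lim: "(\<lambda>N. real (card (F N \<inter> T ` F N)) / real (card (F N))) \<longlonglongrightarrow> 1"
    and "\<And>x. apply_bf f' x = apply_bf f (T x)" "\<And>x. apply_bf g' x = apply_bf g (T x)"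
  shows "mean_ip f' g' = mean_ip f g"
proof (rule mean_ip_eqI)
  obtain C where C: "0 \<le> C" "\<And>x. \<bar>apply_bf f x\<bar> \<le> C" using apply_bf_bounded[of f] by auto
  obtain D where D: "0 \<le> D" "\<And>x. \<bar>apply_bf g x\<bar> \<le> D" using apply_bf_bounded[of g] by auto
  have "\<bar>apply_bf f x * apply_bf g x\<bar> \<le> C * D" for x
    unfolding abs_mult by (intro mult_mono C D) auto
  then have "(\<lambda>N. average F (\<lambda>x. apply_bf f' x * apply_bf g' x) N
      - average F (\<lambda>x. apply_bf f x * apply_bf g x) N) \<longlonglongrightarrow> 0"
    using average_invariant[of "\<lambda>x. apply_bf f x * apply_bf g x" "C * D", OF _ inj lim] by (simp add: assms(3,4))
  from tendsto_add[OF tendsto_mono[OF G_le this] tendsto_mean_ip[of f g]]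
  show "(average F (\<lambda>x. apply_bf f' x * apply_bf g' x) \<longlongrightarrow> mean_ip f g) G" by simp
qed

lemma mean_ip_translate: "mean_ip (translate u f) (translate u g) = mean_ip f g"
proof (cases "u = 0")
  case True
  have "translate 0 f = f" for f :: "'k bounded_fun" by transfer simp
  then show ?thesis using True by simp
next
  case False
  show ?thesis
  proof (rule mean_ip_invariant[of "\<lambda>x. x + u"])
    show "(\<lambda>N. real (card (F N \<inter> (\<lambda>x. x + u) ` F N)) / real (card (F N))) \<longlonglongrightarrow> 1"
      using Folner False by (simp add: double_Folner_def)
  qed (simp_all add: translate.rep_eq)
qed

lemma mean_ip_rescale:
  assumes "u \<noteq> 0"
  shows "mean_ip (rescale u f) (rescale u g) = mean_ip f g"
proof (rule mean_ip_invariant[of "\<lambda>x. x * u"])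
  show "(\<lambda>N. real (card (F N \<inter> (\<lambda>x. x * u) ` F N)) / real (card (F N))) \<longlonglongrightarrow> 1"
    using Folner assms by (simp add: double_Folner_def)
  show "inj (\<lambda>x. x * u)" using assms by (simp add: inj_on_def)
qed (simp_all add: rescale.rep_eq mult.commute)

lemma average_linear:
  "average F (\<lambda>x. \<phi> x + \<psi> x) N = average F \<phi> N + average F \<psi> N"
  "average F (\<lambda>x. c * \<phi> x) N = c * average F \<phi> N"
  by (simp_all add: average_def sum.distrib add_divide_distrib sum_distrib_left[symmetric])

lemma average_indicator: "average F (indicator E) N = card (E \<inter> F N) / card (F N)"
  using F_finite by (simp add: average_def indicator_def sum_of_bool_eq Int_commute)

sublocale semi_inner mean_ip
proof
  fix f g h :: "'k bounded_fun" and c :: real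
  show "mean_ip (f + g) h = mean_ip f h + mean_ip g h"
    using tendsto_add[OF tendsto_mean_ip[of f h] tendsto_mean_ip[of g h]]
    by (intro mean_ip_eqI) (simp add: plus_bounded_fun.rep_eq distrib_right average_linear(1)[abs_def])
  show "mean_ip (c *\<^sub>R f) h = c * mean_ip f h"
    using tendsto_mult_left[OF tendsto_mean_ip[of f h], of c]
    by (intro mean_ip_eqI) (simp add: scaleR_bounded_fun.rep_eq mult.assoc average_linear(2)[abs_def])
  show "mean_ip f g = mean_ip g f" by (simp add: mean_ip_def mult.commute)
  have "0 \<le> average F (\<lambda>x. apply_bf f x * apply_bf f x) N" for N
    unfolding average_def by (intro divide_nonneg_nonneg sum_nonneg) auto
  then show "0 \<le> mean_ip f f"
    by (intro tendsto_lowerbound[OF tendsto_mean_ip[of f f]]) (auto simp: ultra_ne_bot[OF ultra_G])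
qed

lemma affine_representation:
  assumes "large_ideal_domain R"
  shows "affine_representation mean_ip R translate rescale one_bf"
proof unfold_locales
  show "large_ideal_domain R" by fact
  show "mean_ip one_bf one_bf = 1"
    using F_finite by (intro mean_ip_eqI) (simp add: average_def[abs_def] one_bf.rep_eq)
qed (rule mean_ip_translate | (rule mean_ip_rescale, assumption) | (transfer, simp add: fun_eq_iff algebra_simps))+

lemma tendsto_density:
  assumes "\<And>x. apply_bf f x * apply_bf g x = indicator E x"
  shows "((\<lambda>N. ereal (real (card (E \<inter> F N)) / real (card (F N)))) \<longlongrightarrow> ereal (mean_ip f g)) G"
  using tendsto_mean_ip[of f g] by (simp add: assms average_indicator[abs_def])

end

theorem theorem5p15:
  fixes R E :: "'k::{field,countable} set"
    and F :: "nat \<Rightarrow> 'k set"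
    and \<epsilon> :: real
  assumes "is_subring R"
    and "large_ideal_domain R"
    and "double_Folner F"
    and "upper_density F E > 0"
    and "\<epsilon> > 0"
  shows "let S = {u \<in> R - {0}.
            upper_density F (shift_minus E u \<inter> shift_divide E u)
              > (upper_density F E)\<^sup>2 - ereal \<epsilon>}
         in DC_star R S \<and> affinely_syndetic R S"
proof -
  define S where "S = {u \<in> R - {0}.
            upper_density F (shift_minus E u \<inter> shift_divide E u)
              > (upper_density F E)\<^sup>2 - ereal \<epsilon>}"
  obtain G where G: "ultra G" "G \<le> sequentially"
    "((\<lambda>N. ereal (real (card (E \<inter> F N)) / real (card (F N)))) \<longlongrightarrow> upper_density F E) G"
    unfolding upper_density_def by (rule ultra_limsup)
  note nonbot = ultra_ne_bot[OF G(1)]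
  interpret Folner_mean F G using assms(3) G(1,2) by unfold_locales
  interpret affine_representation mean_ip R translate rescale one_bf
    by (rule affine_representation[OF assms(2)])
  define f where "f = indicator_bf E"
  have "((\<lambda>N. ereal (real (card (E \<inter> F N)) / real (card (F N)))) \<longlongrightarrow> ereal (mean_ip f one_bf)) G"
    by (rule tendsto_density) (simp add: f_def indicator_bf.rep_eq one_bf.rep_eq)
  with G(3) have density: "upper_density F E = ereal (mean_ip f one_bf)"
    by (rule tendsto_unique[OF nonbot])
  \<comment> \<open>The product of the two shifted indicators is the indicator of the intersection,
    so \<open>mean_ip\<close> is a limit of its densities along \<open>G\<close> and cannot exceed
    their limsup.\<close>
  have lower: "ereal (mean_ip (translate u f) (rescale u f)) \<le> upper_density F (shift_minus E u \<inter> shift_divide E u)" for u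
    unfolding upper_density_def
  proof (rule tendsto_le_limsup[OF nonbot G(2) tendsto_density])
    show "apply_bf (translate u f) x * apply_bf (rescale u f) x
        = indicator (shift_minus E u \<inter> shift_divide E u) x" for x
      by (simp add: f_def translate.rep_eq rescale.rep_eq indicator_bf.rep_eq shift_minus_def
          shift_divide_def indicator_def)
  qed
  have "S \<in> p" if p: "p \<in> DC_ultrafilters R" for p
  proof -
    note p' = DC_ultrafiltersD[OF p]
    have "eventually (\<lambda>u. u \<in> S) (ufilt p)"
      using affine_recurrence[OF p \<open>\<epsilon> > 0\<close>, of f] p'(7)[of "{0}", simplified]
    proof eventually_elim
      case (elim u)
      have "(upper_density F E)\<^sup>2 - ereal \<epsilon> = ereal ((mean_ip f one_bf)\<^sup>2 - \<epsilon>)"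
        by (simp add: density power2_eq_square)
      also have "\<dots> < ereal (mean_ip (translate u f) (rescale u f))" using elim(1) by simp
      also note lower[of u]
      finally show ?case using elim(2) by (simp add: S_def)
    qed
    then have "{u \<in> R. u \<in> S} \<in> p" by (simp add: eventually_ufilt[OF p'(1)])
    moreover have "{u \<in> R. u \<in> S} = S" by (auto simp: S_def)
    ultimately show ?thesis by simp
  qed
  then have "DC_star R S \<and> affinely_syndetic R S"
    by (intro DC_star_affinely_syndetic) (auto simp: S_def)
  then show ?thesis unfolding S_def Let_def .
qed

end
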